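(* For $\tau$ in the upper half-plane and $z\in\mathbb C$, with $q=e^{2\pi i\tau}$ and $\zeta=e^{2\pi i z}$, \[ \vartheta(2\tau,2z)^4 =\sum_{\substack{n\in \mathbb N \\ n \text{ odd}}} \left( \sum_{\substack{r\in \mathbb Z,\; r\text{ even} \\ 4 n-r^2 \geq 0}} 12H^{(2)}(4n-r^2)\zeta^{2r}-\sum_{\substack{r\in\mathbb Z,\; r\text{ odd} \\ 4 n-r^2 \geq 0}} 12H(4n-r^2)\zeta^{2r} \right) q^n. \]
   Context: The odd Jacobi theta series is $\vartheta(\tau,z)=q^{1/8}\zeta^{1/2}\sum_{n\in\mathbb Z}(-1)^n q^{n(n+1)/2}\zeta^n$ (with $q^{1/8}=e^{2\pi i\tau/8}$, $\zeta^{1/2}=e^{\pi i z}$). $\mathbb N=\{0,1,2,\dots\}$. $H(D)$ is the Hurwitz class number: $H(0)=-1/12$; for $D>0$, $H(D)$ is the number of $\mathrm{SL}_2(\mathbb Z)$-classes of positive definite integral binary quadratic forms of discriminant $-D$, weighted by $1/2$ for the class of $a(x^2+y^2)$ and $1/3$ for the class of $a(x^2+xy+y^2)$; $H(D)=0$ if $D<0$ or $D\equiv1,2\pmod 4$. $H^{(2)}(D)=H(4D)-2H(D)$ if $D\equiv 0,3\pmod 4$, and $H^{(2)}(D)=0$ otherwise. *)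

theory Defs
  imports "HOL-Analysis.Analysis"
begin

text \<open>
  The prefactors \<open>q\<^sup>1\<^sup>/\<^sup>8\<close> and \<open>\<zeta>\<^sup>1\<^sup>/\<^sup>2\<close> are the holomorphic branches
  \<open>exp (2 \<pi> \<i> \<tau> / 8)\<close> and \<open>exp (\<pi> \<i> z)\<close>, not principal powers of
  \<open>q\<close> and \<open>\<zeta>\<close>. The exponent \<open>n (n + 1) / 2\<close> is an integer, so \<open>div\<close> is exact.
\<close>

definition jacobi_theta_odd :: "complex \<Rightarrow> complex \<Rightarrow> complex" where
  "jacobi_theta_odd \<tau> z =
     exp (2 * pi * \<i> * \<tau> / 8) * exp (pi * \<i> * z) *
     (\<Sum>\<^sub>\<infinity>n::int\<in>UNIV. (-1) powi n * exp (2 * pi * \<i> * \<tau>) powi (n * (n + 1) div 2) *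
        exp (2 * pi * \<i> * z) powi n)"

text \<open>
  The triple \<open>(a, b, c)\<close> stands for the form \<open>a x\<^sup>2 + b x y + c y\<^sup>2\<close>. Forms are not
  required to be primitive.
\<close>

type_synonym bqf = "int \<times> int \<times> int"

fun bqf_eval :: "bqf \<Rightarrow> int \<Rightarrow> int \<Rightarrow> int" where
  "bqf_eval (a, b, c) x y = a * x\<^sup>2 + b * x * y + c * y\<^sup>2"

fun bqf_disc :: "bqf \<Rightarrow> int" where
  "bqf_disc (a, b, c) = b\<^sup>2 - 4 * a * c"

definition bqf_pos_def :: "bqf \<Rightarrow> bool" where
  "bqf_pos_def f \<longleftrightarrow> (\<forall>x y. (x, y) \<noteq> (0, 0) \<longrightarrow> bqf_eval f x y > 0)"

definition pos_def_bqfs :: "int \<Rightarrow> bqf set" where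
  "pos_def_bqfs D = {f. bqf_pos_def f \<and> bqf_disc f = - D}"

text \<open>
  Substitution by a matrix of \<open>SL\<^sub>2(\<int>)\<close> with rows \<open>(p, q)\<close> and \<open>(r, s)\<close>. An integral
  binary quadratic form is determined by its values on integers, so comparing values is
  comparing forms.
\<close>

definition bqf_SL2Z_rel :: "(bqf \<times> bqf) set" where
  "bqf_SL2Z_rel = {(f, g). \<exists>p q r s :: int. p * s - q * r = 1 \<and>
     (\<forall>x y. bqf_eval g x y = bqf_eval f (p * x + q * y) (r * x + s * y))}"

definition bqf_classes :: "int \<Rightarrow> bqf set set" where
  "bqf_classes D = pos_def_bqfs D // (bqf_SL2Z_rel \<inter> pos_def_bqfs D \<times> pos_def_bqfs D)"

definition bqf_class_weight :: "bqf set \<Rightarrow> real" where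
  "bqf_class_weight C =
     (if \<exists>a. (a, 0, a) \<in> C then 1 / 2
      else if \<exists>a. (a, a, a) \<in> C then 1 / 3
      else 1)"

definition hurwitz_class_number :: "int \<Rightarrow> real" where
  "hurwitz_class_number D =
     (if D = 0 then - 1 / 12
      else if D < 0 \<or> D mod 4 \<in> {1, 2} then 0
      else (\<Sum>C\<in>bqf_classes D. bqf_class_weight C))"

definition hurwitz_class_number2 :: "int \<Rightarrow> real" where
  "hurwitz_class_number2 D =
     (if D mod 4 \<in> {0, 3}
      then hurwitz_class_number (4 * D) - 2 * hurwitz_class_number D
      else 0)"

end

theory Submission
  imports Defs
begin

text \<open>
  The coefficient of \<open>q\<^sup>n \<zeta>\<^sup>2\<^sup>r\<close> on the left is \<open>(-1)\<^sup>r\<close> times the number of odd quadruples with square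
  sum \<open>4 n\<close> and sum \<open>2 r\<close>. Half of the Hadamard matrix of order 4 turns these quadruples into representations
  of \<open>D = 4 n - r\<^sup>2\<close> as a sum of three squares, and the theorem becomes Gauss's formula
  \<open>r\<^sub>3(D) = 12 (H(4 D) - 2 H(D))\<close>.

  By reduction theory, \<open>3 H(D)\<close> is a weighted number of triples \<open>x, y, z \<ge> 0\<close> of equal parity with
  \<open>x y + y z + z x = D\<close>, and omitting the parity condition gives \<open>3 H(4 D)\<close>. Hence Gauss's formula is the
  power series identity \<open>\<theta>\<^sub>4\<^sup>3 = 1 - 4 \<Sum> w (-1)\<^bsup>x+y+z\<^esup> q\<^bsup>xy+yz+zx\<^esup>\<close> for \<open>\<theta>\<^sub>4 = \<Sum> (-1)\<^sup>k q\<^bsup>k\<^sup>2\<^esup>\<close>.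

  Summing over \<open>z\<close> with \<open>N = x + y\<close> fixed turns the right side into \<open>\<Sum> (-1)\<^sup>N (1 - p\<^sub>N t\<^sub>N)\<close> with
  \<open>t\<^sub>N = (1 - q\<^sup>N) / (1 + q\<^sup>N)\<close>. This is the zeroth coefficient of the convolution of \<open>1 + p\<^sub>N\<close> with
  \<open>2 (-1)\<^sup>N / (1 + q\<^sup>N)\<close>, whose coefficients satisfy \<open>c\<^bsub>k+2\<^esub> = - q\<^bsup>k+1\<^esup> c\<^sub>k\<close> and therefore sum to \<open>\<theta>\<^sub>4 c\<^sub>0\<close>.
  On the other hand, \<open>1 / (1 + q\<^sup>N)\<close> and \<open>(-1)\<^sup>N / (1 + q\<^sup>N)\<close> are convolution inverses up to a constant, and
  this evaluates the same sum as \<open>\<theta>\<^sub>4\<^sup>4\<close> by Jacobi's two-square theorem.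
\<close>

subsection \<open>Sums over the integers\<close>

text \<open>Gauss's formula alone settles even \<open>r\<close>. For odd \<open>r\<close> the number
  \<open>D\<close> is 3 modulo 8, and the integrality condition left over from the Hadamard
  substitution holds for exactly half of the representations. There \<open>H^(2)\<close> gives way
  to \<open>H\<close> because \<open>H(4 D) = 4 H(D)\<close>, which makes \<open>r_3(D)\<close>
  equal to \<open>24 H(D)\<close>; this relation is proved on Selling triples, by matching those of
  mixed parity with the odd ones. The analytic obstacle is that neither \<open>1 + p_N\<close> nor
  \<open>1 / (1 + q^N)\<close> is summable over the integers. The \<open>k\<close>-th convolution
  coefficient is therefore multiplied by \<open>q^(k/2)\<close>, and this factor is distributed over
  the two sequences, each of which then decays at both ends. Associativity and exchange of summation
  become available, and the weight is removed afterwards. The resulting identity carries one factor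
  \<open>theta4\<close> too many. It can be cancelled for small \<open>q\<close>, where
  \<open>theta4\<close> is close to 1, and a right neighbourhood of 0 is enough to compare
  coefficients.\<close>

lemma abs_le_square_int: "\<bar>j :: int\<bar> \<le> j\<^sup>2"
proof (cases "j = 0")
  case False
  then have "\<bar>j\<bar> * 1 \<le> \<bar>j\<bar> * \<bar>j\<bar>" by (intro mult_left_mono) auto
  then show ?thesis by (simp add: power2_eq_square)
qed simp

lemma summable_int_abs:
  fixes f :: "nat \<Rightarrow> real"
  assumes "summable f" "\<And>n. f n \<ge> 0"
  shows "(\<lambda>N::int. f (nat \<bar>N\<bar>)) summable_on UNIV"
proof -
  have f: "f summable_on UNIV"
    using assms by (simp add: summable_nonneg_imp_summable_on)
  have "(\<lambda>N. f (nat \<bar>N\<bar>)) summable_on {0..}"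
  proof -
    have "bij_betw int UNIV {0..}"
      by (rule bij_betwI[of _ _ _ nat]) auto
    from summable_on_reindex_bij_betw[OF this, of "\<lambda>N. f (nat \<bar>N\<bar>)"] f show ?thesis by simp
  qed
  moreover have "(\<lambda>N. f (nat \<bar>N\<bar>)) summable_on {..0}"
  proof -
    have "bij_betw (\<lambda>n. - int n) UNIV {..0}"
      by (rule bij_betwI[of _ _ _ "\<lambda>k. nat (- k)"]) auto
    from summable_on_reindex_bij_betw[OF this, of "\<lambda>N. f (nat \<bar>N\<bar>)"] f show ?thesis by simp
  qed
  ultimately have "(\<lambda>N. f (nat \<bar>N\<bar>)) summable_on {0..} \<union> {..0::int}"
    by (rule summable_on_union)
  moreover have "{0..} \<union> {..0::int} = UNIV" by auto
  ultimately show ?thesis by simp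
qed

lemma summable_on_real_comparison:
  fixes f g :: "'a \<Rightarrow> real"
  assumes "g summable_on A" "\<And>x. x \<in> A \<Longrightarrow> \<bar>f x\<bar> \<le> g x"
  shows "f summable_on A"
proof -
  have "(\<lambda>x. norm (f x)) summable_on A"
    by (rule Infinite_Sum.abs_summable_on_comparison_test'[OF assms(1)]) (use assms(2) in auto)
  then show ?thesis using summable_on_iff_abs_summable_on_real by blast
qed

lemma summable_poly_geom:
  fixes r :: real
  assumes "0 \<le> r" "r < 1"
  shows "summable (\<lambda>n. (real n + 2) * r ^ n)"
proof -
  have 1: "summable (\<lambda>n. r ^ n)" using assms by (simp add: summable_geometric)
  have "summable (\<lambda>n. of_nat (Suc n) * r ^ n)"
    using assms by (intro geometric_deriv_sums[THEN sums_summable]) auto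
  from summable_add[OF this 1] show ?thesis by (simp add: algebra_simps)
qed

text \<open>A common majorant for sums over the integers. The linear factor is there because
  \<open>hyp_nat n\<close> has about \<open>n\<close> terms; the summand \<open>2\<close> leaves
  room for the two further units in the estimates of \<open>hyp_geom\<close> and of
  \<open>hyp N - htan N\<close>.\<close>

definition geom_bd :: "real \<Rightarrow> int \<Rightarrow> real" where
  "geom_bd r N = (\<bar>real_of_int N\<bar> + 2) * r ^ nat \<bar>N\<bar>"

lemma summable_geom_bd:
  assumes "0 \<le> r" "r < 1"
  shows "geom_bd r summable_on UNIV"
proof -
  have "(\<lambda>N. (real (nat \<bar>N\<bar>) + 2) * r ^ nat \<bar>N\<bar>) summable_on UNIV"
    by (rule summable_int_abs[OF summable_poly_geom]) (use assms in auto)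
  then show ?thesis
    unfolding geom_bd_def by (simp add: of_nat_nat)
qed

lemma summable_reindex_bij:
  assumes "bij g" shows "(\<lambda>x. f (g x)) summable_on UNIV \<longleftrightarrow> f summable_on UNIV"
  using summable_on_reindex_bij_betw[OF assms] .

lemma infsum_reindex_bij:
  assumes "bij g" shows "infsum (\<lambda>x. f (g x)) UNIV = infsum f UNIV"
  using infsum_reindex_bij_betw[OF assms] .

lemma bij_int_shift:
  "bij (\<lambda>x::int. x + c)" "bij (\<lambda>x::int. x - c)" "bij (\<lambda>x::int. c - x)" "bij (\<lambda>x::int. - x)"
proof -
  show "bij (\<lambda>x::int. x + c)" by (rule o_bij[of "\<lambda>x. x - c"]) auto
  show "bij (\<lambda>x::int. x - c)" by (rule o_bij[of "\<lambda>x. x + c"]) auto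
  show "bij (\<lambda>x::int. c - x)" by (rule o_bij[of "\<lambda>x. c - x"]) auto
  show "bij (\<lambda>x::int. - x)" by (rule o_bij[of "\<lambda>x. - x"]) auto
qed

text \<open>Covers divergent sums as well: \<open>infsum\<close> is then \<open>0\<close> by
  default, and reindexing and negation respect this.\<close>

lemma infsum_antisym:
  fixes f :: "'a \<Rightarrow> real"
  assumes "bij g" "\<And>x. f (g x) = - f x"
  shows "infsum f UNIV = 0"
proof -
  have "infsum f UNIV = infsum (\<lambda>x. f (g x)) UNIV"
    using infsum_reindex_bij[OF assms(1), of f] by simp
  also have "\<dots> = - infsum f UNIV"
    by (simp add: assms(2) infsum_uminus)
  finally show ?thesis by simp
qed

text \<open>Stated for normed division algebras so that it serves the real sums as well as the
  complex theta series.\<close>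

lemma abs_summable_on_times:
  fixes f :: "'a \<Rightarrow> 'c :: {real_normed_div_algebra, banach}" and g :: "'b \<Rightarrow> 'c"
  assumes "(\<lambda>x. norm (f x)) summable_on A" "(\<lambda>x. norm (g x)) summable_on B"
  shows "(\<lambda>(x, y). norm (f x * g y)) summable_on A \<times> B"
proof -
  have "(\<lambda>z. norm (f (fst z)) * norm (g (snd z))) summable_on (SIGMA x:A. B)"
  proof (rule summable_on_SigmaI)
    show "((\<lambda>y. norm (f (fst (x, y))) * norm (g (snd (x, y)))) has_sum
        norm (f x) * infsum (\<lambda>y. norm (g y)) B) B" for x
      using has_sum_cmult_right[OF has_sum_infsum[OF assms(2)], of "norm (f x)"] by simp
    show "(\<lambda>x. norm (f x) * infsum (\<lambda>y. norm (g y)) B) summable_on A"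
      by (rule summable_on_cmult_left[OF assms(1)])
  qed auto
  then show ?thesis by (simp add: case_prod_unfold norm_mult)
qed

lemma summable_prod:
  fixes f :: "'a \<Rightarrow> real" and g :: "'b \<Rightarrow> real"
  assumes "f summable_on A" "g summable_on B"
  shows "(\<lambda>(x, y). f x * g y) summable_on A \<times> B"
  using abs_summable_on_times[of f A g B] assms summable_on_iff_abs_summable_on_real[of f A]
    summable_on_iff_abs_summable_on_real[of g B]
    summable_on_iff_abs_summable_on_real[of "\<lambda>(x, y). f x * g y" "A \<times> B"]
  by (simp add: case_prod_unfold)

lemma infsum_prod:
  fixes f :: "'a \<Rightarrow> real" and g :: "'b \<Rightarrow> real"
  assumes "f summable_on A" "g summable_on B"
  shows "infsum (\<lambda>(x, y). f x * g y) (A \<times> B) = infsum f A * infsum g B"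
proof -
  have "infsum (\<lambda>(x, y). f x * g y) (A \<times> B) = infsum (\<lambda>x. infsum (\<lambda>y. f x * g y) B) A"
    using infsum_Sigma'_banach[of "\<lambda>x y. f x * g y" A "\<lambda>_. B"] summable_prod[OF assms] by simp
  then show ?thesis
    by (simp add: infsum_cmult_right' infsum_cmult_left')
qed

section \<open>Convolution of summable sequences on the integers\<close>

definition int_conv :: "(int \<Rightarrow> real) \<Rightarrow> (int \<Rightarrow> real) \<Rightarrow> int \<Rightarrow> real" where
  "int_conv f g k = (\<Sum>\<^sub>\<infinity>N\<in>UNIV. f N * g (k - N))"

lemma summable_conv_pairs:
  fixes f g :: "int \<Rightarrow> real"
  assumes "f summable_on UNIV" "g summable_on UNIV"
  shows "(\<lambda>(k, N). f N * g (k - N)) summable_on UNIV \<times> (UNIV :: int set)"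
proof -
  have b: "bij_betw (\<lambda>(k, N). (N, k - N)) (UNIV \<times> UNIV) (UNIV \<times> (UNIV::int set))"
    by (rule bij_betwI[of _ _ _ "\<lambda>(a, b). (a + b, a)"]) auto
  from summable_on_reindex_bij_betw[OF b, of "\<lambda>(x, y). f x * g y"] summable_prod[OF assms]
  show ?thesis by (simp add: case_prod_unfold)
qed

lemma infsum_conv_pairs:
  fixes f g :: "int \<Rightarrow> real"
  assumes "f summable_on UNIV" "g summable_on UNIV"
  shows "(\<Sum>\<^sub>\<infinity>(k, N)\<in>UNIV \<times> UNIV. f N * g (k - N)) = infsum f UNIV * infsum g UNIV"
proof -
  have b: "bij_betw (\<lambda>(k, N). (N, k - N)) (UNIV \<times> UNIV) (UNIV \<times> (UNIV::int set))"
    by (rule bij_betwI[of _ _ _ "\<lambda>(a, b). (a + b, a)"]) auto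
  from infsum_reindex_bij_betw[OF b, of "\<lambda>(x, y). f x * g y"] infsum_prod[OF assms]
  show ?thesis by (simp add: case_prod_unfold)
qed

lemma summable_conv_term:
  fixes f g :: "int \<Rightarrow> real"
  assumes "f summable_on UNIV" "g summable_on UNIV"
  shows "(\<lambda>N. f N * g (k - N)) summable_on UNIV"
  using summable_on_SigmaD1[of "\<lambda>k N. f N * g (k - N)" UNIV "\<lambda>_. UNIV" k]
    summable_conv_pairs[OF assms] by simp

lemma summable_conv:
  fixes f g :: "int \<Rightarrow> real"
  assumes "f summable_on UNIV" "g summable_on UNIV"
  shows "int_conv f g summable_on UNIV"
proof -
  have "(\<lambda>k. infsum (\<lambda>N. case (k, N) of (k, N) \<Rightarrow> f N * g (k - N)) UNIV) summable_on UNIV"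
    by (rule summable_on_SigmaD[OF summable_conv_pairs[OF assms]])
       (use summable_conv_term[OF assms] in simp)
  then show ?thesis by (simp add: int_conv_def[abs_def])
qed

lemma infsum_conv:
  fixes f g :: "int \<Rightarrow> real"
  assumes "f summable_on UNIV" "g summable_on UNIV"
  shows "infsum (int_conv f g) UNIV = infsum f UNIV * infsum g UNIV"
proof -
  have "(\<Sum>\<^sub>\<infinity>(k, N)\<in>UNIV \<times> UNIV. f N * g (k - N)) = infsum (int_conv f g) UNIV"
    using infsum_Sigma'_banach[of "\<lambda>k N. f N * g (k - N)" UNIV "\<lambda>_. UNIV"] summable_conv_pairs[OF assms]
    by (simp add: int_conv_def[abs_def])
  then show ?thesis using infsum_conv_pairs[OF assms] by simp
qed

lemma int_conv_assoc:
  assumes f: "f summable_on UNIV" and g: "g summable_on UNIV" and h: "h summable_on UNIV"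
  shows "int_conv (int_conv f g) h k = int_conv f (int_conv g h) k"
proof -
  \<comment> \<open>A summable \<open>h\<close> is bounded, so a multiple of the pairs
    \<open>f N * g (m - N)\<close> dominates the double series and the two summations may be
    exchanged.\<close>
  obtain B where B: "\<And>n. \<bar>h n\<bar> \<le> B"
  proof
    fix n
    have "(\<lambda>n. \<bar>h n\<bar>) summable_on UNIV"
      using h summable_on_iff_abs_summable_on_real[of h UNIV] by simp
    from finite_sum_le_infsum[OF this, of "{n}"] show "\<bar>h n\<bar> \<le> infsum (\<lambda>n. \<bar>h n\<bar>) UNIV" by simp
  qed
  have abs: "(\<lambda>x. \<bar>case x of (m, N) \<Rightarrow> f N * g (m - N)\<bar>) summable_on UNIV \<times> UNIV"
    using summable_conv_pairs[OF f g]
      summable_on_iff_abs_summable_on_real[of "\<lambda>(m, N). f N * g (m - N)" "UNIV \<times> UNIV"] by simp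
  have S: "(\<lambda>(m, N). f N * g (m - N) * h (k - m)) summable_on UNIV \<times> UNIV"
    by (rule summable_on_real_comparison[OF summable_on_cmult_left[OF abs, of B]])
       (use B in \<open>auto simp: abs_mult intro!: mult_left_mono\<close>)
  have "int_conv (int_conv f g) h k = (\<Sum>\<^sub>\<infinity>m. \<Sum>\<^sub>\<infinity>N. f N * g (m - N) * h (k - m))"
    by (simp add: int_conv_def infsum_cmult_left')
  also have "\<dots> = (\<Sum>\<^sub>\<infinity>N. \<Sum>\<^sub>\<infinity>m. f N * g (m - N) * h (k - m))"
    by (rule infsum_swap_banach) (use S in simp)
  also have "\<dots> = (\<Sum>\<^sub>\<infinity>N. f N * int_conv g h (k - N))"
  proof (rule infsum_cong)
    fix N
    have "(\<Sum>\<^sub>\<infinity>m. f N * g (m - N) * h (k - m)) = f N * (\<Sum>\<^sub>\<infinity>m. g (m - N) * h (k - m))"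
      by (simp add: infsum_cmult_right' mult.assoc)
    also have "(\<Sum>\<^sub>\<infinity>m. g (m - N) * h (k - m)) = int_conv g h (k - N)"
      using infsum_reindex_bij[OF bij_int_shift(2)[of N], of "\<lambda>m. g m * h (k - N - m)"]
      by (simp add: int_conv_def algebra_simps)
    finally show "(\<Sum>\<^sub>\<infinity>m. f N * g (m - N) * h (k - m)) = f N * int_conv g h (k - N)" .
  qed
  finally show ?thesis by (simp add: int_conv_def)
qed


subsection \<open>A convolution identity\<close>

definition alt_sign :: "int \<Rightarrow> real" where "alt_sign N = (if even N then 1 else - 1)"

lemma alt_sign_simps:
  "alt_sign (a + b) = alt_sign a * alt_sign b" "alt_sign (a - b) = alt_sign a * alt_sign b"
  "alt_sign (- a) = alt_sign a" "alt_sign a * alt_sign a = 1" "\<bar>alt_sign a\<bar> = 1"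
  "alt_sign 0 = 1" "alt_sign 1 = -1" "alt_sign 2 = 1" "alt_sign a * (alt_sign a * x) = x"
  by (auto simp: alt_sign_def)

text \<open>The variable of the final power series is \<open>Q^2\<close>: the halved exponents make
  \<open>hsec\<close> even. The Selling series is read at \<open>Q = sqrt q\<close>, whereas the
  two-square theorem compares the instances \<open>Q\<close> and \<open>Q^2\<close>.\<close>

locale nome =
  fixes Q :: real
  assumes Q_pos: "0 < Q" and Q_less_1: "Q < 1"
begin

lemma Q_neq_0 [simp]: "Q \<noteq> 0" using Q_pos by simp

lemma Q_nonneg [simp]: "0 \<le> Q" using Q_pos by simp

lemma powi_pos [simp]: "Q powi N > 0" using Q_pos by simp

lemma powi_add: "Q powi (a + b) = Q powi a * Q powi b"
  by (simp add: power_int_add)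

lemma powi_diff: "Q powi (a - b) = Q powi a / Q powi b"
  by (simp add: power_int_diff)

lemma powi_nat_abs: "Q ^ nat \<bar>N\<bar> = Q powi \<bar>N\<bar>"
  by (simp add: power_int_def)

text \<open>With \<open>q = Q\<^sup>2\<close>, the weighted value \<open>hsec N / Q\<^sup>N\<close> is \<open>1 / (1 + q\<^sup>N)\<close>, and
  \<open>htan N\<close> is \<open>(1 - q\<^sup>N) / (1 + q\<^sup>N)\<close>.\<close>

definition hsec :: "int \<Rightarrow> real" where "hsec N = 1 / (Q powi N + Q powi (- N))"

definition htan :: "int \<Rightarrow> real" where "htan N = 2 * Q powi (- N) * hsec N - 1"

lemma hsec_minus [simp]: "hsec (- N) = hsec N"
  by (simp add: hsec_def add.commute)

lemma hsec_denom_pos: "Q powi N + Q powi (- N) > 0"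
  by (simp add: add_pos_pos)

lemma hsec_pos: "hsec N > 0"
  unfolding hsec_def using hsec_denom_pos by simp

lemma htan_minus [simp]: "htan (- N) = - htan N"
proof -
  have "(Q powi N + Q powi (- N)) * hsec N = 1"
    unfolding hsec_def using hsec_denom_pos[of N] by simp
  then show ?thesis by (simp add: htan_def algebra_simps)
qed

lemma htan_alt: "htan N = 1 - 2 * Q powi N * hsec N"
  using htan_minus[of N] by (simp add: htan_def)

lemma hsec_le: "hsec N \<le> Q ^ nat \<bar>N\<bar>"
proof -
  have "hsec N = hsec \<bar>N\<bar>" by (cases "N \<ge> 0") auto
  also have "\<dots> \<le> 1 / Q powi (- \<bar>N\<bar>)"
    unfolding hsec_def by (rule divide_left_mono) (simp_all add: add_pos_pos)
  also have "\<dots> = Q ^ nat \<bar>N\<bar>"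
    by (simp add: powi_nat_abs power_int_minus divide_inverse)
  finally show ?thesis .
qed

lemma pow_le_geom_bd: "Q ^ nat \<bar>N\<bar> \<le> geom_bd Q N"
proof -
  have "1 * Q ^ nat \<bar>N\<bar> \<le> (\<bar>real_of_int N\<bar> + 2) * Q ^ nat \<bar>N\<bar>"
    by (rule mult_right_mono) simp_all
  then show ?thesis by (simp add: geom_bd_def)
qed

lemma summable_geom_bd_Q: "geom_bd Q summable_on UNIV"
  using Q_pos Q_less_1 by (intro summable_geom_bd) auto

lemma summable_geom_bdI:
  assumes "\<And>N. \<bar>f N\<bar> \<le> C * geom_bd Q N"
  shows "f summable_on UNIV"
  by (rule summable_on_real_comparison[OF summable_on_cmult_right[OF summable_geom_bd_Q, of C]]) (use assms in auto)

lemma summable_hsec: "hsec summable_on UNIV"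
  by (rule summable_geom_bdI[of _ 1]) (use hsec_le pow_le_geom_bd hsec_pos in \<open>auto simp: abs_of_pos intro: order_trans\<close>)

lemma summable_alt_sign: "f summable_on UNIV \<Longrightarrow> (\<lambda>N. alt_sign N * f N) summable_on UNIV"
  by (rule summable_on_real_comparison[of "\<lambda>N. \<bar>f N\<bar>"])
     (use summable_on_iff_abs_summable_on_real[of f] in \<open>auto simp: abs_mult alt_sign_simps\<close>)

definition alt_hsec :: "int \<Rightarrow> real" where "alt_hsec N = alt_sign N * hsec N"

lemma summable_alt_hsec: "alt_hsec summable_on UNIV"
  using summable_alt_sign[OF summable_hsec] by (simp add: alt_hsec_def[abs_def])

text \<open>With \<open>Q = exp (- t)\<close> this is
  \<open>tanh u - tanh v = sinh (u - v) / (cosh u * cosh v)\<close>. It turns each term of a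
  convolution of two \<open>hsec\<close> into a difference of two values of
  \<open>htan\<close>.\<close>

lemma htan_diff: "htan N - htan (N - c) = 2 * (Q powi (- c) - Q powi c) * hsec N * hsec (c - N)"
proof -
  define u v where "u = Q powi N" and "v = Q powi c"
  have uv: "u > 0" "v > 0" by (auto simp: u_def v_def)
  have 1: "hsec N = u / (u\<^sup>2 + 1)"
    using uv by (simp add: hsec_def u_def[symmetric] power_int_minus field_simps power2_eq_square)
  have 2: "hsec (c - N) = u * v / (u\<^sup>2 + v\<^sup>2)"
    using uv by (simp add: hsec_def powi_diff u_def[symmetric] v_def[symmetric] power_int_minus field_simps power2_eq_square)
  have "hsec (N - c) = hsec (c - N)" using hsec_minus[of "N - c"] by simp
  then have 3: "htan (N - c) = 1 - 2 * (u / v) * (u * v / (u\<^sup>2 + v\<^sup>2))"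
    unfolding htan_alt by (simp add: 2 powi_diff u_def[symmetric] v_def[symmetric])
  have "u\<^sup>2 + 1 > 0" "u\<^sup>2 + v\<^sup>2 > 0" using uv by (auto simp: add_pos_pos)
  then show ?thesis
    using uv unfolding 1 2 3 unfolding htan_alt 1 u_def[symmetric] v_def[symmetric] power_int_minus
    by (simp add: divide_simps) algebra
qed

lemma summable_htan_diff: "(\<lambda>N. htan N - htan (N - c)) summable_on UNIV"
  unfolding htan_diff mult.assoc
  by (intro summable_on_cmult_right summable_conv_term summable_hsec)

text \<open>The two halves of the difference cannot be summed separately, since \<open>htan\<close>
  tends to \<open>1\<close> and \<open>- 1\<close> at the ends. The shift \<open>c\<close> is
  reached by unit steps instead: moving \<open>N\<close> by one reverses the sign, so
  \<open>D (c + 1) = D 1 - D c\<close>, and \<open>D 1\<close> vanishes by the reflection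
  \<open>N -> 1 - N\<close>.\<close>

lemma infsum_alt_htan_diff: "(\<Sum>\<^sub>\<infinity>N. alt_sign N * (htan N - htan (N - c))) = 0"
proof -
  define D where "D c = (\<Sum>\<^sub>\<infinity>N. alt_sign N * (htan N - htan (N - c)))" for c
  have D1: "D 1 = 0"
    unfolding D_def
  proof (rule infsum_antisym[OF bij_int_shift(3)[of 1]])
    fix N :: int
    have "htan (1 - N) = - htan (N - 1)" using htan_minus[of "N - 1"] by simp
    then show "alt_sign (1 - N) * (htan (1 - N) - htan (1 - N - 1)) = - (alt_sign N * (htan N - htan (N - 1)))"
      by (simp add: alt_sign_simps algebra_simps)
  qed
  have step: "D (c + 1) = - D c" for c
  proof -
    have "D (c + 1) = (\<Sum>\<^sub>\<infinity>N. alt_sign N * (htan N - htan (N - 1)) + - (alt_sign (N - 1) * (htan (N - 1) - htan (N - 1 - c))))"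
      unfolding D_def by (rule infsum_cong) (simp add: alt_sign_simps algebra_simps)
    also have "\<dots> = D 1 + (\<Sum>\<^sub>\<infinity>N. - (alt_sign (N - 1) * (htan (N - 1) - htan (N - 1 - c))))"
      unfolding D_def
    proof (rule infsum_add)
      show "(\<lambda>N. alt_sign N * (htan N - htan (N - 1))) summable_on UNIV"
        by (rule summable_alt_sign[OF summable_htan_diff])
      have "(\<lambda>N. alt_sign (N - 1) * (htan (N - 1) - htan (N - 1 - c))) summable_on UNIV"
        using summable_reindex_bij[OF bij_int_shift(2), of "\<lambda>N. alt_sign N * (htan N - htan (N - c))" 1]
          summable_alt_sign[OF summable_htan_diff] by simp
      then show "(\<lambda>N. - (alt_sign (N - 1) * (htan (N - 1) - htan (N - 1 - c)))) summable_on UNIV"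
        by (simp add: summable_on_uminus)
    qed
    also have "(\<Sum>\<^sub>\<infinity>N. - (alt_sign (N - 1) * (htan (N - 1) - htan (N - 1 - c)))) = - D c"
      using infsum_reindex_bij[OF bij_int_shift(2), of "\<lambda>N. alt_sign N * (htan N - htan (N - c))" 1]
      by (simp add: infsum_uminus D_def)
    finally show ?thesis using D1 by simp
  qed
  have "D c = 0" for c
  proof (induction c rule: int_induct[of _ 1])
    case base then show ?case by (rule D1)
  next
    case (step1 i) then show ?case using step by simp
  next
    case (step2 i) then show ?case using step[of "i - 1"] by simp
  qed
  then show ?thesis by (simp add: D_def)
qed

definition hsec_const :: real where "hsec_const = int_conv alt_hsec hsec 0"

text \<open>By \<open>htan_diff\<close>, the factor \<open>2 * (Q powi (- k) - Q powi k)\<close>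
  turns the \<open>k\<close>-th coefficient into an alternating sum of differences of
  \<open>htan\<close>, which is zero. The factor itself vanishes only at
  \<open>k = 0\<close>.\<close>

lemma conv_alt_hsec_hsec: "int_conv alt_hsec hsec k = (if k = 0 then hsec_const else 0)"
proof (cases "k = 0")
  case False
  have "Q powi (- k) \<noteq> Q powi k"
  proof
    assume "Q powi (- k) = Q powi k"
    then have "Q powi (k + k) = 1" unfolding powi_add by (simp add: power_int_minus field_simps)
    then have 1: "Q powi \<bar>k + k\<bar> = 1"
      by (cases "k \<ge> 0") (simp_all add: power_int_minus del: power_int_add)
    have "Q powi \<bar>k + k\<bar> < 1"
      unfolding powi_nat_abs[symmetric] using Q_pos Q_less_1 False by (intro power_less_one_iff[THEN iffD2]) auto
    then show False using 1 by simp
  qed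
  moreover have "0 = 2 * (Q powi (- k) - Q powi k) * int_conv alt_hsec hsec k"
    using infsum_alt_htan_diff[of k] unfolding htan_diff
    by (simp add: int_conv_def alt_hsec_def infsum_cmult_right' mult.left_commute[of "alt_sign _"] mult.assoc)
  ultimately show ?thesis using False by simp
qed (simp add: hsec_const_def)

end

lemma summable_even_odd:
  fixes f :: "int \<Rightarrow> real"
  assumes "(\<lambda>j. f (2 * j)) summable_on UNIV" "(\<lambda>j. f (2 * j + 1)) summable_on UNIV"
  shows "f summable_on UNIV"
    and "infsum f UNIV = (\<Sum>\<^sub>\<infinity>j. f (2 * j)) + (\<Sum>\<^sub>\<infinity>j. f (2 * j + 1))"
proof -
  have b0: "bij_betw (\<lambda>j. 2 * j) UNIV {k::int. even k}"
    by (rule bij_betwI[of _ _ _ "\<lambda>k. k div 2"]) auto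
  have b1: "bij_betw (\<lambda>j. 2 * j + 1) UNIV {k::int. odd k}"
    by (rule bij_betwI[of _ _ _ "\<lambda>k. k div 2"]) auto
  have U: "{k::int. even k} \<union> {k. odd k} = UNIV" by auto
  have D: "{k::int. even k} \<inter> {k. odd k} = {}" by auto
  have s0: "f summable_on {k. even k}"
    using summable_on_reindex_bij_betw[OF b0, of f] assms(1) by simp
  have s1: "f summable_on {k. odd k}"
    using summable_on_reindex_bij_betw[OF b1, of f] assms(2) by simp
  show "f summable_on UNIV"
    using summable_on_Un_disjoint[OF s0 s1 D] U by simp
  show "infsum f UNIV = (\<Sum>\<^sub>\<infinity>j. f (2 * j)) + (\<Sum>\<^sub>\<infinity>j. f (2 * j + 1))"
    using infsum_Un_disjoint[OF s0 s1 D] U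
      infsum_reindex_bij_betw[OF b0, of f] infsum_reindex_bij_betw[OF b1, of f] by simp
qed

definition theta4 :: "real \<Rightarrow> real" where
  "theta4 q = (\<Sum>\<^sub>\<infinity>k::int. alt_sign k * q ^ nat (k\<^sup>2))"

definition theta3 :: "real \<Rightarrow> real" where
  "theta3 q = (\<Sum>\<^sub>\<infinity>k::int. q ^ nat (k\<^sup>2))"

section \<open>Hyperbola sums, their two-sided recurrence, and the coefficients of the weighted
  convolution\<close>

context nome
begin

text \<open>\<open>hyp_nat n\<close> is the sum of \<open>q\<^sup>x\<^sup>y\<close> over \<open>x + y = n\<close> in \<open>\<nat>\<close> in which the two end terms have
  weight \<open>1 / 2\<close>. Its odd extension \<open>hyp\<close> satisfies one recurrence on all of \<open>\<int>\<close>.\<close>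

definition hyp_nat :: "nat \<Rightarrow> real" where
  "hyp_nat n = (if n = 0 then 0 else 1 + (\<Sum>x = 1..<n. Q ^ (2 * x * (n - x))))"

definition hyp :: "int \<Rightarrow> real" where
  "hyp N = of_int (sgn N) * hyp_nat (nat \<bar>N\<bar>)"

text \<open>With \<open>x = i + 1\<close> and \<open>n + 2 - x = j + 1\<close> one has
  \<open>x * (n + 2 - x) = i * j + n + 1\<close> and \<open>i + j = n\<close>. The inner terms for
  \<open>n + 2\<close> thus contain the ends \<open>i = 0\<close> and \<open>j = 0\<close> with full
  weight, which is the \<open>1\<close> added to \<open>hyp_nat n\<close>. For \<open>n = 0\<close>
  the ends coincide, which fits \<open>hyp_nat 0 = 0\<close>.\<close>

lemma hyp_nat_rec: "hyp_nat (n + 2) = Q ^ (2 * (n + 1)) * (hyp_nat n + 1) + 1"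
proof -
  have "(\<Sum>x = 1..<n + 2. Q ^ (2 * x * (n + 2 - x))) = (\<Sum>i = 0..<n + 1. Q ^ (2 * Suc i * (n + 2 - Suc i)))"
    using sum.shift_bounds_Suc_ivl[of "\<lambda>x. Q ^ (2 * x * (n + 2 - x))" 0 "n + 1"] by simp
  also have "\<dots> = (\<Sum>i = 0..<n + 1. Q ^ (2 * (n + 1)) * Q ^ (2 * i * (n - i)))"
  proof (rule sum.cong)
    fix i assume "i \<in> {0..<n + 1}"
    then obtain j where n: "n = i + j" using less_eq_Suc_le by (auto simp: nat_le_iff_add)
    have "2 * Suc i * (n + 2 - Suc i) = 2 * (n + 1) + 2 * i * (n - i)"
      unfolding n by (simp add: algebra_simps)
    then show "Q ^ (2 * Suc i * (n + 2 - Suc i)) = Q ^ (2 * (n + 1)) * Q ^ (2 * i * (n - i))"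
      by (simp only: power_add)
  qed simp
  also have "\<dots> = Q ^ (2 * (n + 1)) * (\<Sum>i = 0..<n + 1. Q ^ (2 * i * (n - i)))"
    by (simp only: sum_distrib_left)
  also have "(\<Sum>i = 0..<n + 1. Q ^ (2 * i * (n - i))) = hyp_nat n + 1"
  proof (cases "n = 0")
    case False
    have "(\<Sum>i = 0..<n + 1. Q ^ (2 * i * (n - i))) = (\<Sum>i = 0..<n. Q ^ (2 * i * (n - i))) + 1"
      by simp
    also have "(\<Sum>i = 0..<n. Q ^ (2 * i * (n - i))) = 1 + (\<Sum>i = 1..<n. Q ^ (2 * i * (n - i)))"
      using False by (subst sum.atLeast_Suc_lessThan) auto
    finally show ?thesis using False by (simp add: hyp_nat_def)
  qed (simp add: hyp_nat_def)
  finally show ?thesis by (simp add: hyp_nat_def)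
qed

lemma hyp_minus [simp]: "hyp (- N) = - hyp N"
  by (simp add: hyp_def sgn_if)

text \<open>For an odd function the recurrence is invariant under \<open>N -> - N - 2\<close>, so
  the negative range follows from \<open>hyp_nat_rec\<close> by solving for the other value. At the
  fixed point \<open>N = - 1\<close> both sides are \<open>1\<close>, because
  \<open>hyp N + 1\<close> vanishes.\<close>

lemma hyp_rec: "hyp (N + 2) = Q powi (2 * N + 2) * (hyp N + 1) + 1"
proof -
  consider n where "N = int n" | "N = -1" | n where "N = - int (n + 2)"
  proof -
    have "N \<ge> 0 \<or> N = -1 \<or> N \<le> -2" by linarith
    then show thesis
    proof (elim disjE)
      assume "N \<ge> 0" then show thesis using that(1)[of "nat N"] by simp
    next
      assume "N = -1" then show thesis using that(2) by simp
    next
      assume "N \<le> -2" then show thesis using that(3)[of "nat (- N - 2)"] by simp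
    qed
  qed
  then show ?thesis
  proof cases
    case 1
    have e: "Q powi (2 * N + 2) = Q ^ (2 * (n + 1))"
      using 1 by (simp add: power_int_def nat_add_distrib nat_mult_distrib)
    have "hyp (N + 2) = hyp_nat (n + 2)" using 1 by (simp add: hyp_def nat_add_distrib sgn_if)
    moreover have "hyp N = hyp_nat n" using 1 by (cases "n = 0") (simp_all add: hyp_def hyp_nat_def)
    ultimately show ?thesis unfolding e using hyp_nat_rec[of n] by simp
  next
    case 2
    then show ?thesis by (simp add: hyp_def hyp_nat_def)
  next
    case 3
    have e: "Q powi (2 * N + 2) = 1 / Q ^ (2 * (n + 1))"
      using 3 by (simp add: power_int_def divide_inverse power_inverse nat_add_distrib nat_mult_distrib)
    have "nat \<bar>N\<bar> = n + 2" using 3 by simp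
    then have "hyp N = - hyp_nat (n + 2)" using 3 by (simp add: hyp_def)
    moreover have "hyp (N + 2) = - hyp_nat n" using 3 by (cases "n = 0") (simp_all add: hyp_def hyp_nat_def)
    moreover have "Q ^ (2 * (n + 1)) > 0" using Q_pos by simp
    ultimately show ?thesis unfolding e using hyp_nat_rec[of n] by (simp add: field_simps)
  qed
qed

text \<open>Positive integers satisfy \<open>x * y \<ge> x + y - 1\<close>, so each of the fewer
  than \<open>n\<close> terms is at most \<open>Q ^ (2 * (n - 1))\<close>.\<close>

lemma hyp_nat_bounds:
  assumes "n > 0"
  shows "1 \<le> hyp_nat n" "hyp_nat n - 1 \<le> real n * Q ^ (2 * (n - 1))"
proof -
  have *: "(\<Sum>x = 1..<n. Q ^ (2 * x * (n - x))) \<ge> 0" using Q_pos by (intro sum_nonneg) auto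
  then show "1 \<le> hyp_nat n" using assms by (simp add: hyp_nat_def)
  have "(\<Sum>x = 1..<n. Q ^ (2 * x * (n - x))) \<le> (\<Sum>x = 1..<n. Q ^ (2 * (n - 1)))"
  proof (rule sum_mono)
    fix x assume x: "x \<in> {1..<n}"
    then obtain i j where ij: "x = Suc i" "n = Suc i + Suc j"
      by (metis atLeastLessThan_iff less_imp_Suc_add add_Suc_right not0_implies_Suc not_one_le_zero)
    have "2 * (n - 1) \<le> 2 * x * (n - x)" unfolding ij by simp
    then show "Q ^ (2 * x * (n - x)) \<le> Q ^ (2 * (n - 1))"
      using Q_pos Q_less_1 by (intro power_decreasing) auto
  qed
  also have "\<dots> \<le> real n * Q ^ (2 * (n - 1))"
    using Q_pos assms by (simp add: mult_right_mono)
  finally show "hyp_nat n - 1 \<le> real n * Q ^ (2 * (n - 1))" using assms by (simp add: hyp_nat_def)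
qed

lemma hyp_nat_bound_power:
  assumes "n > 0"
  shows "hyp_nat n - 1 \<le> real n * Q ^ n * Q ^ n / Q\<^sup>2"
proof -
  have "Q ^ (2 * (n - 1)) * Q\<^sup>2 = Q ^ n * Q ^ n"
    unfolding power_add[symmetric] by (rule arg_cong[of _ _ "power Q"]) (use assms in simp)
  then have "Q ^ (2 * (n - 1)) = Q ^ n * Q ^ n / Q\<^sup>2" by (simp add: eq_divide_eq)
  then show ?thesis using hyp_nat_bounds(2)[OF assms] by (simp add: mult.assoc)
qed

text \<open>Both functions tend to \<open>1\<close> and \<open>- 1\<close> at the two ends, with an
  error of geometric size up to a linear factor; only their difference is summable. The factor
  \<open>1 / Q^2\<close> comes from the exponent \<open>2 * (n - 1)\<close> in place of
  \<open>2 * n\<close>.\<close>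

lemma hyp_minus_htan_bound: "\<bar>hyp N - htan N\<bar> \<le> 1 / Q\<^sup>2 * geom_bd Q N"
proof -
  have *: "\<bar>hyp (int n) - htan (int n)\<bar> \<le> 1 / Q\<^sup>2 * geom_bd Q (int n)" for n
  proof (cases "n = 0")
    case True
    then show ?thesis using Q_pos by (simp add: hyp_def htan_def hsec_def geom_bd_def)
  next
    case False
    have Qn: "0 < Q ^ n" "Q ^ n \<le> 1" using Q_pos Q_less_1 by (auto intro: power_le_one)
    have "hsec (int n) \<le> 1" using hsec_le[of "int n"] Qn by simp
    then have "Q ^ n * hsec (int n) \<le> Q ^ n * 1" using Qn by (intro mult_left_mono) auto
    then have 1: "1 - htan (int n) \<le> 2 * Q ^ n" "1 - htan (int n) \<ge> 0"
      using Qn hsec_pos[of "int n"] by (auto simp: htan_alt)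
    have "real n * Q ^ n * Q ^ n / Q\<^sup>2 \<le> real n * Q ^ n * 1 / Q\<^sup>2"
      using Qn by (intro divide_right_mono mult_left_mono) auto
    then have 2: "hyp_nat n - 1 \<le> real n * Q ^ n / Q\<^sup>2" "hyp_nat n - 1 \<ge> 0"
      using hyp_nat_bound_power[of n] hyp_nat_bounds(1)[of n] False by auto
    have 3: "2 * Q ^ n \<le> 2 * Q ^ n / Q\<^sup>2"
      using Qn Q_pos Q_less_1 by (simp add: field_simps power_le_one)
    have "hyp (int n) = hyp_nat n" using False by (simp add: hyp_def)
    then have "\<bar>hyp (int n) - htan (int n)\<bar> \<le> real n * Q ^ n / Q\<^sup>2 + 2 * Q ^ n / Q\<^sup>2"
      using 1 2 3 by linarith
    also have "\<dots> = 1 / Q\<^sup>2 * geom_bd Q (int n)"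
      using Q_pos by (simp add: geom_bd_def field_simps)
    finally show ?thesis .
  qed
  show ?thesis
  proof (cases "N \<ge> 0")
    case True then show ?thesis using *[of "nat N"] by simp
  next
    case False
    have "\<bar>hyp (- N) - htan (- N)\<bar> \<le> 1 / Q\<^sup>2 * geom_bd Q (- N)" using *[of "nat (- N)"] False by simp
    moreover have "\<bar>hyp (- N) - htan (- N)\<bar> = \<bar>hyp N - htan N\<bar>" by simp
    ultimately show ?thesis by (simp add: geom_bd_def)
  qed
qed

lemma summable_hyp_minus_htan: "(\<lambda>N. hyp N - htan N) summable_on UNIV"
  using hyp_minus_htan_bound by (rule summable_geom_bdI)

lemma infsum_alt_hyp_minus_htan: "(\<Sum>\<^sub>\<infinity>N. alt_sign N * (hyp N - htan N)) = 0"
  by (rule infsum_antisym[OF bij_int_shift(4)]) (simp add: alt_sign_simps algebra_simps)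

definition hyp_geom :: "int \<Rightarrow> real" where "hyp_geom N = Q powi N * (hyp N + 1)"

text \<open>At minus infinity, with \<open>n = - N\<close>, the power \<open>Q powi N\<close> grows
  like \<open>1 / Q^n\<close>, but \<open>hyp\<close> tends to \<open>- 1\<close> and
  \<open>hyp N + 1\<close> is of order \<open>n * Q^(2 n)\<close>. The summand \<open>1\<close> in
  \<open>hyp_geom\<close> is what makes the product decay there.\<close>

lemma summable_hyp_geom: "hyp_geom summable_on UNIV"
proof (rule summable_geom_bdI[of _ "1 / Q\<^sup>2"])
  fix N
  have Q2: "1 / Q\<^sup>2 \<ge> 1" using Q_pos Q_less_1 by (simp add: power_le_one)
  define n where "n = nat \<bar>N\<bar>"
  have Qn: "0 < Q ^ n" "Q ^ n \<le> 1" using Q_pos Q_less_1 by (auto intro: power_le_one)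
  have bd: "geom_bd Q N = (real n + 2) * Q ^ n" by (simp add: geom_bd_def n_def)
  have pos: "geom_bd Q N \<ge> 0" unfolding bd using Qn by simp
  show "\<bar>hyp_geom N\<bar> \<le> 1 / Q\<^sup>2 * geom_bd Q N"
  proof (cases "N \<ge> 0")
    case True
    have "hyp_nat n \<le> real n + 1"
    proof (cases "n = 0")
      case False
      have "real n * Q ^ (2 * (n - 1)) \<le> real n * 1"
        using Q_pos Q_less_1 by (intro mult_left_mono power_le_one) auto
      moreover have "hyp_nat n - 1 \<le> real n * Q ^ (2 * (n - 1))" using hyp_nat_bounds(2)[of n] False by simp
      ultimately show ?thesis by linarith
    qed (simp add: hyp_nat_def)
    moreover have "hyp_nat n \<ge> 0" using hyp_nat_bounds(1)[of n] by (cases "n = 0") (auto simp: hyp_nat_def)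
    moreover have "hyp N = hyp_nat n" using True by (cases "N = 0") (auto simp: hyp_def n_def hyp_nat_def)
    ultimately have "\<bar>hyp N + 1\<bar> \<le> real n + 2" by simp
    moreover have "Q powi N = Q ^ n" using True by (simp add: n_def power_int_def)
    ultimately have "\<bar>hyp_geom N\<bar> \<le> Q ^ n * (real n + 2)"
      using Qn by (simp add: hyp_geom_def abs_mult mult_left_mono)
    also have "\<dots> = 1 * geom_bd Q N" by (simp add: bd)
    also have "\<dots> \<le> 1 / Q\<^sup>2 * geom_bd Q N" using Q2 pos by (rule mult_right_mono)
    finally show ?thesis .
  next
    case False
    then have n: "n > 0" by (simp add: n_def)
    have pN: "hyp N = - hyp_nat n" using False by (simp add: hyp_def n_def)
    have pw: "Q powi N = 1 / Q ^ n" using False by (simp add: n_def power_int_def divide_inverse power_inverse)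
    have "\<bar>hyp_geom N\<bar> = 1 / Q ^ n * (hyp_nat n - 1)"
      using hyp_nat_bounds(1)[OF n] Qn by (simp add: hyp_geom_def pN pw abs_mult)
    also have "\<dots> \<le> 1 / Q ^ n * (real n * Q ^ n * Q ^ n / Q\<^sup>2)"
      using hyp_nat_bound_power[OF n] Qn by (intro mult_left_mono) auto
    also have "\<dots> = real n * Q ^ n / Q\<^sup>2" using Qn by simp
    also have "\<dots> \<le> (real n + 2) * Q ^ n / Q\<^sup>2"
      using Qn by (intro divide_right_mono mult_right_mono) auto
    finally show ?thesis by (simp add: bd)
  qed
qed

definition hyp_conv :: "int \<Rightarrow> real" where "hyp_conv = int_conv hyp_geom alt_hsec"

lemma summable_hyp_conv: "hyp_conv summable_on UNIV"
  unfolding hyp_conv_def by (rule summable_conv[OF summable_hyp_geom summable_alt_hsec])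

text \<open>In the combined term the recurrence of \<open>hyp\<close> produces the factor
  \<open>u^2 + v^2\<close>, which cancels the denominator of \<open>hsec (k - N)\<close>. What
  remains is, up to constants, the alternating sum of \<open>hyp (N + 2) - htan (N - k)\<close>, and
  this is zero.\<close>

lemma hyp_conv_rec: "hyp_conv (k + 2) = - (Q powi (2 * k + 4)) * hyp_conv k"
proof -
  have A: "hyp_conv (k + 2) = (\<Sum>\<^sub>\<infinity>N. hyp_geom (N + 2) * alt_hsec (k - N))"
    using infsum_reindex_bij[OF bij_int_shift(1)[of 2], of "\<lambda>N. hyp_geom N * alt_hsec (k + 2 - N)"]
    by (simp add: hyp_conv_def int_conv_def)
  have sA: "(\<lambda>N. hyp_geom (N + 2) * alt_hsec (k - N)) summable_on UNIV"
    using summable_reindex_bij[OF bij_int_shift(1)[of 2], of "\<lambda>N. hyp_geom N * alt_hsec (k + 2 - N)"]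
      summable_conv_term[OF summable_hyp_geom summable_alt_hsec, of "k + 2"] by simp
  have B: "Q powi (2 * k + 4) * hyp_conv k = (\<Sum>\<^sub>\<infinity>N. Q powi (2 * k + 4) * (hyp_geom N * alt_hsec (k - N)))"
    by (simp add: hyp_conv_def int_conv_def infsum_cmult_right')
  have sB: "(\<lambda>N. Q powi (2 * k + 4) * (hyp_geom N * alt_hsec (k - N))) summable_on UNIV"
    by (intro summable_on_cmult_right summable_conv_term summable_hyp_geom summable_alt_hsec)
  have "hyp_conv (k + 2) + Q powi (2 * k + 4) * hyp_conv k
      = (\<Sum>\<^sub>\<infinity>N. hyp_geom (N + 2) * alt_hsec (k - N) + Q powi (2 * k + 4) * (hyp_geom N * alt_hsec (k - N)))"
    unfolding A B by (rule infsum_add[symmetric, OF sA sB])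
  \<comment> \<open>\<open>htan (N + 2)\<close> is inserted between the two functions:
    \<open>hyp - htan\<close> is odd, hence has alternating sum zero, and the other piece is a
    shifted difference of \<open>htan\<close>.\<close>
  also have "\<dots> = (\<Sum>\<^sub>\<infinity>N. alt_sign k * Q powi (k + 2) *
      (alt_sign (N + 2) * (hyp (N + 2) - htan (N + 2)) + alt_sign (N + 2) * (htan (N + 2) - htan (N + 2 - (k + 2)))))"
  proof (rule infsum_cong)
    fix N
    define u v where "u = Q powi N" and "v = Q powi k"
    have uv: "u > 0" "v > 0" by (auto simp: u_def v_def)
    have e: "2 * N + 2 = N + N + 2" "2 * k + 4 = k + k + 4" by simp_all
    have Qs: "Q powi (N + 2) = u * Q\<^sup>2" "Q powi (2 * N + 2) = u\<^sup>2 * Q\<^sup>2" "Q powi (2 * k + 4) = v\<^sup>2 * Q ^ 4"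
      "Q powi (k + 2) = v * Q\<^sup>2"
      unfolding e powi_add u_def v_def by (simp_all add: power2_eq_square)
    define S W where "S = hsec (k - N)" and "W = hyp N + 1"
    have ne: "u\<^sup>2 + v\<^sup>2 > 0" using uv by (simp add: add_pos_pos)
    have "Q powi (k - N) + Q powi (- (k - N)) = (u\<^sup>2 + v\<^sup>2) / (u * v)"
      using uv by (simp add: powi_diff u_def[symmetric] v_def[symmetric] field_simps power2_eq_square)
    then have S: "S * (u\<^sup>2 + v\<^sup>2) = u * v"
      using ne by (simp add: S_def hsec_def)
    have "hsec (N - k) = S" using hsec_minus[of "N - k"] by (simp add: S_def)
    then have t1: "htan (N - k) = 1 - 2 * (u / v) * S"
      unfolding htan_alt by (simp add: powi_diff u_def[symmetric] v_def[symmetric])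
    have "hyp_geom (N + 2) * S + v\<^sup>2 * Q ^ 4 * (hyp_geom N * S)
        = u * Q ^ 4 * W * (S * (u\<^sup>2 + v\<^sup>2)) + 2 * u * Q\<^sup>2 * S"
      unfolding hyp_geom_def hyp_rec Qs u_def[symmetric] W_def[symmetric] by algebra
    also have "\<dots> = v * Q\<^sup>2 * (hyp (N + 2) - htan (N - k))"
      unfolding S hyp_rec Qs t1 W_def[symmetric] using uv by (simp add: field_simps power2_eq_square power4_eq_xxxx)
    finally have *: "hyp_geom (N + 2) * S + v\<^sup>2 * Q ^ 4 * (hyp_geom N * S) = v * Q\<^sup>2 * (hyp (N + 2) - htan (N - k))" .
    have tt: "alt_sign (N + 2) * (hyp (N + 2) - htan (N + 2)) + alt_sign (N + 2) * (htan (N + 2) - htan (N + 2 - (k + 2)))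
        = alt_sign N * (hyp (N + 2) - htan (N - k))"
      by (simp add: alt_sign_simps algebra_simps)
    have "hyp_geom (N + 2) * alt_hsec (k - N) + Q powi (2 * k + 4) * (hyp_geom N * alt_hsec (k - N))
        = alt_sign k * alt_sign N * (hyp_geom (N + 2) * S + v\<^sup>2 * Q ^ 4 * (hyp_geom N * S))"
      unfolding Qs alt_hsec_def alt_sign_simps S_def by (simp add: algebra_simps)
    then show "hyp_geom (N + 2) * alt_hsec (k - N) + Q powi (2 * k + 4) * (hyp_geom N * alt_hsec (k - N)) = alt_sign k * Q powi (k + 2) *
      (alt_sign (N + 2) * (hyp (N + 2) - htan (N + 2)) + alt_sign (N + 2) * (htan (N + 2) - htan (N + 2 - (k + 2))))"
      unfolding tt * Qs by simp
  qed
  also have "\<dots> = alt_sign k * Q powi (k + 2) * (\<Sum>\<^sub>\<infinity>N.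
      (alt_sign (N + 2) * (hyp (N + 2) - htan (N + 2)) + alt_sign (N + 2) * (htan (N + 2) - htan (N + 2 - (k + 2)))))"
    by (simp add: infsum_cmult_right')
  also have "(\<Sum>\<^sub>\<infinity>N. (alt_sign (N + 2) * (hyp (N + 2) - htan (N + 2)) + alt_sign (N + 2) * (htan (N + 2) - htan (N + 2 - (k + 2)))))
      = (\<Sum>\<^sub>\<infinity>N. alt_sign N * (hyp N - htan N) + alt_sign N * (htan N - htan (N - (k + 2))))"
    by (rule infsum_reindex_bij[OF bij_int_shift(1)[of 2]])
  also have "\<dots> = 0"
    by (subst infsum_add[OF summable_alt_sign[OF summable_hyp_minus_htan] summable_alt_sign[OF summable_htan_diff]])
       (simp add: infsum_alt_hyp_minus_htan infsum_alt_htan_diff)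
  finally show ?thesis by simp
qed

text \<open>This is half of \<open>c_k\<close>: dividing by \<open>Q powi k\<close> removes the
  weights \<open>Q powi N\<close> and \<open>Q powi (k - N)\<close> hidden in
  \<open>hyp_geom\<close> and \<open>alt_hsec\<close>. The exponent in the recurrence drops from
  \<open>2 * k + 4\<close> to \<open>2 * k + 2\<close>, and along even \<open>k\<close> these
  exponents add up to \<open>2 * j^2\<close>, those of \<open>theta4 (Q^2)\<close>.\<close>

definition hyp_coeff :: "int \<Rightarrow> real" where "hyp_coeff k = Q powi (- k) * hyp_conv k"

lemma hyp_coeff_rec: "hyp_coeff (k + 2) = - (Q powi (2 * k + 2)) * hyp_coeff k"
  by (simp add: hyp_coeff_def hyp_conv_rec powi_add power_int_minus power_int_diff mult_2 field_simps)

lemma alternating_powi_rec: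
  assumes "\<And>j. f (j + 1) = - (Q powi (g (j + 1) - g j)) * f j"
  shows "f j = alt_sign j * Q powi (g j - g 0) * f 0"
proof (induction j rule: int_induct[of _ 0])
  case (step1 i)
  have "Q powi (g (i + 1)) > 0" "Q powi (g i) > 0" "Q powi (g 0) > 0" by simp_all
  then show ?case unfolding assms[of i] step1(2) alt_sign_simps powi_diff by (simp add: field_simps)
next
  case (step2 i)
  have *: "Q powi (g (i - 1)) > 0" "Q powi (g i) > 0" "Q powi (g 0) > 0" by simp_all
  have 1: "- (Q powi (g i) / Q powi (g (i - 1))) * f (i - 1) = alt_sign i * (Q powi (g i) / Q powi (g 0)) * f 0"
    using assms[of "i - 1"] step2(2) by (simp add: powi_diff)
  have 2: "f (i - 1) = - (Q powi (g (i - 1)) / Q powi (g i)) * (- (Q powi (g i) / Q powi (g (i - 1))) * f (i - 1))"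
    using * by simp
  have "f (i - 1) = - (Q powi (g (i - 1)) / Q powi (g i)) * (alt_sign i * (Q powi (g i) / Q powi (g 0)) * f 0)"
    by (subst 2) (simp only: 1)
  then have "f (i - 1) = - alt_sign i * (Q powi (g (i - 1)) / Q powi (g 0)) * f 0"
    using * by simp
  then show ?case by (simp add: alt_sign_simps powi_diff)
qed (simp add: alt_sign_simps)

lemma hyp_coeff_even: "hyp_coeff (2 * j) = alt_sign j * Q powi (2 * j\<^sup>2) * hyp_coeff 0"
proof -
  have "hyp_coeff (2 * j) = alt_sign j * Q powi (2 * j\<^sup>2 - 2 * 0\<^sup>2) * hyp_coeff (2 * 0)"
  proof (rule alternating_powi_rec[where f = "\<lambda>j. hyp_coeff (2 * j)" and g = "\<lambda>j. 2 * j\<^sup>2"])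
    fix j :: int
    have "2 * (j + 1)\<^sup>2 - 2 * j\<^sup>2 = 2 * (2 * j) + 2" "2 * (j + 1) = 2 * j + 2"
      by (simp_all add: power2_eq_square algebra_simps)
    then show "hyp_coeff (2 * (j + 1)) = - (Q powi (2 * (j + 1)\<^sup>2 - 2 * j\<^sup>2)) * hyp_coeff (2 * j)"
      by (simp only: hyp_coeff_rec)
  qed
  then show ?thesis by simp
qed

lemma hyp_coeff_odd: "hyp_coeff (2 * j + 1) = alt_sign j * Q powi (2 * (j\<^sup>2 + j)) * hyp_coeff 1"
proof -
  have "hyp_coeff (2 * j + 1) = alt_sign j * Q powi (2 * (j\<^sup>2 + j) - 2 * (0\<^sup>2 + 0)) * hyp_coeff (2 * 0 + 1)"
  proof (rule alternating_powi_rec[where f = "\<lambda>j. hyp_coeff (2 * j + 1)" and g = "\<lambda>j. 2 * (j\<^sup>2 + j)"])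
    fix j :: int
    have "2 * ((j + 1)\<^sup>2 + (j + 1)) - 2 * (j\<^sup>2 + j) = 2 * (2 * j + 1) + 2" "2 * (j + 1) + 1 = (2 * j + 1) + 2"
      by (simp_all add: power2_eq_square algebra_simps)
    then show "hyp_coeff (2 * (j + 1) + 1) = - (Q powi (2 * ((j + 1)\<^sup>2 + (j + 1)) - 2 * (j\<^sup>2 + j))) * hyp_coeff (2 * j + 1)"
      by (simp only: hyp_coeff_rec)
  qed
  then show ?thesis by simp
qed

lemma summable_powi_quadratic:
  assumes "\<And>j. g j \<ge> \<bar>j\<bar> - c"
  shows "(\<lambda>j. alt_sign j * Q powi (g j)) summable_on UNIV"
proof (rule summable_geom_bdI)
  fix j
  have "Q powi (g j) \<le> Q powi (\<bar>j\<bar> - c)"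
    using assms[of j] Q_pos Q_less_1 by (intro power_int_decreasing) auto
  also have "\<dots> = Q ^ nat \<bar>j\<bar> / Q powi c" by (simp add: powi_diff powi_nat_abs)
  also have "\<dots> \<le> geom_bd Q j / Q powi c" by (rule divide_right_mono[OF pow_le_geom_bd]) simp
  finally show "\<bar>alt_sign j * Q powi (g j)\<bar> \<le> 1 / Q powi c * geom_bd Q j"
    by (simp add: abs_mult alt_sign_simps)
qed

lemma theta4_square_eq: "theta4 (Q\<^sup>2) = (\<Sum>\<^sub>\<infinity>j. alt_sign j * Q powi (2 * j\<^sup>2))"
  by (simp add: theta4_def power_int_def nat_mult_distrib power_mult)

lemma infsum_hyp_coeff:
  shows "infsum hyp_coeff UNIV = theta4 (Q\<^sup>2) * hyp_coeff 0" "hyp_coeff summable_on UNIV"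
proof -
  have g: "2 * j\<^sup>2 \<ge> \<bar>j\<bar> - 0" "2 * (j\<^sup>2 + j) \<ge> \<bar>j\<bar> - 2" for j :: int
  proof -
    have "j\<^sup>2 \<ge> \<bar>j\<bar>" "j\<^sup>2 \<ge> 0" by (simp_all add: abs_le_square_int)
    then show "2 * j\<^sup>2 \<ge> \<bar>j\<bar> - 0" by linarith
    have "(j + 1)\<^sup>2 = j\<^sup>2 + 2 * j + 1" by (simp add: power2_eq_square algebra_simps)
    moreover have "(j + 1)\<^sup>2 \<ge> - (j + 1)" using abs_le_square_int[of "j + 1"] by linarith
    moreover have "j\<^sup>2 \<ge> j" "j\<^sup>2 \<ge> - j" using abs_le_square_int[of j] by linarith+
    ultimately show "2 * (j\<^sup>2 + j) \<ge> \<bar>j\<bar> - 2" 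
      by (cases "j \<ge> 0") (simp_all add: distrib_left)
  qed
  have s0: "(\<lambda>j. alt_sign j * Q powi (2 * j\<^sup>2)) summable_on UNIV"
    by (rule summable_powi_quadratic[OF g(1)])
  have s1: "(\<lambda>j. alt_sign j * Q powi (2 * (j\<^sup>2 + j))) summable_on UNIV"
    by (rule summable_powi_quadratic[OF g(2)])
  have "(\<Sum>\<^sub>\<infinity>j. alt_sign j * Q powi (2 * (j\<^sup>2 + j))) = 0"
  proof (rule infsum_antisym[OF bij_int_shift(3)[of "-1"]])
    fix j :: int
    have "(-1 - j)\<^sup>2 + (-1 - j) = j\<^sup>2 + j" by (simp add: power2_eq_square algebra_simps)
    moreover have "alt_sign (-1 - j) = - alt_sign j" by (simp add: alt_sign_simps)
    ultimately show "alt_sign (-1 - j) * Q powi (2 * ((-1 - j)\<^sup>2 + (-1 - j))) = - (alt_sign j * Q powi (2 * (j\<^sup>2 + j)))"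
      by (simp only: mult_minus_left)
  qed
  then show "infsum hyp_coeff UNIV = theta4 (Q\<^sup>2) * hyp_coeff 0" "hyp_coeff summable_on UNIV"
    using summable_even_odd[of hyp_coeff] s0 s1
    by (simp_all add: hyp_coeff_even hyp_coeff_odd summable_on_cmult_left infsum_cmult_left' theta4_square_eq)
qed

text \<open>By associativity, \<open>hyp_conv\<close> convolved with \<open>hsec\<close> is a multiple of \<open>hyp_geom\<close>. Inserting this in
  the recurrence of \<open>hyp_geom\<close> at \<open>0\<close> and \<open>2\<close> collapses the left side to the sum of all \<open>hyp_coeff\<close>,
  of which those at odd positions cancel in pairs.\<close>

lemma theta4_coeff_0: "theta4 (Q\<^sup>2) * hyp_coeff 0 = 2 * hsec_const"
proof -
  have C: "int_conv hyp_conv hsec k = hsec_const * hyp_geom k" for k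
  proof -
    have "int_conv hyp_conv hsec k = int_conv hyp_geom (int_conv alt_hsec hsec) k"
      unfolding hyp_conv_def by (rule int_conv_assoc[OF summable_hyp_geom summable_alt_hsec summable_hsec])
    also have "\<dots> = (\<Sum>\<^sub>\<infinity>N. if N = k then hyp_geom k * hsec_const else 0)"
      unfolding int_conv_def[of hyp_geom] by (rule infsum_cong) (simp add: conv_alt_hsec_hsec)
    also have "\<dots> = hsec_const * hyp_geom k"
      by (subst infsum_cong_neutral[where T = "{k}" and g = "\<lambda>_. hyp_geom k * hsec_const"]) auto
    finally show ?thesis .
  qed
  have pr: "hyp 2 = Q\<^sup>2 * (hyp 0 + 1) + 1" using hyp_rec[of 0] by simp
  \<comment> \<open>Since \<open>hyp 2 + 1 = Q^2 * (hyp 0 + 1) + 2\<close>, the weights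
    \<open>Q powi (-2)\<close> and \<open>Q^2\<close> isolate the inhomogeneous term
    \<open>2\<close>.\<close>
  have "2 * hsec_const = Q powi (-2) * (hsec_const * hyp_geom 2) - Q\<^sup>2 * (hsec_const * hyp_geom 0)"
    unfolding hyp_geom_def pr by (simp add: power_int_minus field_simps)
  also have "\<dots> = Q powi (-2) * int_conv hyp_conv hsec 2 - Q\<^sup>2 * int_conv hyp_conv hsec 0"
    by (simp add: C)
  also have "int_conv hyp_conv hsec 2 = (\<Sum>\<^sub>\<infinity>m. hyp_conv (m + 2) * hsec m)"
    using infsum_reindex_bij[OF bij_int_shift(1)[of 2], of "\<lambda>N. hyp_conv N * hsec (2 - N)"]
    by (simp add: int_conv_def)
  also have "int_conv hyp_conv hsec 0 = (\<Sum>\<^sub>\<infinity>m. hyp_conv m * hsec m)"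
    by (simp add: int_conv_def)
  also have "Q powi (-2) * (\<Sum>\<^sub>\<infinity>m. hyp_conv (m + 2) * hsec m) - Q\<^sup>2 * (\<Sum>\<^sub>\<infinity>m. hyp_conv m * hsec m)
      = (\<Sum>\<^sub>\<infinity>m. Q powi (-2) * (hyp_conv (m + 2) * hsec m) + - (Q\<^sup>2) * (hyp_conv m * hsec m))"
  proof (subst infsum_add)
    have "(\<lambda>m. hyp_conv (m + 2) * hsec m) summable_on UNIV"
      using summable_reindex_bij[OF bij_int_shift(1)[of 2], of "\<lambda>N. hyp_conv N * hsec (2 - N)"]
        summable_conv_term[OF summable_hyp_conv summable_hsec, of 2] by simp
    then show "(\<lambda>m. Q powi (-2) * (hyp_conv (m + 2) * hsec m)) summable_on UNIV"
      by (rule summable_on_cmult_right)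
    have "(\<lambda>m. hyp_conv m * hsec m) summable_on UNIV"
      using summable_conv_term[OF summable_hyp_conv summable_hsec, of 0] by simp
    then show "(\<lambda>m. - (Q\<^sup>2) * (hyp_conv m * hsec m)) summable_on UNIV"
      by (rule summable_on_cmult_right)
  qed (simp add: infsum_cmult_right' infsum_uminus)
  \<comment> \<open>By \<open>hyp_conv_rec\<close> both summands are multiples of
    \<open>hyp_conv m * hsec m\<close>; together they contain \<open>u^2 + 1\<close>, which cancels
    the denominator of \<open>hsec m\<close>.\<close>
  also have "\<dots> = (\<Sum>\<^sub>\<infinity>m. hyp_coeff (m + 2))"
  proof (rule infsum_cong)
    fix m
    define u where "u = Q powi m"
    have u: "u > 0" by (simp add: u_def)
    have e: "2 * m + 4 = m + m + 4" "- (m + 2) = - m - 2" by simp_all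
    have Qs: "Q powi (2 * m + 4) = u\<^sup>2 * Q ^ 4" "Q powi (- (m + 2)) = 1 / (u * Q\<^sup>2)"
      unfolding e powi_add powi_diff by (simp_all add: u_def power2_eq_square power_int_minus field_simps)
    have "u\<^sup>2 + 1 > 0" using u by (simp add: add_pos_pos)
    moreover have "hsec m = u / (u\<^sup>2 + 1)"
      using u by (simp add: hsec_def u_def[symmetric] power_int_minus field_simps power2_eq_square)
    ultimately have "hsec m * (u\<^sup>2 + 1) = u" by simp
    have "Q powi (-2) * (hyp_conv (m + 2) * hsec m) + - (Q\<^sup>2) * (hyp_conv m * hsec m) = - Q\<^sup>2 * hyp_conv m * (hsec m * (u\<^sup>2 + 1))"
      unfolding hyp_conv_rec Qs by (simp add: power_int_minus field_simps power2_eq_square power4_eq_xxxx)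
    also have "\<dots> = hyp_coeff (m + 2)"
      unfolding \<open>hsec m * (u\<^sup>2 + 1) = u\<close> hyp_coeff_def hyp_conv_rec Qs using u by (simp add: field_simps power2_eq_square power4_eq_xxxx)
    finally show "Q powi (-2) * (hyp_conv (m + 2) * hsec m) + - (Q\<^sup>2) * (hyp_conv m * hsec m) = hyp_coeff (m + 2)" .
  qed
  also have "\<dots> = infsum hyp_coeff UNIV"
    by (rule infsum_reindex_bij[OF bij_int_shift(1)])
  finally show ?thesis using infsum_hyp_coeff by simp
qed

lemma summable_hyp_geom_alt_hsec: "(\<lambda>N. hyp_geom N * alt_hsec (- N)) summable_on UNIV"
  using summable_conv_term[OF summable_hyp_geom summable_alt_hsec, of 0] by simp

text \<open>Since \<open>2 * Q powi N * hsec N = 1 - htan N\<close>, the terms are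
  \<open>(1 + hyp N) * (1 - htan N)\<close> with alternating sign. Subtracting the vanishing
  alternating sum of \<open>hyp N - htan N\<close> removes the linear part.\<close>

lemma hyp_coeff_0_eq: "2 * hyp_coeff 0 = (\<Sum>\<^sub>\<infinity>N. alt_sign N * (1 - hyp N * htan N))"
proof -
  have "2 * hyp_coeff 0 = (\<Sum>\<^sub>\<infinity>N. 2 * (hyp_geom N * alt_hsec (0 - N)))"
    by (simp add: hyp_coeff_def hyp_conv_def int_conv_def infsum_cmult_right')
  also have "\<dots> = (\<Sum>\<^sub>\<infinity>N. 2 * (hyp_geom N * alt_hsec (0 - N)) + - (alt_sign N * (hyp N - htan N)))"
    by (subst infsum_add)
       (auto simp: infsum_uminus infsum_alt_hyp_minus_htan summable_on_uminus
         intro!: summable_on_cmult_right summable_hyp_geom_alt_hsec summable_alt_sign summable_hyp_minus_htan)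
  also have "\<dots> = (\<Sum>\<^sub>\<infinity>N. alt_sign N * (1 - hyp N * htan N))"
    by (rule infsum_cong) (simp add: hyp_geom_def alt_hsec_def htan_alt alt_sign_simps algebra_simps)
  finally show ?thesis .
qed

end

subsection \<open>Theta constants\<close>

text \<open>The index-two sublattice \<open>x + y\<close> even is a rotated copy of the full lattice
  on which \<open>x^2 + y^2\<close> doubles. This is how products of theta constants pass from
  \<open>Q\<close> to \<open>Q^2\<close>.\<close>

lemma infsum_even_lattice:
  fixes h :: "int \<times> int \<Rightarrow> real"
  assumes "\<And>x y. odd (x + y) \<Longrightarrow> h (x, y) = 0"
  shows "infsum h (UNIV \<times> UNIV) = (\<Sum>\<^sub>\<infinity>(a, b)\<in>UNIV \<times> UNIV. h (a + b, a - b))"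
proof -
  have b: "bij_betw (\<lambda>(a, b). (a + b, a - b)) (UNIV \<times> UNIV) {(x, y). even (x + y :: int)}"
    by (rule bij_betwI[of _ _ _ "\<lambda>(x, y). ((x + y) div 2, (x - y) div 2)"], auto, presburger+)
  have "infsum h (UNIV \<times> UNIV) = infsum h {(x, y). even (x + y :: int)}"
    by (rule infsum_cong_neutral) (use assms in auto)
  also have "\<dots> = (\<Sum>\<^sub>\<infinity>(a, b)\<in>UNIV \<times> UNIV. h (a + b, a - b))"
    using infsum_reindex_bij_betw[OF b, of h] by (simp add: case_prod_unfold)
  finally show ?thesis .
qed

text \<open>For \<open>x \<le> 1 / 2\<close> one factor \<open>x\<close> is split off and the
  remaining power is bounded by a power of \<open>1 / 2\<close>, so the constant is independent of
  \<open>x\<close>. The \<open>4\<close> is the \<open>2\<close> of the hypothesis times the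
  \<open>2\<close> lost in shifting the exponent by one.\<close>

lemma nonneg_sum_near_1:
  fixes f :: "int \<Rightarrow> real"
  assumes x: "0 \<le> x" "x \<le> 1 / 2" and f: "f 0 = 1" "\<And>N. 0 \<le> f N" "\<And>N. f N \<le> 2 * x ^ nat \<bar>N\<bar>"
  shows "f summable_on UNIV" "1 \<le> infsum f UNIV"
    "infsum f UNIV \<le> 1 + x * (4 * infsum (geom_bd (1 / 2)) UNIV)"
proof -
  have S: "geom_bd (1 / 2) summable_on UNIV" by (rule summable_geom_bd) auto
  have le: "f N \<le> (if N = 0 then 1 else 0) + x * (4 * geom_bd (1 / 2) N)" for N
  proof (cases "N = 0")
    case True
    then show ?thesis using x f(1) by (simp add: geom_bd_def)
  next
    case False
    then obtain m where m: "nat \<bar>N\<bar> = Suc m" by (cases "nat \<bar>N\<bar>") auto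
    have "f N \<le> 2 * x ^ Suc m" using f(3)[of N] m by simp
    also have "\<dots> = 2 * x * x ^ m" by simp
    also have "\<dots> \<le> 2 * x * (1 / 2) ^ m" using x by (intro mult_left_mono power_mono) auto
    also have "\<dots> = x * (4 * (1 * (1 / 2) ^ Suc m))" by simp
    also have "\<dots> \<le> x * (4 * geom_bd (1 / 2) N)"
      unfolding geom_bd_def m using x by (intro mult_left_mono mult_right_mono) auto
    finally show ?thesis using False by simp
  qed
  have s1: "(\<lambda>N::int. if N = 0 then 1 else 0 :: real) summable_on UNIV"
    by (rule finite_nonzero_values_imp_summable_on) (auto intro: finite_subset[of _ "{0}"])
  have S2: "(\<lambda>N. (if N = 0 then 1 else 0) + x * (4 * geom_bd (1 / 2) N)) summable_on UNIV"
    by (intro summable_on_add s1 summable_on_cmult_right S)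
  show sf: "f summable_on UNIV"
    by (rule summable_on_real_comparison[OF S2]) (use le f(2) in auto)
  have i1: "infsum (\<lambda>N::int. if N = 0 then 1 else 0 :: real) UNIV = 1"
    by (subst infsum_cong_neutral[where T = "{0}" and g = "\<lambda>_. 1"]) auto
  have "infsum f UNIV \<le> (\<Sum>\<^sub>\<infinity>N. (if N = 0 then 1 else 0) + x * (4 * geom_bd (1 / 2) N))"
    by (rule infsum_mono[OF sf S2]) (use le in auto)
  also have "\<dots> = 1 + x * (4 * infsum (geom_bd (1 / 2)) UNIV)"
    by (subst infsum_add[OF s1]) (simp_all add: i1 infsum_cmult_right' summable_on_cmult_right S)
  finally show "infsum f UNIV \<le> 1 + x * (4 * infsum (geom_bd (1 / 2)) UNIV)" .
  show "1 \<le> infsum f UNIV"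
    using finite_sum_le_infsum[OF sf, of "{0}"] f by simp
qed

section \<open>Quadratic relations between theta constants and Jacobi's two-square theorem\<close>

context nome
begin

lemma nome_square: "nome (Q\<^sup>2)"
  by unfold_locales (use Q_pos Q_less_1 in \<open>auto simp: power_less_one_iff\<close>)

definition theta3_seq :: "int \<Rightarrow> real" where "theta3_seq k = Q powi (k\<^sup>2)"
definition theta4_seq :: "int \<Rightarrow> real" where "theta4_seq k = alt_sign k * Q powi (k\<^sup>2)"

lemma theta_seqs: "theta3 Q = infsum theta3_seq UNIV" "theta4 Q = infsum theta4_seq UNIV"
  by (simp_all add: theta3_def theta4_def theta3_seq_def[abs_def] theta4_seq_def[abs_def] power_int_def)

lemma summable_theta4_seq: "theta4_seq summable_on UNIV"
  unfolding theta4_seq_def[abs_def] by (rule summable_powi_quadratic[where c = 0]) (use abs_le_square_int in auto)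

lemma summable_theta3_seq: "theta3_seq summable_on UNIV"
  using summable_alt_sign[OF summable_theta4_seq] by (simp add: theta3_seq_def[abs_def] theta4_seq_def alt_sign_simps)

text \<open>The exponents \<open>(k + 1 - N)^2\<close> and \<open>2 * k + 1 + (k - N)^2\<close> are
  a common value minus and plus \<open>N\<close>, so their sum cancels the denominator of
  \<open>hsec N\<close>. The common value is symmetric under \<open>N -> 2 * k + 1 - N\<close>, a
  reflection that reverses the sign.\<close>

lemma conv_alt_hsec_theta3: "int_conv alt_hsec theta3_seq k = theta4_seq k * int_conv alt_hsec theta3_seq 0"
proof -
  define F where "F = int_conv alt_hsec theta3_seq"
  have sF: "(\<lambda>N. alt_hsec N * theta3_seq (k - N)) summable_on UNIV" for k
    by (rule summable_conv_term[OF summable_alt_hsec summable_theta3_seq])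
  have "F k = alt_sign k * Q powi (k\<^sup>2 - 0\<^sup>2) * F 0"
  proof (rule alternating_powi_rec[where g = "\<lambda>k. k\<^sup>2"])
    fix k :: int
    have e1: "(k + 1)\<^sup>2 - k\<^sup>2 = 2 * k + 1" by (simp add: power2_eq_square algebra_simps)
    have "F (k + 1) + Q powi (2 * k + 1) * F k
        = (\<Sum>\<^sub>\<infinity>N. alt_hsec N * theta3_seq (k + 1 - N) + Q powi (2 * k + 1) * (alt_hsec N * theta3_seq (k - N)))"
      by (subst infsum_add[OF sF summable_on_cmult_right[OF sF]])
         (simp add: F_def int_conv_def infsum_cmult_right')
    also have "\<dots> = (\<Sum>\<^sub>\<infinity>N. alt_sign N * Q powi ((k - N)\<^sup>2 + (2 * k + 1 - N)))"
    proof (rule infsum_cong)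
      fix N
      have e2: "(k + 1 - N)\<^sup>2 = ((k - N)\<^sup>2 + (2 * k + 1 - N)) + - N"
        and e3: "2 * k + 1 + (k - N)\<^sup>2 = ((k - N)\<^sup>2 + (2 * k + 1 - N)) + N"
        by (simp_all add: power2_eq_square algebra_simps)
      have "hsec N * (Q powi N + Q powi (- N)) = 1"
        using hsec_denom_pos[of N] by (simp add: hsec_def)
      moreover have "alt_hsec N * theta3_seq (k + 1 - N) + Q powi (2 * k + 1) * (alt_hsec N * theta3_seq (k - N))
          = alt_sign N * hsec N * (Q powi ((k + 1 - N)\<^sup>2) + Q powi (2 * k + 1 + (k - N)\<^sup>2))"
        by (simp add: alt_hsec_def theta3_seq_def powi_add algebra_simps)
      ultimately show "alt_hsec N * theta3_seq (k + 1 - N) + Q powi (2 * k + 1) * (alt_hsec N * theta3_seq (k - N))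
          = alt_sign N * Q powi ((k - N)\<^sup>2 + (2 * k + 1 - N))"
        unfolding e2 e3 powi_add[of _ "- N"] powi_add[of _ N] by algebra
    qed
    also have "\<dots> = 0"
    proof (rule infsum_antisym[OF bij_int_shift(3)[of "2 * k + 1"]])
      fix N :: int
      have "(k - (2 * k + 1 - N))\<^sup>2 + (2 * k + 1 - (2 * k + 1 - N)) = (k - N)\<^sup>2 + (2 * k + 1 - N)"
        by (simp add: power2_eq_square algebra_simps)
      moreover have "alt_sign (2 * k + 1 - N) = - alt_sign N" by (simp add: alt_sign_def)
      ultimately show "alt_sign (2 * k + 1 - N) * Q powi ((k - (2 * k + 1 - N))\<^sup>2 + (2 * k + 1 - (2 * k + 1 - N)))
          = - (alt_sign N * Q powi ((k - N)\<^sup>2 + (2 * k + 1 - N)))"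
        by (simp only: mult_minus_left)
    qed
    finally show "F (k + 1) = - (Q powi ((k + 1)\<^sup>2 - k\<^sup>2)) * F k"
      unfolding e1 by simp
  qed
  then show ?thesis by (simp add: F_def theta4_seq_def)
qed

lemma conv_hsec_theta4: "int_conv hsec theta4_seq k = alt_sign k * int_conv alt_hsec theta3_seq k"
  unfolding int_conv_def by (subst infsum_cmult_right'[symmetric], rule infsum_cong)
    (simp add: theta4_seq_def theta3_seq_def alt_hsec_def alt_sign_simps algebra_simps)

text \<open>The same constant \<open>C\<close> governs both convolutions: summing them gives
  \<open>theta4 Q * C\<close> and \<open>theta3 Q * C\<close>, and \<open>C\<close> is eliminated.
  As a result one number \<open>kappa\<close> serves both \<open>hsec\<close> and
  \<open>alt_hsec\<close>.\<close>

lemma hsec_theta_ratio: "infsum hsec UNIV * (theta4 Q)\<^sup>2 = infsum alt_hsec UNIV * (theta3 Q)\<^sup>2"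
proof -
  define C where "C = int_conv alt_hsec theta3_seq 0"
  have "infsum alt_hsec UNIV * theta3 Q = infsum (int_conv alt_hsec theta3_seq) UNIV"
    unfolding theta_seqs by (rule infsum_conv[symmetric, OF summable_alt_hsec summable_theta3_seq])
  also have "int_conv alt_hsec theta3_seq = (\<lambda>k. theta4_seq k * C)"
    by (rule ext) (metis conv_alt_hsec_theta3 C_def)
  finally have 1: "infsum alt_hsec UNIV * theta3 Q = theta4 Q * C"
    by (simp add: infsum_cmult_left' theta_seqs)
  have "infsum hsec UNIV * theta4 Q = infsum (int_conv hsec theta4_seq) UNIV"
    unfolding theta_seqs by (rule infsum_conv[symmetric, OF summable_hsec summable_theta4_seq])
  also have "int_conv hsec theta4_seq = (\<lambda>k. theta3_seq k * C)"
  proof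
    fix k
    have "int_conv hsec theta4_seq k = alt_sign k * (theta4_seq k * C)"
      unfolding conv_hsec_theta4 C_def using conv_alt_hsec_theta3[of k] by simp
    then show "int_conv hsec theta4_seq k = theta3_seq k * C" by (simp add: theta4_seq_def theta3_seq_def alt_sign_simps)
  qed
  finally have 2: "infsum hsec UNIV * theta4 Q = theta3 Q * C"
    by (simp add: infsum_cmult_left' theta_seqs)
  show ?thesis using 1 2 by (simp add: power2_eq_square mult.assoc[symmetric])
qed

lemma hsec_const_eq: "hsec_const = infsum alt_hsec UNIV * infsum hsec UNIV"
proof -
  have "infsum alt_hsec UNIV * infsum hsec UNIV = infsum (int_conv alt_hsec hsec) UNIV"
    by (rule infsum_conv[symmetric, OF summable_alt_hsec summable_hsec])
  also have "\<dots> = hsec_const"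
    by (subst infsum_cong_neutral[where T = "{0}" and g = "\<lambda>_. hsec_const"]) (auto simp: conv_alt_hsec_hsec)
  finally show ?thesis ..
qed

lemma theta3_square_eq: "theta3 (Q\<^sup>2) = (\<Sum>\<^sub>\<infinity>k. Q powi (2 * k\<^sup>2))"
  by (simp add: theta3_def power_int_def nat_mult_distrib power_mult)

lemma summable_theta_square:
  "(\<lambda>k. alt_sign k * Q powi (2 * k\<^sup>2)) summable_on UNIV" "(\<lambda>k. Q powi (2 * k\<^sup>2)) summable_on UNIV"
proof -
  show "(\<lambda>k. alt_sign k * Q powi (2 * k\<^sup>2)) summable_on UNIV"
  proof (rule summable_powi_quadratic[where c = 0])
    fix j :: int
    show "\<bar>j\<bar> - 0 \<le> 2 * j\<^sup>2" using abs_le_square_int[of j] zero_le_power2[of j] by linarith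
  qed
  from summable_alt_sign[OF this] show "(\<lambda>k. Q powi (2 * k\<^sup>2)) summable_on UNIV" by (simp add: alt_sign_simps)
qed

lemma theta3_sq_plus_theta4_sq: "(theta3 Q)\<^sup>2 + (theta4 Q)\<^sup>2 = 2 * (theta3 (Q\<^sup>2))\<^sup>2"
proof -
  have "(theta3 Q)\<^sup>2 + (theta4 Q)\<^sup>2
      = (\<Sum>\<^sub>\<infinity>(x, y)\<in>UNIV \<times> UNIV. theta3_seq x * theta3_seq y) + (\<Sum>\<^sub>\<infinity>(x, y)\<in>UNIV \<times> UNIV. theta4_seq x * theta4_seq y)"
    using infsum_prod[OF summable_theta3_seq summable_theta3_seq] infsum_prod[OF summable_theta4_seq summable_theta4_seq]
    by (simp add: theta_seqs power2_eq_square)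
  also have "\<dots> = (\<Sum>\<^sub>\<infinity>z\<in>UNIV \<times> UNIV. (case z of (x, y) \<Rightarrow> theta3_seq x * theta3_seq y) + (case z of (x, y) \<Rightarrow> theta4_seq x * theta4_seq y))"
    by (rule infsum_add[symmetric]; rule summable_prod) (auto simp: summable_theta3_seq summable_theta4_seq)
  also have "\<dots> = (\<Sum>\<^sub>\<infinity>(x, y)\<in>UNIV \<times> UNIV. 2 * Q powi (2 * x\<^sup>2) * Q powi (2 * y\<^sup>2))"
  proof (rule trans[OF infsum_even_lattice], goal_cases)
    case (1 x y)
    then have "alt_sign x * alt_sign y = -1" by (simp add: alt_sign_simps(1)[symmetric]) (simp add: alt_sign_def)
    moreover have "theta4_seq x * theta4_seq y = (alt_sign x * alt_sign y) * (theta3_seq x * theta3_seq y)" by (simp add: theta3_seq_def theta4_seq_def)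
    ultimately show ?case by simp
  next
    case 2
    show ?case
    proof (rule infsum_cong, goal_cases)
      case (1 z)
      obtain a b where z: "z = (a, b)" by (cases z)
      have "(a + b)\<^sup>2 + (a - b)\<^sup>2 = 2 * a\<^sup>2 + 2 * b\<^sup>2" by (simp add: power2_eq_square algebra_simps)
      then have *: "theta3_seq (a + b) * theta3_seq (a - b) = Q powi (2 * a\<^sup>2) * Q powi (2 * b\<^sup>2)"
        unfolding theta3_seq_def powi_add[symmetric] by simp
      have "theta4_seq (a + b) * theta4_seq (a - b) = (alt_sign (a + b) * alt_sign (a - b)) * (theta3_seq (a + b) * theta3_seq (a - b))"
        by (simp add: theta3_seq_def theta4_seq_def)
      also have "alt_sign (a + b) * alt_sign (a - b) = 1" by (simp add: alt_sign_def)
      finally show ?case unfolding z using * by simp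
    qed
  qed
  also have "\<dots> = 2 * (theta3 (Q\<^sup>2))\<^sup>2"
    using infsum_prod[of "\<lambda>x. 2 * Q powi (2 * x\<^sup>2)" UNIV "\<lambda>x. Q powi (2 * x\<^sup>2)" UNIV]
    by (simp add: summable_theta_square summable_on_cmult_right infsum_cmult_right' theta3_square_eq theta4_square_eq
        power2_eq_square[of "infsum _ _"])
  finally show ?thesis .
qed

lemma theta3_times_theta4: "theta3 Q * theta4 Q = (theta4 (Q\<^sup>2))\<^sup>2"
proof -
  \<comment> \<open>A single mixed product does not vanish for odd \<open>x + y\<close>; the sum
    over both orders has the factor \<open>alt_sign x + alt_sign y\<close>, which does.\<close>
  have "2 * (theta3 Q * theta4 Q)
      = (\<Sum>\<^sub>\<infinity>(x, y)\<in>UNIV \<times> UNIV. theta3_seq x * theta4_seq y) + (\<Sum>\<^sub>\<infinity>(x, y)\<in>UNIV \<times> UNIV. theta4_seq x * theta3_seq y)"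
    using infsum_prod[OF summable_theta3_seq summable_theta4_seq] infsum_prod[OF summable_theta4_seq summable_theta3_seq]
    by (simp add: theta_seqs)
  also have "\<dots> = (\<Sum>\<^sub>\<infinity>z\<in>UNIV \<times> UNIV. (case z of (x, y) \<Rightarrow> theta3_seq x * theta4_seq y) + (case z of (x, y) \<Rightarrow> theta4_seq x * theta3_seq y))"
    by (rule infsum_add[symmetric]; rule summable_prod) (auto simp: summable_theta3_seq summable_theta4_seq)
  also have "\<dots> = (\<Sum>\<^sub>\<infinity>(x, y)\<in>UNIV \<times> UNIV. 2 * (alt_sign x * Q powi (2 * x\<^sup>2)) * (alt_sign y * Q powi (2 * y\<^sup>2)))"
  proof (rule trans[OF infsum_even_lattice], goal_cases)
    case (1 x y)
    then have "alt_sign x + alt_sign y = 0" by (auto simp: alt_sign_def)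
    moreover have "theta3_seq x * theta4_seq y + theta4_seq x * theta3_seq y = (alt_sign x + alt_sign y) * (theta3_seq x * theta3_seq y)"
      by (simp add: theta3_seq_def theta4_seq_def algebra_simps)
    ultimately show ?case by simp
  next
    case 2
    show ?case
    proof (rule infsum_cong, goal_cases)
      case (1 z)
      obtain a b where z: "z = (a, b)" by (cases z)
      have "(a + b)\<^sup>2 + (a - b)\<^sup>2 = 2 * a\<^sup>2 + 2 * b\<^sup>2" by (simp add: power2_eq_square algebra_simps)
      then have *: "theta3_seq (a + b) * theta3_seq (a - b) = Q powi (2 * a\<^sup>2) * Q powi (2 * b\<^sup>2)"
        unfolding theta3_seq_def powi_add[symmetric] by simp
      have "theta3_seq (a + b) * theta4_seq (a - b) + theta4_seq (a + b) * theta3_seq (a - b)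
          = (alt_sign (a - b) + alt_sign (a + b)) * (theta3_seq (a + b) * theta3_seq (a - b))"
        by (simp add: theta3_seq_def theta4_seq_def algebra_simps)
      also have "\<dots> = 2 * (alt_sign a * Q powi (2 * a\<^sup>2)) * (alt_sign b * Q powi (2 * b\<^sup>2))"
        unfolding * by (simp add: alt_sign_simps)
      finally show ?case unfolding z by simp
    qed
  qed
  also have "\<dots> = 2 * (theta4 (Q\<^sup>2))\<^sup>2"
    using infsum_prod[of "\<lambda>x. 2 * (alt_sign x * Q powi (2 * x\<^sup>2))" UNIV "\<lambda>x. alt_sign x * Q powi (2 * x\<^sup>2)" UNIV]
    by (simp add: summable_theta_square summable_on_cmult_right infsum_cmult_right' theta3_square_eq theta4_square_eq
        power2_eq_square[of "infsum _ _"])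
  finally show ?thesis by simp
qed

lemma hsec_landen: "infsum hsec UNIV + infsum alt_hsec UNIV = 2 * infsum (nome.hsec (Q\<^sup>2)) UNIV"
proof -
  interpret Q2: nome "Q\<^sup>2" by (rule nome_square)
  have "Q powi (2 * j) = Q\<^sup>2 powi j" for j by (simp add: power_int_mult)
  from this[of "- j" for j] this have e: "hsec (2 * j) = Q2.hsec j" for j
    by (simp add: hsec_def Q2.hsec_def)
  have "infsum hsec UNIV + infsum alt_hsec UNIV = (\<Sum>\<^sub>\<infinity>N. hsec N + alt_hsec N)"
    by (rule infsum_add[symmetric, OF summable_hsec summable_alt_hsec])
  also have "\<dots> = (\<Sum>\<^sub>\<infinity>j. hsec (2 * j) + alt_hsec (2 * j)) + (\<Sum>\<^sub>\<infinity>j. hsec (2 * j + 1) + alt_hsec (2 * j + 1))"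
    by (rule summable_even_odd(2))
       (simp_all add: alt_hsec_def alt_sign_def e summable_on_cmult_right Q2.summable_hsec)
  also have "\<dots> = 2 * infsum Q2.hsec UNIV"
    by (simp add: alt_hsec_def alt_sign_def e infsum_cmult_right')
  finally show ?thesis .
qed

lemma theta3_ge_1: "1 \<le> theta3 Q"
proof -
  have "sum theta3_seq {0} \<le> infsum theta3_seq UNIV"
    by (rule finite_sum_le_infsum[OF summable_theta3_seq]) (auto simp: theta3_seq_def)
  then show ?thesis by (simp add: theta_seqs theta3_seq_def)
qed

text \<open>That \<open>kappa = 1\<close> is Jacobi's two-square theorem. It is invariant under \<open>Q \<mapsto> Q\<^sup>2\<close> and tends to \<open>1\<close>
  as \<open>Q\<close> tends to \<open>0\<close>.\<close>

definition kappa :: real where "kappa = 2 * infsum hsec UNIV / (theta3 Q)\<^sup>2"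

lemma kappa_hsec: "2 * infsum hsec UNIV = kappa * (theta3 Q)\<^sup>2"
  and kappa_alt_hsec: "2 * infsum alt_hsec UNIV = kappa * (theta4 Q)\<^sup>2"
  using theta3_ge_1 hsec_theta_ratio by (auto simp: kappa_def field_simps)

text \<open>Adding \<open>kappa_hsec\<close> and \<open>kappa_alt_hsec\<close> lets both sides
  double at once: the sums by \<open>hsec_landen\<close>, the squares by
  \<open>theta3_sq_plus_theta4_sq\<close>.\<close>

lemma kappa_invariant: "kappa = nome.kappa (Q\<^sup>2)"
proof -
  interpret Q2: nome "Q\<^sup>2" by (rule nome_square)
  have "2 * (2 * infsum Q2.hsec UNIV) = kappa * ((theta3 Q)\<^sup>2 + (theta4 Q)\<^sup>2)"
    using hsec_landen kappa_hsec kappa_alt_hsec by (simp add: distrib_left)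
  also have "\<dots> = 2 * (kappa * (theta3 (Q\<^sup>2))\<^sup>2)"
    by (simp add: theta3_sq_plus_theta4_sq)
  finally have "Q2.kappa * (theta3 (Q\<^sup>2))\<^sup>2 = kappa * (theta3 (Q\<^sup>2))\<^sup>2"
    using Q2.kappa_hsec by simp
  then show ?thesis using Q2.theta3_ge_1 by auto
qed

lemma kappa_bounds:
  assumes "Q \<le> 1 / 2"
  defines "e \<equiv> 1 + Q * (4 * infsum (geom_bd (1 / 2)) UNIV)"
  shows "1 / e\<^sup>2 \<le> kappa" "kappa \<le> e"
proof -
  have "hsec 0 = 1 / 2" by (simp add: hsec_def)
  have 1: "1 \<le> infsum (\<lambda>N. 2 * hsec N) UNIV" "infsum (\<lambda>N. 2 * hsec N) UNIV \<le> e"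
    unfolding e_def using nonneg_sum_near_1(2,3)[of Q "\<lambda>N. 2 * hsec N"] assms(1) hsec_le hsec_pos \<open>hsec 0 = 1 / 2\<close>
    by (auto simp: less_imp_le)
  have theta3_seq: "theta3_seq N \<le> 1 * Q ^ nat \<bar>N\<bar>" for N
    unfolding theta3_seq_def powi_nat_abs using abs_le_square_int[of N] Q_pos Q_less_1
    by (simp add: power_int_decreasing)
  have theta3_seq': "theta3_seq N \<le> 2 * Q ^ nat \<bar>N\<bar>" for N
    by (rule order_trans[OF theta3_seq mult_right_mono]) auto
  have 2: "infsum theta3_seq UNIV \<le> e"
    unfolding e_def using nonneg_sum_near_1[of Q theta3_seq] assms(1) theta3_seq' by (simp add: theta3_seq_def)
  have th: "1 \<le> theta3 Q" "theta3 Q \<le> e" using 2 theta3_ge_1 by (auto simp: theta_seqs)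
  have k: "kappa = infsum (\<lambda>N. 2 * hsec N) UNIV / (theta3 Q)\<^sup>2"
    by (simp add: kappa_def infsum_cmult_right')
  have "1 / e\<^sup>2 \<le> 1 / (theta3 Q)\<^sup>2"
    using th by (intro divide_left_mono power_mono) auto
  also have "\<dots> \<le> kappa" unfolding k using 1 by (intro divide_right_mono) auto
  finally show "1 / e\<^sup>2 \<le> kappa" .
  have "kappa \<le> infsum (\<lambda>N. 2 * hsec N) UNIV / 1"
    unfolding k using 1 th by (intro divide_left_mono) auto
  then show "kappa \<le> e" using 1 by simp
qed

lemma nome_power: "nome (Q ^ (2 ^ n))" "nome.kappa (Q ^ (2 ^ n)) = kappa"
proof (induction n)
  case (Suc n)
  have e: "Q ^ (2 ^ Suc n) = (Q ^ (2 ^ n))\<^sup>2" by (simp add: power_mult[symmetric] mult.commute)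
  { case 1 show ?case unfolding e using nome.nome_square Suc(1) by blast }
  { case 2 show ?case unfolding e using nome.kappa_invariant[OF Suc(1)] Suc(2) by simp }
qed (simp_all add: nome_axioms)

lemma kappa_eq_1: "kappa = 1"
proof -
  define K where "K = 4 * infsum (geom_bd (1 / 2)) UNIV"
  define x where "x n = Q ^ (2 ^ n)" for n :: nat
  have "x \<longlonglongrightarrow> 0"
    unfolding x_def
  proof (rule tendsto_sandwich[of "\<lambda>_. 0" _ _ "\<lambda>n. Q ^ n"])
    show "\<forall>\<^sub>F n in sequentially. Q ^ 2 ^ n \<le> Q ^ n"
      using Q_pos Q_less_1 by (intro always_eventually allI power_decreasing) (auto intro: less_imp_le)
  qed (use Q_pos Q_less_1 in \<open>auto intro: LIMSEQ_realpow_zero\<close>)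
  then have e: "(\<lambda>n. 1 + x n * K) \<longlonglongrightarrow> 1 + 0 * K" "(\<lambda>n. 1 / (1 + x n * K)\<^sup>2) \<longlonglongrightarrow> 1 / (1 + 0 * K)\<^sup>2"
    by (intro tendsto_intros \<open>x \<longlonglongrightarrow> 0\<close>; simp)+
  have "\<forall>\<^sub>F n in sequentially. x n < 1 / 2"
    using \<open>x \<longlonglongrightarrow> 0\<close> by (rule order_tendstoD) simp
  then have b: "\<forall>\<^sub>F n in sequentially. 1 / (1 + x n * K)\<^sup>2 \<le> kappa \<and> kappa \<le> 1 + x n * K"
  proof eventually_elim
    case (elim n)
    interpret N: nome "Q ^ (2 ^ n)" by (rule nome_power)
    show ?case using N.kappa_bounds elim nome_power(2)[of n] by (simp add: x_def K_def)
  qed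
  have "kappa \<le> 1 + 0 * K"
    by (rule tendsto_lowerbound[OF e(1)]) (use b in \<open>auto elim: eventually_mono\<close>)
  moreover have "1 / (1 + 0 * K)\<^sup>2 \<le> kappa"
    by (rule tendsto_upperbound[OF e(2)]) (use b in \<open>auto elim: eventually_mono\<close>)
  ultimately show ?thesis by simp
qed

text \<open>The evaluation gives the fourth power of \<open>theta4 (Q^2)\<close> on one side and the
  sum times \<open>theta4 (Q^2)\<close> on the other; the hypothesis permits the
  cancellation.\<close>

theorem theta4_cube:
  assumes "theta4 (Q\<^sup>2) \<noteq> 0"
  shows "(\<Sum>\<^sub>\<infinity>N. alt_sign N * (1 - hyp N * htan N)) = theta4 (Q\<^sup>2) ^ 3"
proof -
  have "theta4 (Q\<^sup>2) * (2 * hyp_coeff 0) = (2 * infsum alt_hsec UNIV) * (2 * infsum hsec UNIV)"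
    using theta4_coeff_0 hsec_const_eq by (simp add: algebra_simps)
  also have "\<dots> = (theta3 Q * theta4 Q)\<^sup>2"
    unfolding kappa_hsec kappa_alt_hsec kappa_eq_1 by (simp add: power_mult_distrib)
  also have "\<dots> = theta4 (Q\<^sup>2) * theta4 (Q\<^sup>2) ^ 3"
    unfolding theta3_times_theta4 by (simp add: power2_eq_square power3_eq_cube)
  finally show ?thesis using assms unfolding hyp_coeff_0_eq by simp
qed

end

subsection \<open>Sums of three squares\<close>

text \<open>Collects a sum over lattice points into a series indexed by degree; used for triples of
  squares, for Selling triples and for theta quadruples.\<close>

lemma has_sum_fibres:
  fixes g :: "'a \<Rightarrow> 'b :: {topological_comm_monoid_add, t3_space}"
  assumes "(g has_sum T) S" "\<And>M. finite {s \<in> S. f s = M}"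
  shows "((\<lambda>M. \<Sum>s | s \<in> S \<and> f s = M. g s) has_sum T) UNIV"
proof (rule has_sum_SigmaD)
  show "((\<lambda>(M, s). g s) has_sum T) (SIGMA M:UNIV. {s \<in> S. f s = M})"
    by (rule iffD1[OF has_sum_reindex_bij_witness[of S "\<lambda>(M, s). s" "\<lambda>s. (f s, s)"] assms(1)]) auto
  show "((\<lambda>s. case (M, s) of (M, s) \<Rightarrow> g s) has_sum (\<Sum>s | s \<in> S \<and> f s = M. g s)) {s \<in> S. f s = M}" for M
    using has_sum_finite[OF assms(2), of g M] by simp
qed

text \<open>Once the earlier coefficients vanish, dividing by \<open>x ^ M\<close> leaves a power
  series that is zero to the right of 0 and tends to \<open>c M\<close>. The hypothesis is one-sided
  because the locale \<open>nome\<close> requires positive arguments.\<close>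

lemma powser_right_unique:
  fixes c :: "nat \<Rightarrow> real"
  assumes sm: "\<And>q. 0 < q \<Longrightarrow> q < 1 \<Longrightarrow> summable (\<lambda>M. c M * q ^ M)"
    and "\<delta> > 0" and z: "\<And>q. 0 < q \<Longrightarrow> q < 1 \<Longrightarrow> q < \<delta> \<Longrightarrow> (\<Sum>M. c M * q ^ M) = 0"
  shows "c M = 0"
proof (induction M rule: less_induct)
  case (less M)
  define f where "f x = (\<Sum>k. c (k + M) * x ^ k)" for x
  have s: "summable (\<lambda>k. c (k + M) * x ^ k)" if x1: "\<bar>x\<bar> < 1" for x
  proof -
    obtain r where r: "\<bar>x\<bar> < r" "r < 1" using dense[OF x1] by blast
    then have "r > 0" by linarith
    then have "summable (\<lambda>k. c (k + M) * r ^ (k + M))"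
      using summable_ignore_initial_segment[OF sm[of r]] r by simp
    then have "summable (\<lambda>k. c (k + M) * r ^ (k + M) * (1 / r ^ M))" by (rule summable_mult2)
    then have "summable (\<lambda>k. c (k + M) * r ^ k)" using \<open>r > 0\<close> by (simp add: power_add)
    then show ?thesis by (rule powser_inside) (use r in auto)
  qed
  have "(f \<longlongrightarrow> c (0 + M)) (at 0)"
    by (rule powser_limit_0[of 1]) (use s in \<open>auto simp: f_def summable_sums\<close>)
  then have 1: "(f \<longlongrightarrow> c M) (at_right 0)" by (simp add: filterlim_at_split)
  have "f x = 0" if "0 < x" "x < min 1 \<delta>" for x
  proof -
    have "0 = (\<Sum>k. c k * x ^ k)" using z[of x] that by simp
    also have "\<dots> = (\<Sum>k. c (k + M) * x ^ (k + M)) + (\<Sum>k<M. c k * x ^ k)"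
      by (rule suminf_split_initial_segment[OF sm]) (use that in auto)
    also have "(\<Sum>k<M. c k * x ^ k) = 0" using less by simp
    also have "(\<Sum>k. c (k + M) * x ^ (k + M)) = x ^ M * f x"
      using suminf_mult[OF s[of x], of "x ^ M"] that by (simp add: f_def power_add algebra_simps)
    finally show ?thesis using that by simp
  qed
  then have "\<forall>\<^sub>F x in at_right 0. f x = 0"
    using \<open>\<delta> > 0\<close> by (intro eventually_at_rightI[of 0 "min 1 \<delta>"]) auto
  then have "(f \<longlongrightarrow> 0) (at_right 0)" by (rule tendsto_eventually)
  with 1 show ?case using tendsto_unique trivial_limit_at_right_real by blast
qed

section \<open>Representations by three squares and Selling triples\<close>

definition three_squares :: "int \<Rightarrow> (int \<times> int \<times> int) set" where
  "three_squares D = {(a, b, c). a\<^sup>2 + b\<^sup>2 + c\<^sup>2 = D}"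

lemma finite_three_squares: "finite (three_squares D)"
proof (rule finite_subset)
  show "three_squares D \<subseteq> {- D..D} \<times> {- D..D} \<times> {- D..D}"
  proof
    fix t assume "t \<in> three_squares D"
    then obtain a b c where t: "t = (a, b, c)" "a\<^sup>2 + b\<^sup>2 + c\<^sup>2 = D" by (auto simp: three_squares_def)
    have "\<bar>a\<bar> \<le> D" "\<bar>b\<bar> \<le> D" "\<bar>c\<bar> \<le> D"
      using t(2) abs_le_square_int[of a] abs_le_square_int[of b] abs_le_square_int[of c] by linarith+
    then show "t \<in> {- D..D} \<times> {- D..D} \<times> {- D..D}" by (auto simp: t(1))
  qed
qed simp

text \<open>Selling parameters: \<open>(x, y, z)\<close> stands for the form \<open>x X\<^sup>2 + y Y\<^sup>2 + z (X - Y)\<^sup>2\<close>, which is twice an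
  integral form of discriminant \<open>- (x y + y z + z x)\<close> when \<open>x\<close>, \<open>y\<close>, \<open>z\<close> have equal parity. The weight
  compensates for the two obtuse superbases of a form with a vanishing parameter.\<close>

definition selling_triples :: "int \<Rightarrow> (int \<times> int \<times> int) set" where
  "selling_triples D = {(x, y, z). x \<ge> 0 \<and> y \<ge> 0 \<and> z \<ge> 0 \<and> x * y + y * z + z * x = D}"

definition selling_wt :: "int \<times> int \<times> int \<Rightarrow> real" where
  "selling_wt = (\<lambda>(x, y, z). if x = 0 \<or> y = 0 \<or> z = 0 then 1 / 2 else 1)"

definition selling_cone :: "(int \<times> int \<times> int) set" where
  "selling_cone = {(x, y, z). x \<ge> 0 \<and> y \<ge> 0 \<and> z \<ge> 0 \<and> x * y + y * z + z * x > 0}"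

text \<open>At least two coordinates are positive. For these
  \<open>(u - 1) * (v - 1) \<ge> 0\<close>, and the third coordinate is at most its product with one
  of them. The bound yields both finiteness and convergence.\<close>

lemma selling_sum_le:
  assumes "(x, y, z) \<in> selling_cone"
  shows "x + y + z \<le> x * y + y * z + z * x + 1"
proof -
  have nn: "x \<ge> 0" "y \<ge> 0" "z \<ge> 0" "x * y + y * z + z * x > 0" using assms by (auto simp: selling_cone_def)
  have two: "u + v \<le> u * v + 1" if "u \<ge> 1" "v \<ge> 1" for u v :: int
  proof -
    have "(u - 1) * (v - 1) \<ge> 0" using that by (intro mult_nonneg_nonneg) auto
    then show ?thesis by (simp add: algebra_simps)
  qed
  have prods: "x * y \<ge> 0" "y * z \<ge> 0" "z * x \<ge> 0" using nn by simp_all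
  have le: "v \<le> u * v" if "u \<ge> 1" "v \<ge> 0" for u v :: int
    using mult_right_mono[of 1 u v] that by simp
  consider "x \<ge> 1" "y \<ge> 1" | "y \<ge> 1" "z \<ge> 1" | "x \<ge> 1" "z \<ge> 1"
  proof -
    have "x \<ge> 1 \<and> y \<ge> 1 \<or> y \<ge> 1 \<and> z \<ge> 1 \<or> x \<ge> 1 \<and> z \<ge> 1"
    proof (rule ccontr)
      assume "\<not> ?thesis"
      then have "(x = 0 \<or> y = 0) \<and> (y = 0 \<or> z = 0) \<and> (x = 0 \<or> z = 0)" using nn by linarith
      then show False using nn(4) by auto
    qed
    then show thesis using that by blast
  qed
  then show ?thesis
  proof cases
    case 1
    have "z \<le> z * x" using le[of x z] 1 nn by (simp add: mult.commute)
    then show ?thesis using two[of x y] 1 prods by linarith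
  next
    case 2
    have "x \<le> x * y" using le[of y x] 2 nn by (simp add: mult.commute)
    then show ?thesis using two[of y z] 2 prods by linarith
  next
    case 3
    have "y \<le> x * y" using le[of x y] 3 nn by simp
    then show ?thesis using two[of z x] 3 prods by linarith
  qed
qed

lemma finite_selling_triples:
  assumes "D > 0" shows "finite (selling_triples D)"
proof (rule finite_subset)
  show "selling_triples D \<subseteq> {0..D + 1} \<times> {0..D + 1} \<times> {0..D + 1}"
  proof
    fix t assume t: "t \<in> selling_triples D"
    obtain x y z where xyz: "t = (x, y, z)" by (cases t)
    have "(x, y, z) \<in> selling_cone" using t assms by (auto simp: xyz selling_triples_def selling_cone_def)
    from selling_sum_le[OF this] t show "t \<in> {0..D + 1} \<times> {0..D + 1} \<times> {0..D + 1}"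
      by (auto simp: xyz selling_triples_def)
  qed
qed simp

text \<open>In \<open>theta3 + theta4\<close> the odd terms cancel and \<open>N = 0\<close>
  contributes \<open>2\<close>, so \<open>theta4 \<ge> 2 - theta3\<close>, while
  \<open>theta3\<close> is below \<open>2\<close> for small \<open>q\<close>.\<close>

lemma theta4_nonzero_near_0: "\<exists>\<delta>>0. \<forall>q. 0 < q \<longrightarrow> q < \<delta> \<longrightarrow> theta4 q \<noteq> 0"
proof -
  define K where "K = 4 * infsum (geom_bd (1 / 2)) UNIV"
  have "K \<ge> 0" unfolding K_def by (intro mult_nonneg_nonneg infsum_nonneg) (auto simp: geom_bd_def)
  show ?thesis
  proof (intro exI[of _ "min (1 / 2) (1 / (K + 1))"] conjI allI impI)
    fix q :: real assume q: "0 < q" "q < min (1 / 2) (1 / (K + 1))"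
    then interpret nome q by unfold_locales auto
    have theta3_seq: "theta3_seq N \<le> 2 * q ^ nat \<bar>N\<bar>" for N
    proof -
      have "theta3_seq N \<le> 1 * q ^ nat \<bar>N\<bar>"
        unfolding theta3_seq_def powi_nat_abs using abs_le_square_int[of N] Q_pos Q_less_1
        by (simp add: power_int_decreasing)
      also have "\<dots> \<le> 2 * q ^ nat \<bar>N\<bar>" by (rule mult_right_mono) auto
      finally show ?thesis .
    qed
    have 1: "infsum theta3_seq UNIV \<le> 1 + q * K"
      unfolding K_def using nonneg_sum_near_1(3)[of q theta3_seq] q theta3_seq by (simp add: theta3_seq_def)
    have S: "(\<lambda>N. theta3_seq N + theta4_seq N) summable_on UNIV" by (intro summable_on_add summable_theta3_seq summable_theta4_seq)
    have "sum (\<lambda>N. theta3_seq N + theta4_seq N) {0} \<le> (\<Sum>\<^sub>\<infinity>N. theta3_seq N + theta4_seq N)"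
      by (rule finite_sum_le_infsum[OF S]) (auto simp: theta3_seq_def theta4_seq_def alt_sign_def)
    also have "(\<Sum>\<^sub>\<infinity>N. theta3_seq N + theta4_seq N) = infsum theta3_seq UNIV + infsum theta4_seq UNIV"
      by (rule infsum_add[OF summable_theta3_seq summable_theta4_seq])
    finally have 2: "2 \<le> infsum theta3_seq UNIV + infsum theta4_seq UNIV"
      by (simp add: theta3_seq_def[of 0] theta4_seq_def[of 0] alt_sign_def)
    have "q * K \<le> q * (K + 1)" using q by simp
    also have "\<dots> < 1" using q \<open>K \<ge> 0\<close> by (simp add: field_simps)
    finally show "theta4 q \<noteq> 0" using 1 2 unfolding theta_seqs by linarith
  qed (use \<open>K \<ge> 0\<close> in auto)
qed

context nome
begin

lemma summable_theta4: "(\<lambda>k. alt_sign k * Q ^ nat (k\<^sup>2)) summable_on UNIV"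
  using summable_theta4_seq by (simp add: theta4_seq_def[abs_def] power_int_def)

lemma theta4_cube_has_sum:
  "((\<lambda>M. (-1) ^ M * real (card (three_squares (int M))) * Q ^ M) has_sum theta4 Q ^ 3) UNIV"
proof -
  define f where "f k = alt_sign k * Q ^ nat (k\<^sup>2)" for k :: int
  have f: "f summable_on UNIV" using summable_theta4 by (simp add: f_def[abs_def])
  have f2: "(\<lambda>z. case z of (b, c) \<Rightarrow> f b * f c) summable_on UNIV \<times> UNIV" by (rule summable_prod[OF f f])
  have "((\<lambda>(a, z). f a * (case z of (b, c) \<Rightarrow> f b * f c)) has_sum theta4 Q * (theta4 Q * theta4 Q))
      (UNIV \<times> (UNIV \<times> UNIV))"
    using has_sum_infsum[OF summable_prod[OF f f2]] infsum_prod[OF f f2] infsum_prod[OF f f]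
    by (simp add: theta4_def f_def[abs_def])
  moreover have "(\<lambda>(a, z). f a * (case z of (b, c) \<Rightarrow> f b * f c))
      = (\<lambda>(a, b, c). alt_sign (a + b + c) * Q ^ nat (a\<^sup>2 + b\<^sup>2 + c\<^sup>2))"
  proof (rule ext, clarify)
    fix a b c :: int
    have "nat (a\<^sup>2 + b\<^sup>2 + c\<^sup>2) = nat (a\<^sup>2) + nat (b\<^sup>2) + nat (c\<^sup>2)" by (simp add: nat_add_distrib)
    then show "f a * (f b * f c) = alt_sign (a + b + c) * Q ^ nat (a\<^sup>2 + b\<^sup>2 + c\<^sup>2)"
      by (simp only: f_def alt_sign_simps(1) power_add mult_ac)
  qed
  moreover have "theta4 Q * (theta4 Q * theta4 Q) = theta4 Q ^ 3" by (simp add: power3_eq_cube)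
  ultimately have "((\<lambda>(a, b, c). alt_sign (a + b + c) * Q ^ nat (a\<^sup>2 + b\<^sup>2 + c\<^sup>2)) has_sum theta4 Q ^ 3) UNIV"
    by simp
  moreover have "finite {s \<in> UNIV. (case s of (a, b, c) \<Rightarrow> nat (a\<^sup>2 + b\<^sup>2 + c\<^sup>2)) = M}" for M
    by (rule finite_subset[OF _ finite_three_squares[of "int M"]]) (auto simp: three_squares_def)
  ultimately have "((\<lambda>M. \<Sum>s | s \<in> UNIV \<and> (case s of (a, b, c) \<Rightarrow> nat (a\<^sup>2 + b\<^sup>2 + c\<^sup>2)) = M.
      case s of (a, b, c) \<Rightarrow> alt_sign (a + b + c) * Q ^ nat (a\<^sup>2 + b\<^sup>2 + c\<^sup>2)) has_sum theta4 Q ^ 3) UNIV"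
    by (rule has_sum_fibres)
  also have "(\<lambda>M. \<Sum>s | s \<in> UNIV \<and> (case s of (a, b, c) \<Rightarrow> nat (a\<^sup>2 + b\<^sup>2 + c\<^sup>2)) = M.
      case s of (a, b, c) \<Rightarrow> alt_sign (a + b + c) * Q ^ nat (a\<^sup>2 + b\<^sup>2 + c\<^sup>2))
      = (\<lambda>M. (-1) ^ M * real (card (three_squares (int M))) * Q ^ M)"
  proof
    fix M
    have "(\<Sum>s | s \<in> UNIV \<and> (case s of (a, b, c) \<Rightarrow> nat (a\<^sup>2 + b\<^sup>2 + c\<^sup>2)) = M.
        case s of (a, b, c) \<Rightarrow> alt_sign (a + b + c) * Q ^ nat (a\<^sup>2 + b\<^sup>2 + c\<^sup>2))
        = (\<Sum>t\<in>three_squares (int M). (-1) ^ M * Q ^ M)"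
    proof (rule sum.cong)
      show "{s. s \<in> UNIV \<and> (case s of (a, b, c) \<Rightarrow> nat (a\<^sup>2 + b\<^sup>2 + c\<^sup>2)) = M} = three_squares (int M)"
        by (auto simp: three_squares_def)
    next
      fix t assume "t \<in> three_squares (int M)"
      then obtain a b c where t: "t = (a, b, c)" "a\<^sup>2 + b\<^sup>2 + c\<^sup>2 = int M" by (auto simp: three_squares_def)
      have "even (a\<^sup>2 + b\<^sup>2 + c\<^sup>2) \<longleftrightarrow> even (a + b + c)" by simp
      then have "alt_sign (a + b + c) = (-1) ^ M" unfolding t(2) by (simp add: alt_sign_def)
      then show "(case t of (a, b, c) \<Rightarrow> alt_sign (a + b + c) * Q ^ nat (a\<^sup>2 + b\<^sup>2 + c\<^sup>2)) = (-1) ^ M * Q ^ M"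
        by (simp add: t)
    qed
    then show "(\<Sum>s | s \<in> UNIV \<and> (case s of (a, b, c) \<Rightarrow> nat (a\<^sup>2 + b\<^sup>2 + c\<^sup>2)) = M.
        case s of (a, b, c) \<Rightarrow> alt_sign (a + b + c) * Q ^ nat (a\<^sup>2 + b\<^sup>2 + c\<^sup>2))
        = (-1) ^ M * real (card (three_squares (int M))) * Q ^ M"
      by simp
  qed
  finally show ?thesis .
qed

end

lemma has_sum_prod_real:
  fixes f :: "'a \<Rightarrow> real" and g :: "'b \<Rightarrow> real"
  assumes "(f has_sum a) A" "(g has_sum b) B"
  shows "((\<lambda>(x, y). f x * g y) has_sum a * b) (A \<times> B)"
proof -
  have "f summable_on A" "g summable_on B" using assms has_sum_imp_summable by blast+
  from has_sum_infsum[OF summable_prod[OF this]] infsum_prod[OF this] infsumI[OF assms(1)] infsumI[OF assms(2)]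
  show ?thesis by simp
qed

definition selling_disc :: "int \<times> int \<times> int \<Rightarrow> int" where
  "selling_disc = (\<lambda>(x, y, z). x * y + y * z + z * x)"

definition selling_sum :: "int \<times> int \<times> int \<Rightarrow> int" where
  "selling_sum = (\<lambda>(x, y, z). x + y + z)"

section \<open>Summation of the signed series over the cone of Selling triples\<close>

context nome
begin

definition selling_term :: "int \<times> int \<times> int \<Rightarrow> real" where
  "selling_term v = selling_wt v * alt_sign (selling_sum v) * Q ^ nat (2 * selling_disc v)"

lemma summable_selling_term: "selling_term summable_on selling_cone"
proof -
  have g: "(\<lambda>N::int. Q ^ nat \<bar>N\<bar>) summable_on UNIV"
    by (rule summable_geom_bdI[of _ 1]) (use pow_le_geom_bd in auto)
  have "(\<lambda>(x, z). Q ^ nat \<bar>x\<bar> * (case z of (y, z) \<Rightarrow> Q ^ nat \<bar>y\<bar> * Q ^ nat \<bar>z\<bar>))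
      summable_on (UNIV :: int set) \<times> ((UNIV :: int set) \<times> (UNIV :: int set))"
    by (intro summable_prod g)
  then have "(\<lambda>(x, z). Q ^ nat \<bar>x\<bar> * (case z of (y, z) \<Rightarrow> Q ^ nat \<bar>y\<bar> * Q ^ nat \<bar>z\<bar>)) summable_on selling_cone"
    by (rule summable_on_subset_banach) auto
  then have S: "(\<lambda>v. 1 / Q * (case v of (x, z) \<Rightarrow> Q ^ nat \<bar>x\<bar> * (case z of (y, z) \<Rightarrow> Q ^ nat \<bar>y\<bar> * Q ^ nat \<bar>z\<bar>)))
      summable_on selling_cone"
    by (rule summable_on_cmult_right)
  show ?thesis
  proof (rule summable_on_real_comparison[OF S])
    fix v assume v: "v \<in> selling_cone"
    obtain x y z where xyz: "v = (x, y, z)" by (cases v)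
    have nn: "x \<ge> 0" "y \<ge> 0" "z \<ge> 0" and d: "selling_disc v > 0"
      using v by (auto simp: xyz selling_cone_def selling_disc_def)
    have le: "x + y + z \<le> selling_disc v + 1"
      using selling_sum_le[of x y z] v by (simp add: xyz selling_disc_def)
    \<comment> \<open>The \<open>1\<close> in \<open>selling_sum_le\<close> costs one factor
      \<open>Q\<close>, hence the constant \<open>1 / Q\<close> in the majorant.\<close>
    have "Q ^ Suc (nat (2 * selling_disc v)) \<le> Q ^ (nat \<bar>x\<bar> + (nat \<bar>y\<bar> + nat \<bar>z\<bar>))"
      by (rule power_decreasing) (use le d nn Q_pos Q_less_1 in auto)
    then have "Q ^ nat (2 * selling_disc v) \<le> 1 / Q * (Q ^ nat \<bar>x\<bar> * (Q ^ nat \<bar>y\<bar> * Q ^ nat \<bar>z\<bar>))"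
      using Q_pos by (simp add: field_simps power_add)
    moreover have "\<bar>selling_term v\<bar> \<le> 1 * Q ^ nat (2 * selling_disc v)"
      unfolding selling_term_def by (simp add: abs_mult alt_sign_simps) (simp add: selling_wt_def xyz)
    ultimately show "\<bar>selling_term v\<bar> \<le> 1 / Q * (case v of (x, z) \<Rightarrow> Q ^ nat \<bar>x\<bar> * (case z of (y, z) \<Rightarrow> Q ^ nat \<bar>y\<bar> * Q ^ nat \<bar>z\<bar>))"
      by (simp add: xyz)
  qed
qed

text \<open>For \<open>x + y = n\<close> the discriminant is \<open>x * (n - x) + n * z\<close>: the
  layers \<open>z \<ge> 1\<close> give a geometric series with ratio \<open>- (Q ^ (2 * n))\<close>
  times \<open>hyp_nat n\<close>. The layer \<open>z = 0\<close> has weight \<open>1 / 2\<close>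
  throughout and lacks the ends \<open>x = 0\<close> and \<open>x = n\<close>, where the
  discriminant vanishes; it contributes half of \<open>hyp_nat n - 1\<close>.\<close>

lemma selling_term_slice:
  assumes "n \<ge> 1"
  shows "((\<lambda>(x, z). selling_term (int x, int n - int x, int z)) has_sum (1 / 2 * (-1) ^ n * (hyp_nat n * htan (int n) - 1)))
      {(x, z). x \<le> n \<and> (z = 0 \<longrightarrow> 0 < x \<and> x < n)}"
proof -
  define w where "w x = (if x = 0 \<or> x = n then 1 / 2 else 1 :: real)" for x
  have deg: "nat (2 * selling_disc (int x, int n - int x, int z)) = 2 * x * (n - x) + 2 * n * z" if "x \<le> n" for x z
  proof -
    obtain m where m: "n = x + m" using \<open>x \<le> n\<close> le_Suc_ex by blast
    have "2 * selling_disc (int x, int n - int x, int z) = int (2 * x * (n - x) + 2 * n * z)"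
      unfolding m by (simp add: selling_disc_def algebra_simps)
    then show ?thesis by linarith
  qed
  have sgn: "alt_sign (selling_sum (int x, int n - int x, int z)) = (-1) ^ n * (-1) ^ z" for x z
    by (cases "even n"; cases "even z"; simp add: selling_sum_def alt_sign_def)
  have q: "0 < Q ^ (2 * n)" "Q ^ (2 * n) < 1"
    using Q_pos Q_less_1 assms by (simp, intro power_less_one_iff[THEN iffD2]) auto
  have geo: "((\<lambda>z. (- (Q ^ (2 * n))) ^ z) has_sum (- (Q ^ (2 * n)) / (1 - - (Q ^ (2 * n))))) {1..}"
    by (rule has_sum_geometric_from_1) (use q in auto)
  have fin: "((\<lambda>x. (-1) ^ n * (w x * Q ^ (2 * x * (n - x)))) has_sum ((-1) ^ n * hyp_nat n)) {0..n}"
  proof (rule has_sum_finiteI)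
    have "{0..n} = insert 0 (insert n {1..<n})" using assms by auto
    then have "(\<Sum>x = 0..n. w x * Q ^ (2 * x * (n - x))) = hyp_nat n"
      using assms by (simp add: w_def hyp_nat_def)
    then show "(-1) ^ n * hyp_nat n = (\<Sum>x = 0..n. (-1) ^ n * (w x * Q ^ (2 * x * (n - x))))"
      by (simp add: sum_distrib_left[symmetric])
  qed simp
  have 1: "((\<lambda>(x, z). selling_term (int x, int n - int x, int z)) has_sum
      ((-1) ^ n * hyp_nat n * (- (Q ^ (2 * n)) / (1 - - (Q ^ (2 * n)))))) ({0..n} \<times> {1..})"
  proof (rule iffD1[OF has_sum_cong has_sum_prod_real[OF fin geo]])
    fix v assume "v \<in> {0..n} \<times> {1::nat..}"
    then obtain x z where v: "v = (x, z)" "x \<le> n" "z \<ge> 1" by auto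
    have "selling_wt (int x, int n - int x, int z) = w x"
      using v(3) by (auto simp: selling_wt_def w_def)
    then have "selling_term (int x, int n - int x, int z) = (-1) ^ n * (w x * Q ^ (2 * x * (n - x))) * (- (Q ^ (2 * n))) ^ z"
      unfolding selling_term_def sgn deg[OF v(2)] power_minus[of "Q ^ (2 * n)"] power_add power_mult[symmetric] by simp
    then show "(case v of (x, z) \<Rightarrow> (-1) ^ n * (w x * Q ^ (2 * x * (n - x))) * (- (Q ^ (2 * n))) ^ z)
        = (case v of (x, z) \<Rightarrow> selling_term (int x, int n - int x, int z))"
      by (simp add: v(1))
  qed
  have 2: "((\<lambda>(x, z). selling_term (int x, int n - int x, int z)) has_sum (1 / 2 * (-1) ^ n * (hyp_nat n - 1))) ({1..<n} \<times> {0})"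
  proof (rule has_sum_finiteI)
    have "(\<Sum>(x, z)\<in>{1..<n} \<times> {0}. selling_term (int x, int n - int x, int z)) = (\<Sum>x\<in>{1..<n}. selling_term (int x, int n - int x, 0))"
      by (simp add: sum.cartesian_product[symmetric])
    also have "\<dots> = (\<Sum>x\<in>{1..<n}. 1 / 2 * (-1) ^ n * Q ^ (2 * x * (n - x)))"
    proof (rule sum.cong)
      fix x assume "x \<in> {1..<n}"
      then show "selling_term (int x, int n - int x, 0) = 1 / 2 * (-1) ^ n * Q ^ (2 * x * (n - x))"
        using deg[of x 0] sgn[of x 0] by (simp add: selling_term_def selling_wt_def)
    qed simp
    also have "\<dots> = 1 / 2 * (-1) ^ n * (hyp_nat n - 1)"
      using assms by (simp add: hyp_nat_def sum_distrib_left)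
    finally show "1 / 2 * (-1) ^ n * (hyp_nat n - 1) = (\<Sum>(x, z)\<in>{1..<n} \<times> {0}. selling_term (int x, int n - int x, int z))"
      by simp
  qed simp
  have S: "({0..n} \<times> {1..}) \<union> ({1..<n} \<times> {0}) = {(x :: nat, z :: nat). x \<le> n \<and> (z = 0 \<longrightarrow> 0 < x \<and> x < n)}" by auto
  have H: "((\<lambda>(x, z). selling_term (int x, int n - int x, int z)) has_sum
      ((-1) ^ n * hyp_nat n * (- (Q ^ (2 * n)) / (1 - - (Q ^ (2 * n)))) + 1 / 2 * (-1) ^ n * (hyp_nat n - 1)))
      (({0..n} \<times> {1..}) \<union> ({1..<n} \<times> {0}))"
    by (rule has_sum_Un_disjoint[OF 1 2]) auto
  have V: "(-1) ^ n * hyp_nat n * (- (Q ^ (2 * n)) / (1 - - (Q ^ (2 * n)))) + 1 / 2 * (-1) ^ n * (hyp_nat n - 1)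
      = 1 / 2 * (-1) ^ n * (hyp_nat n * htan (int n) - 1)"
  proof -
    define u where "u = Q ^ n"
    have u: "u > 0" using Q_pos by (simp add: u_def)
    have "hsec (int n) = 1 / (u + 1 / u)" by (simp add: hsec_def power_int_minus u_def divide_inverse)
    then have "Q powi int n * hsec (int n) = u\<^sup>2 / (1 + u\<^sup>2)"
      using u by (simp add: u_def[symmetric] field_simps power2_eq_square)
    moreover have "Q ^ (2 * n) = u\<^sup>2" by (simp add: u_def power_even_eq)
    ultimately have "Q powi int n * hsec (int n) = Q ^ (2 * n) / (1 + Q ^ (2 * n))" by simp
    then have tn: "htan (int n) = 1 - 2 * (Q ^ (2 * n) / (1 + Q ^ (2 * n)))" by (simp add: htan_alt)
    have key: "E * P * (- X) + 1 / 2 * E * (P - 1) = 1 / 2 * E * (P * (1 - 2 * X) - 1)" for E P X :: real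
      by (simp add: field_simps)
    have e: "- (Q ^ (2 * n)) / (1 - - (Q ^ (2 * n))) = - (Q ^ (2 * n) / (1 + Q ^ (2 * n)))" by simp
    show ?thesis unfolding tn e by (rule key)
  qed
  show ?thesis using H unfolding S V .
qed

text \<open>For positive \<open>N\<close> the term on the left is \<open>- 2\<close> times a slice,
  and it is even in \<open>N\<close>. The two half-lines give \<open>- 2 * A\<close> each, and
  \<open>N = 0\<close> supplies the \<open>1\<close>.\<close>

lemma infsum_selling_term: "(\<Sum>\<^sub>\<infinity>N. alt_sign N * (1 - hyp N * htan N)) = 1 - 4 * infsum selling_term selling_cone"
proof -
  define A where "A = infsum selling_term selling_cone"
  define f where "f N = alt_sign N * (1 - hyp N * htan N)" for N
  have "(selling_term has_sum A) selling_cone"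
    unfolding A_def using summable_selling_term by simp
  then have "((\<lambda>(n, x, z). selling_term (int x, int n - int x, int z)) has_sum A)
      (SIGMA n:{1..}. {(x, z). x \<le> n \<and> (z = 0 \<longrightarrow> 0 < x \<and> x < n)})"
  proof (rule iffD2[OF has_sum_reindex_bij_witness[where j = "\<lambda>(n, x, z). (int x, int n - int x, int z)"
          and i = "\<lambda>(x, y, z). (nat (x + y), nat x, nat z)"], rotated -1], goal_cases)
    case (1 a) then show ?case by auto
  next
    case (2 a) then show ?case
    proof -
      obtain n x z where a: "a = (n, x, z)" by (cases a)
      from 2 have x: "x \<le> n" "n \<ge> 1" "z = 0 \<longrightarrow> 0 < x \<and> x < n" by (auto simp: a)
      obtain m where m: "n = x + m" using x(1) le_Suc_ex by blast
      have "0 < x * m + m * z + z * x" using x(2,3) by (cases "z = 0") (auto simp: m)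
      then have "0 < int x * int m + int m * int z + int z * int x"
        by (metis of_nat_0_less_iff of_nat_add of_nat_mult)
      then show ?thesis by (simp add: a selling_cone_def m)
    qed
  next
    case (3 b) then show ?case by (auto simp: selling_cone_def)
  next
    case (4 b)
    obtain x y z where b: "b = (x, y, z)" by (cases b)
    have nn: "x \<ge> 0" "y \<ge> 0" "z \<ge> 0" "x * y + y * z + z * x > 0" using 4 by (auto simp: b selling_cone_def)
    have "x + y > 0" using nn by (cases "x = 0"; cases "y = 0"; auto)
    moreover have "z = 0 \<Longrightarrow> x > 0 \<and> y > 0" using nn by (cases "x = 0"; cases "y = 0"; auto)
    ultimately show ?case using nn by (auto simp: b nat_le_iff)
  qed auto
  then have "((\<lambda>n. 1 / 2 * (-1) ^ n * (hyp_nat n * htan (int n) - 1)) has_sum A) {1..}"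
    by (rule has_sum_SigmaD) (use selling_term_slice in auto)
  then have "((\<lambda>n. (- 2) * (1 / 2 * (-1) ^ n * (hyp_nat n * htan (int n) - 1))) has_sum ((- 2) * A)) {1..}"
    by (rule has_sum_cmult_right)
  moreover have "(- 2) * (1 / 2 * (-1) ^ n * (hyp_nat n * htan (int n) - 1)) = f (int n)" if "n \<in> {1..}" for n
    using that by (simp add: f_def hyp_def alt_sign_def algebra_simps)
  ultimately have h: "((\<lambda>n. f (int n)) has_sum (- 2 * A)) {1..}"
    using has_sum_cong[of "{1..}"] by (metis (no_types, lifting))
  have pos: "(f has_sum (- 2 * A)) {1..}"
    by (rule iffD1[OF has_sum_reindex_bij_witness[of "{1..}" nat int] h]) auto
  have "f (- N) = f N" for N by (simp add: f_def alt_sign_simps)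
  then have neg: "(f has_sum (- 2 * A)) {..-1}"
    by (intro iffD1[OF has_sum_reindex_bij_witness[of "{1..}" uminus uminus] pos]) auto
  have "(f has_sum f 0) {0}" by (rule has_sum_finiteI) auto
  moreover have "{1..} \<inter> {..-1} = ({} :: int set)" "({1..} \<union> {..-1}) \<inter> {0} = ({} :: int set)" by auto
  ultimately have "(f has_sum (- 2 * A + - 2 * A + f 0)) ({1..} \<union> {..-1} \<union> {0})"
    using has_sum_Un_disjoint[OF has_sum_Un_disjoint[OF pos neg]] by blast
  moreover have "{1..} \<union> {..-1} \<union> {0::int} = UNIV" by auto
  moreover have "f 0 = 1" by (simp add: f_def hyp_def alt_sign_def)
  ultimately show ?thesis unfolding A_def f_def by (simp add: infsumI)
qed

text \<open>The intersection with \<open>selling_cone\<close> makes a difference at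
  \<open>M = 0\<close>, where \<open>selling_triples\<close> is infinite and the coefficient has to
  be \<open>0\<close>.\<close>

lemma selling_term_series:
  "((\<lambda>M. (\<Sum>v\<in>selling_triples (int M) \<inter> selling_cone. selling_wt v * alt_sign (selling_sum v)) * (Q\<^sup>2) ^ M)
     has_sum infsum selling_term selling_cone) UNIV"
proof -
  have set: "{v \<in> selling_cone. nat (selling_disc v) = M} = selling_triples (int M) \<inter> selling_cone" for M
    by (auto simp: selling_triples_def selling_cone_def selling_disc_def)
  have fin: "finite {v \<in> selling_cone. nat (selling_disc v) = M}" for M
  proof (cases "M = 0")
    case True
    then have E: "{v \<in> selling_cone. nat (selling_disc v) = M} = {}"
      by (auto simp: selling_cone_def selling_disc_def)
    show ?thesis by (simp only: E finite.emptyI)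
  next
    case False
    then show ?thesis unfolding set by (simp add: finite_selling_triples)
  qed
  have "((\<lambda>M. \<Sum>v | v \<in> selling_cone \<and> nat (selling_disc v) = M. selling_term v) has_sum infsum selling_term selling_cone) UNIV"
    by (rule has_sum_fibres[OF has_sum_infsum[OF summable_selling_term] fin])
  moreover have "(\<Sum>v | v \<in> selling_cone \<and> nat (selling_disc v) = M. selling_term v)
      = (\<Sum>v\<in>selling_triples (int M) \<inter> selling_cone. selling_wt v * alt_sign (selling_sum v)) * (Q\<^sup>2) ^ M" for M
    unfolding sum_distrib_right
  proof (rule sum.cong)
    fix v assume "v \<in> selling_triples (int M) \<inter> selling_cone"
    then have "selling_disc v = int M" by (auto simp: selling_triples_def selling_disc_def)
    then have "nat (2 * selling_disc v) = 2 * M" by simp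
    then show "selling_term v = selling_wt v * alt_sign (selling_sum v) * (Q\<^sup>2) ^ M"
      by (simp add: selling_term_def power_mult)
  qed (rule set)
  ultimately show ?thesis by simp
qed

end

lemma three_squares_0: "three_squares 0 = {(0, 0, 0)}"
  by (auto simp: three_squares_def add_nonneg_eq_0_iff)

lemma card_three_squares_signed:
  assumes "M > 0"
  shows "(-1) ^ M * real (card (three_squares (int M)))
    = - 4 * (\<Sum>v\<in>selling_triples (int M). selling_wt v * alt_sign (selling_sum v))"
proof -
  define a where "a M = (\<Sum>v\<in>selling_triples (int M) \<inter> selling_cone. selling_wt v * alt_sign (selling_sum v))" for M
  define d where "d M = (if M = 0 then 1 else 0 :: real)" for M :: nat
  \<comment> \<open>The coefficients of \<open>theta4^3 - 1 + 4 * A\<close>, where \<open>A\<close>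
    is the Selling series; \<open>d\<close> is the constant series \<open>1\<close>.\<close>
  define c where "c M = (-1) ^ M * real (card (three_squares (int M))) + - (d M) + 4 * a M" for M
  obtain \<delta> where \<delta>: "\<delta> > 0" "\<And>q. 0 < q \<Longrightarrow> q < \<delta> \<Longrightarrow> theta4 q \<noteq> 0"
    using theta4_nonzero_near_0 by blast
  have H: "((\<lambda>M. c M * q ^ M) has_sum (theta4 q ^ 3 + - 1 + 4 * infsum (nome.selling_term (sqrt q)) selling_cone)) UNIV"
    if q: "0 < q" "q < 1" for q
  proof -
    interpret q: nome q using q by unfold_locales
    interpret Q: nome "sqrt q" using q by unfold_locales auto
    have "((\<lambda>M. d M * q ^ M) has_sum 1) UNIV"
    proof -
      have "((\<lambda>M. d M * q ^ M) has_sum 1) {0}" by (rule has_sum_finiteI) (auto simp: d_def)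
      then show ?thesis by (rule iffD1[OF has_sum_cong_neutral, rotated -1]) (auto simp: d_def)
    qed
    then have 1: "((\<lambda>M. - (d M * q ^ M)) has_sum - 1) UNIV" by (simp add: has_sum_uminus)
    have "((\<lambda>M. a M * q ^ M) has_sum infsum Q.selling_term selling_cone) UNIV"
      using Q.selling_term_series q by (simp add: a_def)
    then have 2: "((\<lambda>M. 4 * (a M * q ^ M)) has_sum 4 * infsum Q.selling_term selling_cone) UNIV"
      by (rule has_sum_cmult_right)
    from has_sum_add[OF has_sum_add[OF q.theta4_cube_has_sum 1] 2] show ?thesis
      by (simp add: c_def algebra_simps)
  qed
  have "c M = 0"
  proof (rule powser_right_unique[OF _ \<open>\<delta> > 0\<close>])
    fix q :: real assume q: "0 < q" "q < 1"
    show "summable (\<lambda>M. c M * q ^ M)"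
      using has_sum_imp_sums[OF H[OF q]] by (rule sums_summable)
    assume "q < \<delta>"
    interpret Q: nome "sqrt q" using q by unfold_locales auto
    have "theta4 q ^ 3 = 1 - 4 * infsum Q.selling_term selling_cone"
      using Q.theta4_cube Q.infsum_selling_term \<delta>(2)[of q] q \<open>q < \<delta>\<close> by simp
    then show "(\<Sum>M. c M * q ^ M) = 0"
      using sums_unique[OF has_sum_imp_sums[OF H[OF q]]] by simp
  qed
  moreover have "selling_triples (int M) \<inter> selling_cone = selling_triples (int M)"
    using assms by (auto simp: selling_triples_def selling_cone_def)
  ultimately show ?thesis using assms by (simp add: c_def d_def a_def)
qed

definition same_parity :: "int \<times> int \<times> int \<Rightarrow> bool" where
  "same_parity = (\<lambda>(x, y, z). (even x \<longleftrightarrow> even y) \<and> (even y \<longleftrightarrow> even z))"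

text \<open>The integer \<open>x * y + y * z + z * x + x + y + z\<close> is even exactly when the
  three parities agree. Multiplying by \<open>(-1) ^ D\<close> therefore turns the signed sum into
  twice the equal-parity sum minus the full sum.\<close>

theorem card_three_squares:
  assumes "D > 0"
  shows "real (card (three_squares D)) = 4 * (\<Sum>v\<in>selling_triples D. selling_wt v)
    - 8 * (\<Sum>v | v \<in> selling_triples D \<and> same_parity v. selling_wt v)"
proof -
  define M where "M = nat D"
  have M: "D = int M" "M > 0" using assms by (auto simp: M_def)
  have "real (card (three_squares D)) = (-1) ^ M * ((-1) ^ M * real (card (three_squares D)))"
    by (simp add: power_add[symmetric] mult.assoc[symmetric])
  also have "\<dots> = (-1) ^ M * (- 4 * (\<Sum>v\<in>selling_triples D. selling_wt v * alt_sign (selling_sum v)))"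
    using card_three_squares_signed[OF M(2)] by (simp add: M(1))
  also have "\<dots> = - 4 * (\<Sum>v\<in>selling_triples D. selling_wt v * ((-1) ^ M * alt_sign (selling_sum v)))"
    by (simp add: sum_distrib_left mult_ac)
  also have "(\<Sum>v\<in>selling_triples D. selling_wt v * ((-1) ^ M * alt_sign (selling_sum v)))
      = (\<Sum>v\<in>selling_triples D. 2 * (if same_parity v then selling_wt v else 0) - selling_wt v)"
  proof (rule sum.cong)
    fix v assume v: "v \<in> selling_triples D"
    obtain x y z where xyz: "v = (x, y, z)" by (cases v)
    have "x * y + y * z + z * x = int M" using v by (simp add: xyz selling_triples_def M)
    then have "(-1) ^ M = alt_sign (x * y + y * z + z * x)" by (simp add: alt_sign_def)
    then have "(-1) ^ M * alt_sign (selling_sum v) = (if same_parity v then 1 else - 1)"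
      by (auto simp: xyz selling_sum_def same_parity_def alt_sign_def)
    then show "selling_wt v * ((-1) ^ M * alt_sign (selling_sum v)) = 2 * (if same_parity v then selling_wt v else 0) - selling_wt v"
      by simp
  qed simp
  also have "\<dots> = 2 * (\<Sum>v | v \<in> selling_triples D \<and> same_parity v. selling_wt v) - (\<Sum>v\<in>selling_triples D. selling_wt v)"
    using finite_selling_triples[OF assms]
    by (simp add: sum_subtractf sum_distrib_left[symmetric] sum.inter_filter[symmetric])
  finally show ?thesis by simp
qed

subsection \<open>Reduction of binary quadratic forms\<close>

lemma bqf_disc_neg_eval:
  "4 * a * bqf_eval (a, b, c) x y = (2 * a * x + b * y)\<^sup>2 - bqf_disc (a, b, c) * y\<^sup>2"
  unfolding bqf_eval.simps bqf_disc.simps by algebra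

lemma bqf_pos_defD: "bqf_pos_def f \<Longrightarrow> (x, y) \<noteq> (0, 0) \<Longrightarrow> bqf_eval f x y > 0"
  unfolding bqf_pos_def_def by metis

lemma pos_def_iff:
  assumes "D > 0" "bqf_disc (a, b, c) = - D"
  shows "bqf_pos_def (a, b, c) \<longleftrightarrow> a > 0"
proof
  assume "bqf_pos_def (a, b, c)"
  from bqf_pos_defD[OF this, of 1 0] show "a > 0" by simp
next
  assume a: "a > 0"
  show "bqf_pos_def (a, b, c)"
    unfolding bqf_pos_def_def
  proof (intro allI impI)
    fix x y :: int assume xy: "(x, y) \<noteq> (0, 0)"
    have eq: "4 * a * bqf_eval (a, b, c) x y = (2 * a * x + b * y)\<^sup>2 + D * y\<^sup>2"
      using bqf_disc_neg_eval[of a b c x y] assms(2) by simp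
    have "(2 * a * x + b * y)\<^sup>2 + D * y\<^sup>2 > 0"
    proof (cases "y = 0")
      case True
      then show ?thesis using xy a by simp
    next
      case False
      then show ?thesis using assms(1) by (intro add_nonneg_pos) auto
    qed
    then have "4 * a * bqf_eval (a, b, c) x y > 0" unfolding eq .
    then show "bqf_eval (a, b, c) x y > 0" using a by (simp add: zero_less_mult_iff)
  qed
qed

lemma pos_def_bqfs_iff:
  assumes "D > 0"
  shows "(a, b, c) \<in> pos_def_bqfs D \<longleftrightarrow> a > 0 \<and> 4 * a * c - b\<^sup>2 = D"
proof -
  have "bqf_disc (a, b, c) = - D \<longleftrightarrow> 4 * a * c - b\<^sup>2 = D" by auto
  then show ?thesis using pos_def_iff[OF assms, of a b c] unfolding pos_def_bqfs_def by blast
qed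

fun bqf_act :: "bqf \<Rightarrow> int \<Rightarrow> int \<Rightarrow> int \<Rightarrow> int \<Rightarrow> bqf" where
  "bqf_act (a, b, c) p q r s =
     (a * p\<^sup>2 + b * p * r + c * r\<^sup>2, 2 * a * p * q + b * (p * s + q * r) + 2 * c * r * s,
      a * q\<^sup>2 + b * q * s + c * s\<^sup>2)"

lemma bqf_eval_act:
  "bqf_eval (bqf_act f p q r s) x y = bqf_eval f (p * x + q * y) (r * x + s * y)"
proof -
  obtain a b c where f: "f = (a, b, c)" by (metis prod_cases3)
  show ?thesis unfolding f bqf_act.simps bqf_eval.simps by algebra
qed

lemma bqf_eqI:
  assumes "\<And>x y. bqf_eval f x y = bqf_eval g x y"
  shows "f = g"
proof -
  obtain a b c a' b' c' where fg: "f = (a, b, c)" "g = (a', b', c')" by (metis prod_cases3)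
  show ?thesis
    using assms[of 1 0] assms[of 0 1] assms[of 1 1] by (simp add: fg)
qed

lemma bqf_rel_iff: "(f, g) \<in> bqf_SL2Z_rel \<longleftrightarrow> (\<exists>p q r s. p * s - q * r = 1 \<and> g = bqf_act f p q r s)"
proof -
  have "(\<forall>x y. bqf_eval g x y = bqf_eval f (p * x + q * y) (r * x + s * y)) \<longleftrightarrow> g = bqf_act f p q r s" for p q r s
    using bqf_eqI[of g "bqf_act f p q r s"] by (auto simp: bqf_eval_act)
  then show ?thesis unfolding bqf_SL2Z_rel_def by simp
qed

lemma bqf_act_act:
  "bqf_act (bqf_act f p q r s) p' q' r' s'
    = bqf_act f (p * p' + q * r') (p * q' + q * s') (r * p' + s * r') (r * q' + s * s')"
  by (rule bqf_eqI, unfold bqf_eval_act, rule arg_cong2[of _ _ _ _ "bqf_eval f"]; algebra)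

lemma bqf_act_id: "bqf_act f 1 0 0 1 = f"
  by (rule bqf_eqI) (simp add: bqf_eval_act)

lemma equiv_bqf_rel: "equiv UNIV bqf_SL2Z_rel"
proof (rule equivI)
  show "refl bqf_SL2Z_rel"
    unfolding refl_on_def bqf_rel_iff using bqf_act_id
    by (metis UNIV_I add_0 diff_0_right mult.right_neutral mult_zero_left)
  show "sym bqf_SL2Z_rel"
  proof (rule symI)
    fix f g assume "(f, g) \<in> bqf_SL2Z_rel"
    then obtain p q r s where d: "p * s - q * r = 1" and g: "g = bqf_act f p q r s"
      unfolding bqf_rel_iff by blast
    have "bqf_act g s (- q) (- r) p = bqf_act f 1 0 0 1"
      unfolding g bqf_act_act using d by (simp add: algebra_simps)
    then have "f = bqf_act g s (- q) (- r) p" by (simp add: bqf_act_id)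
    moreover have "s * p - (- q) * (- r) = 1" using d by (simp add: algebra_simps)
    ultimately show "(g, f) \<in> bqf_SL2Z_rel" unfolding bqf_rel_iff by blast
  qed
  show "trans bqf_SL2Z_rel"
  proof (rule transI)
    fix f g h assume "(f, g) \<in> bqf_SL2Z_rel" "(g, h) \<in> bqf_SL2Z_rel"
    then obtain p q r s p' q' r' s' where d: "p * s - q * r = 1" "p' * s' - q' * r' = 1"
      and g: "g = bqf_act f p q r s" "h = bqf_act g p' q' r' s'"
      unfolding bqf_rel_iff by blast
    have "(p * p' + q * r') * (r * q' + s * s') - (p * q' + q * s') * (r * p' + s * r')
        = (p * s - q * r) * (p' * s' - q' * r')" by algebra
    then have "(p * p' + q * r') * (r * q' + s * s') - (p * q' + q * s') * (r * p' + s * r') = 1"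
      unfolding d by simp
    moreover have "h = bqf_act f (p * p' + q * r') (p * q' + q * s') (r * p' + s * r') (r * q' + s * s')"
      unfolding g by (rule bqf_act_act)
    ultimately show "(f, h) \<in> bqf_SL2Z_rel" unfolding bqf_rel_iff by blast
  qed
qed (auto)

lemma bqf_disc_act:
  assumes "p * s - q * r = 1"
  shows "bqf_disc (bqf_act f p q r s) = bqf_disc f"
proof -
  obtain a b c where f: "f = (a, b, c)" by (metis prod_cases3)
  have "bqf_disc (bqf_act f p q r s) = (p * s - q * r)\<^sup>2 * bqf_disc f"
    unfolding f bqf_act.simps bqf_disc.simps by algebra
  then show ?thesis using assms by simp
qed

lemma bqf_pos_def_act:
  assumes "p * s - q * r = 1" "bqf_pos_def f"
  shows "bqf_pos_def (bqf_act f p q r s)"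
  unfolding bqf_pos_def_def
proof (intro allI impI)
  fix x y :: int assume xy: "(x, y) \<noteq> (0, 0)"
  have "(p * x + q * y, r * x + s * y) \<noteq> (0, 0)"
  proof
    assume "(p * x + q * y, r * x + s * y) = (0, 0)"
    moreover have "s * (p * x + q * y) - q * (r * x + s * y) = (p * s - q * r) * x"
      "p * (r * x + s * y) - r * (p * x + q * y) = (p * s - q * r) * y" by (simp_all add: algebra_simps)
    ultimately show False using assms(1) xy by simp
  qed
  then show "bqf_eval (bqf_act f p q r s) x y > 0"
    unfolding bqf_eval_act by (rule bqf_pos_defD[OF assms(2)])
qed

lemma bqf_rel_pos_def:
  assumes "(f, g) \<in> bqf_SL2Z_rel" "f \<in> pos_def_bqfs D"
  shows "g \<in> pos_def_bqfs D"
proof -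
  obtain p q r s where d: "p * s - q * r = 1" and g: "g = bqf_act f p q r s"
    using assms(1) unfolding bqf_rel_iff by blast
  show ?thesis
    using assms(2) bqf_disc_act[OF d, of f] bqf_pos_def_act[OF d, of f]
    unfolding pos_def_bqfs_def g by simp
qed

text \<open>The last conjunct chooses the representative with \<open>b \<ge> 0\<close> on the
  boundary, where \<open>|b| = a\<close> or \<open>a = c\<close>.\<close>

definition bqf_reduced :: "bqf \<Rightarrow> bool" where
  "bqf_reduced = (\<lambda>(a, b, c). \<bar>b\<bar> \<le> a \<and> a \<le> c \<and> (b < 0 \<longrightarrow> - b < a \<and> a < c))"

definition reduced_bqfs :: "int \<Rightarrow> bqf set" where
  "reduced_bqfs D = {f \<in> pos_def_bqfs D. bqf_reduced f}"

text \<open>A form with least leading coefficient in its class is translated until the middle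
  coefficient lies in \<open>(- a, a]\<close>. The inverted form \<open>(c, - b, a)\<close> is
  equivalent to it, so minimality gives \<open>a \<le> c\<close>; inversion also repairs the sign of
  \<open>b\<close> when \<open>a = c\<close>.\<close>

lemma exists_reduced:
  assumes D: "D > 0" and f: "f \<in> pos_def_bqfs D"
  shows "\<exists>g \<in> reduced_bqfs D. (f, g) \<in> bqf_SL2Z_rel"
proof -
  define P where "P g \<longleftrightarrow> (f, g) \<in> bqf_SL2Z_rel" for g
  have tr: "P h" if "P g" "(g, h) \<in> bqf_SL2Z_rel" for g h
    using that equiv_bqf_rel unfolding P_def equiv_def by (meson transE)
  have "P f" using equiv_bqf_rel unfolding P_def equiv_def refl_on_def by blast
  then obtain g0 where g0: "P g0" "\<And>h. P h \<Longrightarrow> nat (fst g0) \<le> nat (fst h)"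
    using ex_has_least_nat[of P f "\<lambda>g. nat (fst g)"] by blast
  obtain a b0 c0 where g0e: "g0 = (a, b0, c0)" by (metis prod_cases3)
  have pd: "h \<in> pos_def_bqfs D" if "P h" for h using that bqf_rel_pos_def f unfolding P_def by blast
  have a: "a > 0" using pd[OF g0(1)] pos_def_bqfs_iff[OF D] unfolding g0e by blast
  \<comment> \<open>Adding \<open>2 * a * k\<close> must move \<open>b0\<close> into
    \<open>(- a, a]\<close>; the offset \<open>a - 1\<close> carries this interval to the residues
    \<open>0\<close> to \<open>2 * a - 1\<close>.\<close>
  define k where "k = - ((b0 + a - 1) div (2 * a))"
  define b where "b = b0 + 2 * a * k"
  define c where "c = a * k\<^sup>2 + b0 * k + c0"
  have "bqf_act g0 1 k 0 1 = (a, b, c)" by (simp add: g0e b_def c_def algebra_simps)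
  then have "(g0, (a, b, c)) \<in> bqf_SL2Z_rel" unfolding bqf_rel_iff by (metis diff_0_right mult_zero_right mult.right_neutral)
  then have P1: "P (a, b, c)" using tr g0(1) by blast
  have "(b0 + a - 1) mod (2 * a) = b0 + a - 1 - 2 * a * ((b0 + a - 1) div (2 * a))"
    by (simp add: minus_mult_div_eq_mod)
  then have "b = (b0 + a - 1) mod (2 * a) - a + 1" by (simp add: b_def k_def)
  moreover have "0 \<le> (b0 + a - 1) mod (2 * a)" "(b0 + a - 1) mod (2 * a) < 2 * a"
    using a by simp_all
  ultimately have b: "- a < b" "b \<le> a" by linarith+
  have "bqf_act (a, b, c) 0 (-1) 1 0 = (c, - b, a)" by simp
  then have "((a, b, c), (c, - b, a)) \<in> bqf_SL2Z_rel"
    unfolding bqf_rel_iff by (metis add.inverse_inverse diff_0 mult_1 mult_minus1 mult_zero_left)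
  then have P2: "P (c, - b, a)" using tr P1 by blast
  have "c > 0" using pd[OF P2] pos_def_bqfs_iff[OF D] by blast
  have ac: "a \<le> c" using g0(2)[OF P2] a \<open>c > 0\<close> by (simp add: g0e)
  show ?thesis
  proof (cases "b < 0 \<and> a = c")
    case True
    then have "bqf_reduced (c, - b, a)" using b by (auto simp: bqf_reduced_def)
    then show ?thesis using P2 pd[OF P2] unfolding reduced_bqfs_def P_def by blast
  next
    case False
    then have "bqf_reduced (a, b, c)" using b ac by (auto simp: bqf_reduced_def)
    then show ?thesis using P1 pd[OF P1] unfolding reduced_bqfs_def P_def by blast
  qed
qed

text \<open>From \<open>|b| \<le> a \<le> c\<close> the value is at least
  \<open>a * (x^2 - |x * y| + y^2)\<close>, and the bracket is a positive integer away from the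
  origin.\<close>

lemma reduced_min:
  assumes "bqf_reduced (a, b, c)" "a > 0" "(x, y) \<noteq> (0, 0)"
  shows "a \<le> bqf_eval (a, b, c) x y"
proof -
  have r: "\<bar>b\<bar> \<le> a" "a \<le> c" using assms(1) by (auto simp: bqf_reduced_def)
  have "\<bar>b * (x * y)\<bar> \<le> a * \<bar>x * y\<bar>" unfolding abs_mult[of b] using r by (intro mult_right_mono) auto
  then have 1: "b * x * y \<ge> - (a * \<bar>x * y\<bar>)" by (simp add: mult.assoc abs_le_iff)
  have 2: "c * y\<^sup>2 \<ge> a * y\<^sup>2" using r by (intro mult_right_mono) auto
  have "x\<^sup>2 - \<bar>x * y\<bar> + y\<^sup>2 \<ge> 1"
  proof -
    have "2 * (x\<^sup>2 - \<bar>x * y\<bar> + y\<^sup>2) = (\<bar>x\<bar> - \<bar>y\<bar>)\<^sup>2 + x\<^sup>2 + y\<^sup>2"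
    proof -
      have "2 * (u\<^sup>2 - u * v + v\<^sup>2) = (u - v)\<^sup>2 + u\<^sup>2 + v\<^sup>2" for u v :: int by algebra
      from this[of "\<bar>x\<bar>" "\<bar>y\<bar>"] show ?thesis by (simp add: abs_mult)
    qed
    moreover have "x\<^sup>2 + y\<^sup>2 > 0" using assms(3) by (auto simp: sum_power2_gt_zero_iff)
    moreover have "1 \<le> X" if "2 * X = A + u + v" "u + v > 0" "A \<ge> 0" for X A u v :: int
      using that by linarith
    ultimately show ?thesis by (meson zero_le_power2)
  qed
  then have "a * 1 \<le> a * (x\<^sup>2 - \<bar>x * y\<bar> + y\<^sup>2)" using assms(2) by (intro mult_left_mono) auto
  then show ?thesis using 1 2 by (simp add: algebra_simps)
qed

text \<open>Both leading coefficients are the minimum of the same set of values, hence equal. As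
  \<open>3 * a^2 \<le> D\<close>, the vector \<open>(p, r)\<close> where \<open>f\<close> takes the
  value \<open>a\<close> has \<open>|r| \<le> 1\<close>. If \<open>r = 0\<close> the substitution is
  a translation up to sign, and the range \<open>(- a, a]\<close> for both middle coefficients makes
  it trivial. If \<open>|r| = 1\<close>, both forms have equal outer coefficients, and their middle
  coefficients are nonnegative with equal squares.\<close>

lemma reduced_unique:
  assumes D: "D > 0" and f: "f \<in> reduced_bqfs D" and g: "g \<in> reduced_bqfs D"
    and fg: "(f, g) \<in> bqf_SL2Z_rel"
  shows "f = g"
proof -
  obtain a b c where fe: "f = (a, b, c)" by (metis prod_cases3)
  obtain a' b' c' where ge: "g = (a', b', c')" by (metis prod_cases3)
  have rf: "bqf_reduced (a, b, c)" "a > 0" "4 * a * c - b\<^sup>2 = D"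
    and rg: "bqf_reduced (a', b', c')" "a' > 0" "4 * a' * c' - b'\<^sup>2 = D"
    using f g pos_def_bqfs_iff[OF D] unfolding reduced_bqfs_def fe ge by blast+
  obtain p q r s where d: "p * s - q * r = 1" and act: "g = bqf_act f p q r s"
    using fg unfolding bqf_rel_iff by blast
  have inv: "f = bqf_act g s (- q) (- r) p"
  proof -
    have "bqf_act g s (- q) (- r) p = bqf_act f 1 0 0 1"
      unfolding act bqf_act_act using d by (simp add: algebra_simps)
    then show ?thesis by (simp add: bqf_act_id)
  qed
  have a': "a' = bqf_eval (a, b, c) p r" using act by (simp add: fe ge)
  have a: "a = bqf_eval (a', b', c') s (- r)" using inv by (simp add: fe ge)
  have "(p, r) \<noteq> (0, 0)" "(s, - r) \<noteq> (0, 0)" using d by auto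
  have "a \<le> a'" unfolding a' by (rule reduced_min[OF rf(1,2) \<open>(p, r) \<noteq> (0, 0)\<close>])
  moreover have "a' \<le> a" unfolding a by (rule reduced_min[OF rg(1,2) \<open>(s, - r) \<noteq> (0, 0)\<close>])
  ultimately have aa: "a' = a" by simp
  have ap: "bqf_eval (a, b, c) p r = a" and as: "bqf_eval (a', b', c') s (- r) = a'"
    using a a' aa by metis+
  have bc: "\<bar>b\<bar> \<le> a" "a \<le> c" "\<bar>b'\<bar> \<le> a" "a \<le> c'"
    using rf(1) rg(1) aa by (auto simp: bqf_reduced_def)
  have bc': "\<not> (b < 0 \<and> (a = - b \<or> a = c))" "\<not> (b' < 0 \<and> (a = - b' \<or> a = c'))"
    using rf(1) rg(1) aa by (auto simp: bqf_reduced_def)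
  have "4 * a * a = (2 * a * p + b * r)\<^sup>2 + D * r\<^sup>2"
  proof -
    have "bqf_disc (a, b, c) = - D" using rf(3) by simp
    then show ?thesis using bqf_disc_neg_eval[of a b c p r] unfolding ap by (simp only: mult_minus_left diff_minus_eq_add)
  qed
  then have "D * r\<^sup>2 \<le> 4 * a * a" using zero_le_power2[of "2 * a * p + b * r"] by linarith
  moreover have "3 * (a * a) \<le> D"
  proof -
    have "b\<^sup>2 \<le> a\<^sup>2" using bc(1) rf(2) abs_le_square_iff[of b a] by simp
    moreover have "a * a \<le> a * c" using bc(2) rf(2) by simp
    ultimately show ?thesis using rf(3) by (simp add: power2_eq_square)
  qed
  ultimately have "3 * (a * a) * r\<^sup>2 \<le> 4 * (a * a)"
    using mult_right_mono[of "3 * (a * a)" D "r\<^sup>2"] by simp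
  then have "3 * r\<^sup>2 \<le> 4" using rf(2) by (simp add: mult.commute mult.left_commute)
  then have r: "\<bar>r\<bar> \<le> 1"
  proof -
    have "\<not> \<bar>r\<bar> \<ge> 2"
    proof
      assume "\<bar>r\<bar> \<ge> 2"
      then have "r\<^sup>2 \<ge> 2\<^sup>2" using abs_le_square_iff[of 2 r] by simp
      then show False using \<open>3 * r\<^sup>2 \<le> 4\<close> by simp
    qed
    then show ?thesis by simp
  qed
  show ?thesis
  proof (cases "r = 0")
    case True
    then have "p * s = 1" using d by simp
    then have ps: "p = s" "p * p = 1" using zmult_eq_1_iff[of p s] by auto
    have b': "b' = b + 2 * a * (p * q)" using act True ps by (simp add: fe ge algebra_simps power2_eq_square)
    have "p * q = 0"
    proof (rule ccontr)
      assume "p * q \<noteq> 0"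
      then consider "p * q \<ge> 1" | "p * q \<le> -1" by linarith
      then show False
      proof cases
        case 1
        then have "2 * a * 1 \<le> 2 * a * (p * q)" using rf(2) by (intro mult_left_mono) auto
        then show False using b' bc bc' rf(2) by linarith
      next
        case 2
        then have "2 * a * (p * q) \<le> 2 * a * (-1)" using rf(2) by (intro mult_left_mono) auto
        then show False using b' bc bc' rf(2) by linarith
      qed
    qed
    then have "b' = b" using b' by simp
    have "4 * a * c' = 4 * a * c" using rf(3) rg(3) unfolding aa \<open>b' = b\<close> by linarith
    then have "c' = c" using rf(2) by simp
    then show ?thesis using aa \<open>b' = b\<close> by (simp add: fe ge)
  next
    case False
    then have r1: "\<bar>r\<bar> = 1" using r by linarith
    \<comment> \<open>For \<open>|y| = 1\<close> the terms \<open>a * x^2 + b * x * y\<close> are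
      nonnegative, so the value is at least \<open>c\<close>; attaining the minimum \<open>a\<close>
      forces \<open>c = a\<close>.\<close>
    have key: "c = a" if "bqf_reduced (a, b, c)" "a > 0" "a = bqf_eval (a, b, c) x y" "\<bar>y\<bar> = 1" for a b c x y
    proof -
      have r: "\<bar>b\<bar> \<le> a" "a \<le> c" using that(1) by (auto simp: bqf_reduced_def)
      have y: "y\<^sup>2 = 1" using that(4) by (metis power2_abs one_power2)
      have "\<bar>b * x * y\<bar> \<le> a * \<bar>x\<bar>" using r that(4) by (simp add: abs_mult mult_right_mono)
      moreover have "\<bar>x\<bar> \<le> x\<^sup>2"
      proof (cases "x = 0")
        case False
        then have "\<bar>x\<bar> * 1 \<le> \<bar>x\<bar> * \<bar>x\<bar>" by (intro mult_left_mono) auto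
        then show ?thesis by (simp add: power2_eq_square)
      qed simp
      then have "a * \<bar>x\<bar> \<le> a * x\<^sup>2" using that(2) by (intro mult_left_mono) auto
      ultimately show "c = a" using that(3) r y by (simp add: abs_le_iff)
    qed
    have "c = a" by (rule key[OF rf(1,2) ap[symmetric] r1])
    moreover have "c' = a'" by (rule key[OF rg(1,2) as[symmetric]]) (use r1 in simp)
    ultimately have ca: "c = a" "c' = a" using aa by auto
    have "b\<^sup>2 = b'\<^sup>2" using rf(3) rg(3) unfolding aa ca by linarith
    moreover have "b \<ge> 0" "b' \<ge> 0" using bc' ca by auto
    ultimately have "b = b'" by (simp add: power2_eq_iff_nonneg)
    then show ?thesis using ca aa by (simp add: fe ge)
  qed
qed

section \<open>Class numbers as weighted sums over reduced forms\<close>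

definition reduced_wt :: "bqf \<Rightarrow> real" where
  "reduced_wt = (\<lambda>(a, b, c). if b = 0 \<and> a = c then 1 / 2 else if b = a \<and> a = c then 1 / 3 else 1)"

text \<open>Reduced forms are a transversal of the classes. The weight can be read off the
  representative because \<open>(a, 0, a)\<close> and \<open>(a, a, a)\<close> with
  \<open>a > 0\<close> are themselves reduced, so a class contains such a form only as its reduced
  one.\<close>

lemma hurwitz_class_number_reduced:
  assumes D: "D > 0" "D mod 4 \<notin> {1, 2}"
  shows "hurwitz_class_number D = (\<Sum>f\<in>reduced_bqfs D. reduced_wt f)"
proof -
  define X where "X = pos_def_bqfs D"
  define R where "R = bqf_SL2Z_rel \<inter> X \<times> X"
  have E: "equiv X R"
  proof (rule equivI)
    show "R \<subseteq> X \<times> X" by (auto simp: R_def)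
    show "refl_on X R" using equiv_bqf_rel unfolding R_def equiv_def refl_on_def by auto
    show "sym R" using equiv_bqf_rel unfolding R_def equiv_def sym_def by auto
    show "trans R" using equiv_bqf_rel unfolding R_def equiv_def trans_def by blast
  qed
  have RX: "f \<in> X" "bqf_reduced f" if "f \<in> reduced_bqfs D" for f
    using that by (auto simp: reduced_bqfs_def X_def)
  have bij: "bij_betw (\<lambda>f. R `` {f}) (reduced_bqfs D) (X // R)"
    unfolding bij_betw_def
  proof (intro conjI inj_onI equalityI subsetI)
    fix f g assume fg: "f \<in> reduced_bqfs D" "g \<in> reduced_bqfs D" "R `` {f} = R `` {g}"
    then have "(f, g) \<in> R" using eq_equiv_class[OF _ E] RX by blast
    then show "f = g" using reduced_unique[OF D(1) fg(1,2)] by (auto simp: R_def)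
  next
    fix C assume "C \<in> (\<lambda>f. R `` {f}) ` reduced_bqfs D"
    then show "C \<in> X // R" using RX by (auto intro: quotientI)
  next
    fix C assume "C \<in> X // R"
    then obtain f where f: "f \<in> X" "C = R `` {f}" by (rule quotientE)
    obtain g where g: "g \<in> reduced_bqfs D" "(f, g) \<in> bqf_SL2Z_rel"
      using exists_reduced[OF D(1)] f(1) unfolding X_def by blast
    then have "(f, g) \<in> R" using f RX by (auto simp: R_def)
    then have "C = R `` {g}" using f(2) equiv_class_eq[OF E] by blast
    then show "C \<in> (\<lambda>f. R `` {f}) ` reduced_bqfs D" using g(1) by blast
  qed
  have wt: "bqf_class_weight (R `` {f}) = reduced_wt f" if f: "f \<in> reduced_bqfs D" for f
  proof -
    have in_iff: "h \<in> R `` {f} \<longleftrightarrow> h = f" if "bqf_reduced h" for h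
    proof
      assume "h \<in> R `` {f}"
      then have "(f, h) \<in> bqf_SL2Z_rel" "h \<in> reduced_bqfs D"
        using that by (auto simp: R_def X_def reduced_bqfs_def)
      then show "h = f" using reduced_unique[OF D(1) f] by blast
    next
      assume "h = f" then show "h \<in> R `` {f}"
        using RX[OF f] E by (auto simp: equiv_def refl_on_def)
    qed
    have pos: "a > 0" if "h \<in> R `` {f}" "h = (a, b, c)" for h a b c
      using that pos_def_bqfs_iff[OF D(1)] by (auto simp: R_def X_def)
    have 1: "(\<exists>a. (a, 0, a) \<in> R `` {f}) \<longleftrightarrow> (\<exists>a. f = (a, 0, a))"
    proof
      assume "\<exists>a. (a, 0, a) \<in> R `` {f}"
      then obtain a where a: "(a, 0, a) \<in> R `` {f}" by blast
      then have "bqf_reduced (a, 0, a)" using pos[OF a refl] by (simp add: bqf_reduced_def)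
      then show "\<exists>a. f = (a, 0, a)" using in_iff a by metis
    next
      assume "\<exists>a. f = (a, 0, a)"
      then show "\<exists>a. (a, 0, a) \<in> R `` {f}" using in_iff[of f] RX(2)[OF f] by auto
    qed
    have 2: "(\<exists>a. (a, a, a) \<in> R `` {f}) \<longleftrightarrow> (\<exists>a. f = (a, a, a))"
    proof
      assume "\<exists>a. (a, a, a) \<in> R `` {f}"
      then obtain a where a: "(a, a, a) \<in> R `` {f}" by blast
      then have "bqf_reduced (a, a, a)" using pos[OF a refl] by (simp add: bqf_reduced_def)
      then show "\<exists>a. f = (a, a, a)" using in_iff a by metis
    next
      assume "\<exists>a. f = (a, a, a)"
      then show "\<exists>a. (a, a, a) \<in> R `` {f}" using in_iff[of f] RX(2)[OF f] by auto
    qed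
    show ?thesis unfolding bqf_class_weight_def 1 2 by (cases f) (auto simp: reduced_wt_def)
  qed
  have "bqf_classes D = X // R" by (simp add: bqf_classes_def X_def R_def)
  then have "hurwitz_class_number D = (\<Sum>C\<in>X // R. bqf_class_weight C)"
    using D by (auto simp: hurwitz_class_number_def)
  also have "\<dots> = (\<Sum>f\<in>reduced_bqfs D. bqf_class_weight (R `` {f}))"
    by (rule sum.reindex_bij_betw[OF bij, symmetric])
  also have "\<dots> = (\<Sum>f\<in>reduced_bqfs D. reduced_wt f)"
    using wt by (intro sum.cong) auto
  finally show ?thesis .
qed

subsection \<open>Class numbers and Selling parameters\<close>

definition par_triples :: "int \<Rightarrow> (int \<times> int \<times> int) set" where
  "par_triples D = {v \<in> selling_triples D. same_parity v}"

definition sorted_triples :: "int \<Rightarrow> (int \<times> int \<times> int) set" where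
  "sorted_triples D = {v \<in> par_triples D. case v of (x, y, z) \<Rightarrow> x \<le> y \<and> y \<le> z}"

definition sort3 :: "int \<times> int \<times> int \<Rightarrow> int \<times> int \<times> int" where
  "sort3 = (\<lambda>(x, y, z). (min x (min y z), x + y + z - min x (min y z) - max x (max y z), max x (max y z)))"

text \<open>Taken as a set, so that orderings which coincide for repeated entries count
  once.\<close>

definition perms3 :: "int \<times> int \<times> int \<Rightarrow> (int \<times> int \<times> int) set" where
  "perms3 = (\<lambda>(x, y, z). {(x, y, z), (x, z, y), (y, x, z), (y, z, x), (z, x, y), (z, y, x)})"

lemma sort3_eq_iff:
  assumes "x \<le> y" "y \<le> z"
  shows "sort3 v = (x, y, z) \<longleftrightarrow> v \<in> perms3 (x, y, z)"
  using assms by (cases v) (auto simp: sort3_def perms3_def min_def max_def split: if_splits)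

lemma sort3_sorted: "sort3 v = (x, y, z) \<Longrightarrow> x \<le> y \<and> y \<le> z"
  by (cases v) (auto simp: sort3_def min_def max_def split: if_splits)

lemma perms3_par_triples:
  assumes "w \<in> perms3 v"
  shows "w \<in> par_triples D \<longleftrightarrow> v \<in> par_triples D"
proof -
  obtain x y z where v: "v = (x, y, z)" by (metis prod_cases3)
  show ?thesis
    using assms by (auto simp: v perms3_def par_triples_def selling_triples_def same_parity_def algebra_simps)
qed

lemma sort3_par_triples:
  assumes "v \<in> par_triples D" shows "sort3 v \<in> sorted_triples D"
proof -
  obtain x y z where s: "sort3 v = (x, y, z)" by (metis prod_cases3)
  have le: "x \<le> y" "y \<le> z" using sort3_sorted[OF s] by auto
  then have "v \<in> perms3 (x, y, z)" using s sort3_eq_iff by blast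
  then show ?thesis using assms perms3_par_triples le unfolding s sorted_triples_def by auto
qed

lemma sort3_fibre:
  assumes "s \<in> sorted_triples D"
  shows "{v \<in> par_triples D. sort3 v = s} = perms3 s"
proof -
  obtain x y z where s: "s = (x, y, z)" by (metis prod_cases3)
  have "x \<le> y" "y \<le> z" "s \<in> par_triples D" using assms by (auto simp: s sorted_triples_def)
  then show ?thesis using sort3_eq_iff perms3_par_triples unfolding s by blast
qed

text \<open>The number of distinct orderings times the Selling weight. In a sorted triple with
  \<open>D > 0\<close> only \<open>x\<close> can vanish, which is why \<open>x = 0\<close> alone is
  tested.\<close>

definition triple_mult :: "int \<times> int \<times> int \<Rightarrow> real" where
  "triple_mult = (\<lambda>(x, y, z). (if x = y \<and> y = z then 1 else if x = y \<or> y = z then 3 else 6) *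
     (if x = 0 then 1 / 2 else 1))"

lemma sum_perms3:
  assumes "s \<in> sorted_triples D" "D > 0"
  shows "(\<Sum>v\<in>perms3 s. selling_wt v) = triple_mult s"
proof -
  obtain x y z where s: "s = (x, y, z)" by (metis prod_cases3)
  have le: "0 \<le> x" "x \<le> y" "y \<le> z" "x * y + y * z + z * x = D"
    using assms(1) by (auto simp: s sorted_triples_def par_triples_def selling_triples_def)
  have y: "y > 0" using le assms(2) by (cases "y = 0") auto
  consider "x = y" "y = z" | "x = y" "y < z" | "x < y" "y = z" | "x < y" "y < z" using le by linarith
  then show ?thesis
    using y le(1) by cases (auto simp: s perms3_def triple_mult_def selling_wt_def insert_commute)
qed

lemma finite_par_triples: "D > 0 \<Longrightarrow> finite (par_triples D)"
  unfolding par_triples_def using finite_selling_triples by simp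

lemma finite_sorted_triples: "D > 0 \<Longrightarrow> finite (sorted_triples D)"
  unfolding sorted_triples_def using finite_par_triples by simp

lemma sum_par_triples:
  assumes "D > 0"
  shows "(\<Sum>v\<in>par_triples D. selling_wt v) = (\<Sum>s\<in>sorted_triples D. triple_mult s)"
proof -
  have "(\<Sum>s\<in>sorted_triples D. \<Sum>v | v \<in> par_triples D \<and> sort3 v = s. selling_wt v) = (\<Sum>v\<in>par_triples D. selling_wt v)"
    by (rule sum.group) (use finite_par_triples finite_sorted_triples sort3_par_triples assms in auto)
  then show ?thesis using sort3_fibre sum_perms3 assms by simp
qed

text \<open>A reduced form determines its Selling parameters up to order; the sign of the middle coefficient
  and the class weights account for the number of orderings.\<close>

definition form_triple :: "bqf \<Rightarrow> int \<times> int \<times> int" where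
  "form_triple = (\<lambda>(a, b, c). (\<bar>b\<bar>, 2 * a - \<bar>b\<bar>, 2 * c - \<bar>b\<bar>))"

lemma form_triple_sorted:
  assumes "f \<in> reduced_bqfs D" "D > 0"
  shows "form_triple f \<in> sorted_triples D"
proof -
  obtain a b c where f: "f = (a, b, c)" by (metis prod_cases3)
  have r: "\<bar>b\<bar> \<le> a" "a \<le> c" "4 * a * c - b\<^sup>2 = D"
    using assms pos_def_bqfs_iff[OF assms(2)] by (auto simp: f reduced_bqfs_def bqf_reduced_def)
  define u where "u = \<bar>b\<bar>"
  have "b\<^sup>2 = u\<^sup>2" by (simp add: u_def)
  then have "4 * a * c - u\<^sup>2 = D" using r(3) by simp
  moreover have "u * (2 * a - u) + (2 * a - u) * (2 * c - u) + (2 * c - u) * u = 4 * a * c - u\<^sup>2"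
    by algebra
  moreover have "0 \<le> u" "u \<le> 2 * a - u" "2 * a - u \<le> 2 * c - u" "0 \<le> 2 * a - u" "0 \<le> 2 * c - u"
    using r(1,2) by (auto simp: u_def)
  ultimately show ?thesis
    by (simp add: f form_triple_def sorted_triples_def par_triples_def selling_triples_def same_parity_def
        u_def[symmetric] del: diff_ge_0_iff_ge)
qed

text \<open>The sign of \<open>b\<close> is free exactly in the interior of the reduced domain:
  \<open>x = 0\<close> means \<open>b = 0\<close>, \<open>x = y\<close> means
  \<open>|b| = a\<close>, and \<open>y = z\<close> means \<open>a = c\<close>.\<close>

lemma form_triple_fibre:
  assumes s: "(x, y, z) \<in> sorted_triples D" and D: "D > 0"
  shows "{f \<in> reduced_bqfs D. form_triple f = (x, y, z)}
    = (if 0 < x \<and> x < y \<and> y < z then {((x + y) div 2, x, (x + z) div 2), ((x + y) div 2, - x, (x + z) div 2)}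
       else {((x + y) div 2, x, (x + z) div 2)})"
proof -
  have le: "0 \<le> x" "x \<le> y" "y \<le> z" "x * y + y * z + z * x = D" and par: "even x \<longleftrightarrow> even y" "even y \<longleftrightarrow> even z"
    using s by (auto simp: sorted_triples_def par_triples_def selling_triples_def same_parity_def)
  define a c where "a = (x + y) div 2" and "c = (x + z) div 2"
  have ac: "2 * a = x + y" "2 * c = x + z" using par by (auto simp: a_def c_def)
  have y: "y > 0" using le D by (cases "y = 0") auto
  have D': "4 * a * c - x\<^sup>2 = D"
  proof -
    have "4 * a * c = (2 * a) * (2 * c)" by simp
    also have "\<dots> = x * y + y * z + z * x + x\<^sup>2" unfolding ac by algebra
    finally show ?thesis using le(4) by simp
  qed
  have iff: "(a', b', c') \<in> reduced_bqfs D \<and> form_triple (a', b', c') = (x, y, z)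
     \<longleftrightarrow> a' = a \<and> c' = c \<and> (b' = x \<or> b' = - x \<and> 0 < x \<and> x < y \<and> y < z)" for a' b' c'
  proof
    assume "(a', b', c') \<in> reduced_bqfs D \<and> form_triple (a', b', c') = (x, y, z)"
    then have h: "bqf_reduced (a', b', c')" "\<bar>b'\<bar> = x" "2 * a' - \<bar>b'\<bar> = y" "2 * c' - \<bar>b'\<bar> = z"
      by (auto simp: reduced_bqfs_def form_triple_def)
    then have e: "a' = a" "c' = c" using ac by linarith+
    moreover have "b' < 0 \<Longrightarrow> - b' < a' \<and> a' < c'" using h(1) by (auto simp: bqf_reduced_def)
    ultimately show "a' = a \<and> c' = c \<and> (b' = x \<or> b' = - x \<and> 0 < x \<and> x < y \<and> y < z)"
      using h(2-4) by linarith
  next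
    assume h: "a' = a \<and> c' = c \<and> (b' = x \<or> b' = - x \<and> 0 < x \<and> x < y \<and> y < z)"
    then have b: "\<bar>b'\<bar> = x" using le by auto
    then have "b'\<^sup>2 = x\<^sup>2" by (metis power2_abs)
    then have "4 * a' * c' - b'\<^sup>2 = D" using D' h by simp
    moreover have "a' > 0" using h ac y le by linarith
    moreover have "bqf_reduced (a', b', c')"
      unfolding bqf_reduced_def using h b ac le by (simp, linarith)
    ultimately show "(a', b', c') \<in> reduced_bqfs D \<and> form_triple (a', b', c') = (x, y, z)"
      using pos_def_bqfs_iff[OF D] h b ac by (auto simp: reduced_bqfs_def form_triple_def)
  qed
  show ?thesis unfolding a_def[symmetric] c_def[symmetric] using iff by auto
qed

text \<open>In the generic case two forms of weight \<open>1\<close> give \<open>6\<close>. One form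
  of weight \<open>1\<close> gives \<open>3\<close>, which is either the three orderings of a triple
  with two equal positive entries or half of six when only \<open>x = 0\<close>. The special weights
  match too: \<open>3 / 2\<close> for \<open>x = 0\<close> and \<open>y = z\<close>, and
  \<open>1\<close> for \<open>x = y = z\<close>.\<close>

lemma sum_form_triple_fibre:
  assumes s: "s \<in> sorted_triples D" and D: "D > 0"
  shows "(\<Sum>f | f \<in> reduced_bqfs D \<and> form_triple f = s. 3 * reduced_wt f) = triple_mult s"
proof -
  obtain x y z where xyz: "s = (x, y, z)" by (metis prod_cases3)
  have le: "0 \<le> x" "x \<le> y" "y \<le> z" "x * y + y * z + z * x = D" and par: "even x \<longleftrightarrow> even y" "even y \<longleftrightarrow> even z"
    using s by (auto simp: xyz sorted_triples_def par_triples_def selling_triples_def same_parity_def)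
  define a c where "a = (x + y) div 2" and "c = (x + z) div 2"
  have ac: "2 * a = x + y" "2 * c = x + z" using par by (auto simp: a_def c_def)
  have y: "y > 0" using le D by (cases "y = 0") auto
  have eqs: "a = c \<longleftrightarrow> y = z" "x = a \<longleftrightarrow> x = y" "- x \<noteq> a" using ac le y by linarith+
  show ?thesis
  proof (cases "0 < x \<and> x < y \<and> y < z")
    case True
    then show ?thesis
      unfolding xyz form_triple_fibre[OF s[unfolded xyz] D] a_def[symmetric] c_def[symmetric]
      by (simp add: reduced_wt_def triple_mult_def eqs)
  next
    case False
    then have cs: "x = 0 \<or> x = y \<or> y = z" using le by linarith
    have "(\<Sum>f\<in>{(a, x, c)}. 3 * reduced_wt f)
        = 3 * reduced_wt (a, x, c)" by simp
    also have "reduced_wt (a, x, c) = (if x = 0 \<and> a = c then 1 / 2 else if x = a \<and> a = c then 1 / 3 else 1)"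
      by (simp only: reduced_wt_def prod.case)
    also have "\<dots> = (if x = 0 \<and> y = z then 1 / 2 else if x = y \<and> y = z then 1 / 3 else 1)"
      by (simp only: eqs)
    also have "3 * (if x = 0 \<and> y = z then 1 / 2 else if x = y \<and> y = z then 1 / 3 else 1) = triple_mult (x, y, z)"
      using y cs by (cases "x = 0"; cases "x = y"; cases "y = z"; simp add: triple_mult_def)
    finally show ?thesis
      unfolding xyz form_triple_fibre[OF s[unfolded xyz] D] a_def[symmetric] c_def[symmetric] if_not_P[OF False] .
  qed
qed

lemma finite_reduced_bqfs:
  assumes D: "D > 0" shows "finite (reduced_bqfs D)"
proof (rule finite_subset)
  show "reduced_bqfs D \<subseteq> (\<Union>s\<in>sorted_triples D. {f \<in> reduced_bqfs D. form_triple f = s})"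
    using form_triple_sorted[OF _ D] by blast
  show "finite (\<Union>s\<in>sorted_triples D. {f \<in> reduced_bqfs D. form_triple f = s})"
  proof (rule finite_UN_I[OF finite_sorted_triples[OF D]])
    fix s assume "s \<in> sorted_triples D"
    then show "finite {f \<in> reduced_bqfs D. form_triple f = s}"
      using form_triple_fibre[OF _ D] by (cases s) simp
  qed
qed

theorem hurwitz_class_number_selling:
  assumes D: "D > 0" "D mod 4 \<notin> {1, 2}"
  shows "3 * hurwitz_class_number D = (\<Sum>v\<in>par_triples D. selling_wt v)"
proof -
  have "(\<Sum>s\<in>sorted_triples D. \<Sum>f | f \<in> reduced_bqfs D \<and> form_triple f = s. 3 * reduced_wt f)
      = (\<Sum>f\<in>reduced_bqfs D. 3 * reduced_wt f)"
    by (rule sum.group) (use finite_reduced_bqfs finite_sorted_triples form_triple_sorted D in auto)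
  then have "(\<Sum>f\<in>reduced_bqfs D. 3 * reduced_wt f) = (\<Sum>s\<in>sorted_triples D. triple_mult s)"
    using sum_form_triple_fibre D(1) by simp
  then show ?thesis
    using hurwitz_class_number_reduced[OF D] sum_par_triples[OF D(1)] by (simp add: sum_distrib_left)
qed

text \<open>Three odd entries would make \<open>x * y + y * z + z * x\<close> odd, so the
  equal-parity triples for \<open>4 * D\<close> are entirely even and can be halved.\<close>

lemma sum_par_triples_4:
  assumes "D > 0"
  shows "(\<Sum>v\<in>par_triples (4 * D). selling_wt v) = (\<Sum>v\<in>selling_triples D. selling_wt v)"
proof (rule sum.reindex_bij_witness[of _ "\<lambda>(x, y, z). (2 * x, 2 * y, 2 * z)" "\<lambda>(x, y, z). (x div 2, y div 2, z div 2)"])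
  have ev: "even x \<and> even y \<and> even z" if "(x, y, z) \<in> par_triples (4 * D)" for x y z
  proof (rule ccontr)
    assume "\<not> ?thesis"
    then have "odd x" "odd y" "odd z" using that by (auto simp: par_triples_def same_parity_def)
    then have "odd (x * y + y * z + z * x)" by simp
    moreover have "x * y + y * z + z * x = 4 * D" using that by (auto simp: par_triples_def selling_triples_def)
    ultimately show False by simp
  qed
  fix v assume v: "v \<in> par_triples (4 * D)"
  obtain x y z where xyz: "v = (x, y, z)" by (metis prod_cases3)
  have e: "even x" "even y" "even z" using ev v by (auto simp: xyz)
  then obtain i j k where ijk: "x = 2 * i" "y = 2 * j" "z = 2 * k" by (auto elim!: evenE)
  show "(case case v of (x, y, z) \<Rightarrow> (x div 2, y div 2, z div 2) of (x, y, z) \<Rightarrow> (2 * x, 2 * y, 2 * z)) = v"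
    by (simp add: xyz ijk)
  show "(case v of (x, y, z) \<Rightarrow> (x div 2, y div 2, z div 2)) \<in> selling_triples D"
    using v by (auto simp: xyz ijk par_triples_def selling_triples_def algebra_simps)
  show "selling_wt (case v of (x, y, z) \<Rightarrow> (x div 2, y div 2, z div 2)) = selling_wt v"
    by (simp add: xyz ijk selling_wt_def)
next
  fix v assume v: "v \<in> selling_triples D"
  obtain x y z where xyz: "v = (x, y, z)" by (metis prod_cases3)
  show "(case case v of (x, y, z) \<Rightarrow> (2 * x, 2 * y, 2 * z) of (x, y, z) \<Rightarrow> (x div 2, y div 2, z div 2)) = v"
    by (simp add: xyz)
  show "(case v of (x, y, z) \<Rightarrow> (2 * x, 2 * y, 2 * z)) \<in> par_triples (4 * D)"
    using v by (auto simp: xyz par_triples_def selling_triples_def same_parity_def algebra_simps)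
qed

theorem card_three_squares_hurwitz:
  assumes D: "D > 0" "D mod 4 \<in> {0, 3}"
  shows "real (card (three_squares D)) = 12 * hurwitz_class_number2 D"
proof -
  have D': "D mod 4 \<notin> {1, 2}" using D by auto
  have 1: "3 * hurwitz_class_number (4 * D) = (\<Sum>v\<in>selling_triples D. selling_wt v)"
    using hurwitz_class_number_selling[of "4 * D"] sum_par_triples_4 D(1) by simp
  have 2: "3 * hurwitz_class_number D = (\<Sum>v\<in>par_triples D. selling_wt v)"
    by (rule hurwitz_class_number_selling[OF D(1) D'])
  have "hurwitz_class_number2 D = hurwitz_class_number (4 * D) - 2 * hurwitz_class_number D"
    using D by (simp add: hurwitz_class_number2_def)
  then show ?thesis
    using card_three_squares[OF D(1)] 1 2 by (simp add: par_triples_def)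
qed

section \<open>Discriminants congruent to 3 modulo 8\<close>

lemma par_triples_odd:
  assumes "(x, y, z) \<in> par_triples D" "D mod 4 = 3"
  shows "odd x" "odd y" "odd z"
proof -
  have e: "x * y + y * z + z * x = D" and p: "even x \<longleftrightarrow> even y" "even y \<longleftrightarrow> even z"
    using assms(1) by (auto simp: par_triples_def selling_triples_def same_parity_def)
  have "odd D" using assms(2) by presburger
  then have "odd (x * y + y * z + z * x)" unfolding e .
  then show "odd x" "odd y" "odd z" using p by auto
qed

definition mixed_triples :: "int \<Rightarrow> (int \<times> int \<times> int) set" where
  "mixed_triples D = {(x, y, z). (x, y, z) \<in> selling_triples D \<and> odd x \<and> odd y \<and> even z}"

text \<open>For \<open>x < y\<close> the map \<open>(x, y, z) \<mapsto> (x, x + 2 z, (y - x) / 2)\<close> preserves \<open>x y + y z + z x\<close>. Modulo 8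
  it sends the mixed triples onto the odd triples with \<open>x \<le> y\<close>.\<close>

lemma sum_mixed_triples:
  assumes D: "D > 0" "D mod 8 = 3"
  shows "(\<Sum>v\<in>mixed_triples D. selling_wt v) = (\<Sum>v\<in>par_triples D. selling_wt v)"
proof -
  have D4: "D mod 4 = 3" using D(2) by presburger
  define M1 where "M1 = {(x, y, z). (x, y, z) \<in> mixed_triples D \<and> x < y}"
  define M2 where "M2 = {(x, y, z). (x, y, z) \<in> mixed_triples D \<and> y < x}"
  define P1 where "P1 = {(x, y, z). (x, y, z) \<in> par_triples D \<and> x \<le> y}"
  define P2 where "P2 = {(x, y, z). (x, y, z) \<in> par_triples D \<and> y < x}"
  have fM: "finite (mixed_triples D)"
    by (rule finite_subset[OF _ finite_selling_triples[OF D(1)]]) (auto simp: mixed_triples_def)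
  have fP: "finite (par_triples D)" by (rule finite_par_triples[OF D(1)])
  have ne: "x \<noteq> y" if t: "(x, y, z) \<in> mixed_triples D" for x y z
  proof
    assume "x = y"
    obtain i where i: "x = 2 * i + 1" using t by (auto simp: mixed_triples_def elim!: oddE)
    obtain k where k: "z = 2 * k" using t by (auto simp: mixed_triples_def elim!: evenE)
    have "D = x * y + y * z + z * x" using t by (auto simp: mixed_triples_def selling_triples_def)
    also have "\<dots> = 4 * (i\<^sup>2 + i + k * (2 * i + 1)) + 1" unfolding \<open>x = y\<close>[symmetric] i k by algebra
    finally show False using D4 by presburger
  qed
  have M: "mixed_triples D = M1 \<union> M2" using ne by (force simp: M1_def M2_def)
  have "(\<Sum>v\<in>mixed_triples D. selling_wt v) = (\<Sum>v\<in>M1. selling_wt v) + (\<Sum>v\<in>M2. selling_wt v)"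
    unfolding M
  proof (rule sum.union_disjoint)
    show "finite M1" "finite M2" by (rule finite_subset[OF _ fM], auto simp: M1_def M2_def)+
  qed (auto simp: M1_def M2_def)
  also have "(\<Sum>v\<in>M2. selling_wt v) = (\<Sum>v\<in>M1. selling_wt v)"
    by (rule sum.reindex_bij_witness[of _ "\<lambda>(x, y, z). (y, x, z)" "\<lambda>(x, y, z). (y, x, z)"])
       (auto simp: M1_def M2_def mixed_triples_def selling_triples_def selling_wt_def algebra_simps)
  \<comment> \<open>The map sends the face \<open>z = 0\<close>, of weight \<open>1 / 2\<close>, to
    the diagonal \<open>x = y\<close>. After doubling, the diagonal of \<open>P1\<close> counts once
    and the rest twice, which by the symmetry in \<open>x\<close> and \<open>y\<close> is all of
    \<open>par_triples D\<close>.\<close>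
  also have "(\<Sum>v\<in>M1. selling_wt v) = (\<Sum>(x, y, z)\<in>P1. if x = y then 1 / 2 else 1)"
  proof (rule sum.reindex_bij_witness[of _ "\<lambda>(x, y, z). (x, x + 2 * z, (y - x) div 2)" "\<lambda>(x, y, z). (x, x + 2 * z, (y - x) div 2)"])
    fix v assume v: "v \<in> M1"
    obtain x y z where xyz: "v = (x, y, z)" by (metis prod_cases3)
    have h: "x \<ge> 0" "z \<ge> 0" "x * y + y * z + z * x = D" "odd x" "odd y" "even z" "x < y"
      using v by (auto simp: xyz M1_def mixed_triples_def selling_triples_def)
    have "even (y - x)" using h(4,5) by simp
    then obtain m where "y - x = 2 * m" using evenE by blast
    then have m: "y = x + 2 * m" by simp
    obtain i where i: "x = 2 * i + 1" using oddE[OF h(4)] by blast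
    obtain k where k: "z = 2 * k" using evenE[OF h(6)] by blast
    have "odd m"
    proof
      assume "even m"
      then obtain n where n: "m = 2 * n" using evenE by blast
      have "D = 4 * (i\<^sup>2 + i + n * x + k * x + 2 * n * k) + 1"
        unfolding h(3)[symmetric] m n k i by algebra
      then show False using D4 by presburger
    qed
    have e: "x * (x + 2 * z) + (x + 2 * z) * m + m * x = D"
      unfolding h(3)[symmetric] m by algebra
    have w: "(case v of (x, y, z) \<Rightarrow> (x, x + 2 * z, (y - x) div 2)) = (x, x + 2 * z, m)"
      by (simp add: xyz m)
    show "(case case v of (x, y, z) \<Rightarrow> (x, x + 2 * z, (y - x) div 2) of (x, y, z) \<Rightarrow> (x, x + 2 * z, (y - x) div 2)) = v"
      unfolding w by (simp add: xyz m)
    show "(case v of (x, y, z) \<Rightarrow> (x, x + 2 * z, (y - x) div 2)) \<in> P1"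
      unfolding w using e h m \<open>odd m\<close> by (simp add: P1_def par_triples_def selling_triples_def same_parity_def)
    show "(case case v of (x, y, z) \<Rightarrow> (x, x + 2 * z, (y - x) div 2) of (x, y, z) \<Rightarrow> if x = y then 1 / 2 else 1) = selling_wt v"
    proof -
      have "x \<noteq> 0" "y \<noteq> 0" using h(4,5) by auto
      then show ?thesis unfolding w using \<open>odd m\<close> by (auto simp: xyz selling_wt_def)
    qed
  next
    fix v assume v: "v \<in> P1"
    obtain x y z where xyz: "v = (x, y, z)" by (metis prod_cases3)
    have h: "x \<ge> 0" "z \<ge> 0" "x * y + y * z + z * x = D" "x \<le> y" and p: "(x, y, z) \<in> par_triples D"
      using v by (auto simp: xyz P1_def par_triples_def selling_triples_def)
    have o: "odd x" "odd y" "odd z" using par_triples_odd[OF p D4] by auto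
    have "z > 0" using h(2) o(3) by (cases "z = 0") auto
    have "even (y - x)" using o by simp
    then obtain m where "y - x = 2 * m" using evenE by blast
    then have m: "y = x + 2 * m" by simp
    obtain i where i: "z = 2 * i + 1" using oddE[OF o(3)] by blast
    obtain j where j: "x = 2 * j + 1" using oddE[OF o(1)] by blast
    have "even m"
    proof (rule ccontr)
      assume "odd m"
      then obtain n where n: "m = 2 * n + 1" using oddE by blast
      \<comment> \<open>\<open>W\<close> is \<open>(x + z) / 2\<close>, suggested by
        \<open>D = (x + z) * (y + z) - z^2\<close>. For odd \<open>m\<close> the product
        \<open>W * (W + m)\<close> is even, which would put \<open>D\<close> in the class 7 modulo
        8.\<close>
      define W where "W = i + j + 1"
      obtain V where V: "W * (W + m) = 2 * V"
      proof -
        have "even (W * (W + m))" using n by simp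
        then show thesis using that evenE by blast
      qed
      obtain U where U: "i\<^sup>2 + i = 2 * U"
      proof -
        have "even (i\<^sup>2 + i)" by simp
        then show thesis using that evenE by blast
      qed
      have "D = 4 * (W * (W + m)) - 4 * (i\<^sup>2 + i) - 1"
        unfolding h(3)[symmetric] m W_def i j by algebra
      then have "D = 8 * V - 8 * U - 1" unfolding V U by simp
      then show False using D(2) by presburger
    qed
    have e: "x * (x + 2 * z) + (x + 2 * z) * m + m * x = D"
      unfolding h(3)[symmetric] m by algebra
    have w: "(case v of (x, y, z) \<Rightarrow> (x, x + 2 * z, (y - x) div 2)) = (x, x + 2 * z, m)"
      by (simp add: xyz m)
    show "(case case v of (x, y, z) \<Rightarrow> (x, x + 2 * z, (y - x) div 2) of (x, y, z) \<Rightarrow> (x, x + 2 * z, (y - x) div 2)) = v"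
      unfolding w by (simp add: xyz m)
    show "(case v of (x, y, z) \<Rightarrow> (x, x + 2 * z, (y - x) div 2)) \<in> M1"
      unfolding w using e h m \<open>even m\<close> o \<open>z > 0\<close> by (simp add: M1_def mixed_triples_def selling_triples_def)
  qed
  also have "(\<Sum>(x, y, z)\<in>P1. if x = y then 1 / 2 else 1) + (\<Sum>(x, y, z)\<in>P1. if x = y then 1 / 2 else 1)
      = (\<Sum>(x, y, z)\<in>P1. if x = y then 1 else 2 :: real)"
    unfolding sum.distrib[symmetric] by (rule sum.cong) auto
  also have "\<dots> = (\<Sum>v\<in>P1. 1) + (\<Sum>(x, y, z)\<in>P1. if x < y then 1 else 0)"
    unfolding sum.distrib[symmetric] by (rule sum.cong) (auto simp: P1_def)
  also have "(\<Sum>(x, y, z)\<in>P1. if x < y then 1 else 0) = (\<Sum>v\<in>P2. 1 :: real)"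
  proof -
    have "finite P1" by (rule finite_subset[OF _ fP]) (auto simp: P1_def)
    then have "(\<Sum>(x, y, z)\<in>P1. if x < y then 1 else 0) = (\<Sum>v | v \<in> P1 \<and> (case v of (x, y, z) \<Rightarrow> x < y). 1 :: real)"
      by (subst sum.inter_filter) (auto intro!: sum.cong)
    also have "\<dots> = (\<Sum>v\<in>P2. 1)"
      by (rule sum.reindex_bij_witness[of _ "\<lambda>(x, y, z). (y, x, z)" "\<lambda>(x, y, z). (y, x, z)"])
         (auto simp: P1_def P2_def par_triples_def selling_triples_def same_parity_def algebra_simps)
    finally show ?thesis .
  qed
  also have "(\<Sum>v\<in>P1. 1) + (\<Sum>v\<in>P2. 1 :: real) = (\<Sum>v\<in>par_triples D. 1)"
  proof -
    have P: "par_triples D = P1 \<union> P2" by (force simp: P1_def P2_def)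
    have "finite P1" "finite P2" by (rule finite_subset[OF _ fP], auto simp: P1_def P2_def)+
    moreover have "P1 \<inter> P2 = {}" by (auto simp: P1_def P2_def)
    ultimately show ?thesis unfolding P by (rule sum.union_disjoint[symmetric])
  qed
  also have "\<dots> = (\<Sum>v\<in>par_triples D. selling_wt v)"
  proof (rule sum.cong)
    fix v assume v: "v \<in> par_triples D"
    obtain x y z where xyz: "v = (x, y, z)" by (metis prod_cases3)
    show "1 = selling_wt v" using par_triples_odd[OF v[unfolded xyz] D4] by (auto simp: xyz selling_wt_def)
  qed simp
  finally show ?thesis .
qed

text \<open>For odd \<open>D\<close> either all entries are odd or exactly one is even. The three
  positions of the even entry each contribute as much as the odd triples by
  \<open>sum_mixed_triples\<close>, so the full sum is four times the equal-parity sum, that is,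
  \<open>H(4 D) = 4 H(D)\<close>.\<close>

theorem card_three_squares_3_mod_8:
  assumes D: "D > 0" "D mod 8 = 3"
  shows "real (card (three_squares D)) = 24 * hurwitz_class_number D"
proof -
  have D4: "D mod 4 = 3" using D(2) by presburger
  have oD: "odd D" using D(2) by presburger
  define N where "N = mixed_triples D"
  define N1 where "N1 = (\<lambda>(x, y, z). (z, x, y)) ` N"
  define N2 where "N2 = (\<lambda>(x, y, z). (y, z, x)) ` N"
  have fN: "finite N"
    unfolding N_def by (rule finite_subset[OF _ finite_selling_triples[OF D(1)]]) (auto simp: mixed_triples_def)
  have sub: "v \<in> par_triples D \<or> v \<in> N \<or> v \<in> N1 \<or> v \<in> N2" if v: "v \<in> selling_triples D" for v
  proof -
    obtain x y z where xyz: "v = (x, y, z)" by (metis prod_cases3)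
    have e: "x * y + y * z + z * x = D" using v by (auto simp: xyz selling_triples_def)
    have "odd (x * y + y * z + z * x)" unfolding e by (rule oD)
    then consider "odd x" "odd y" "odd z" | "odd x" "odd y" "even z" | "odd y" "odd z" "even x" | "odd z" "odd x" "even y"
      by auto
    then show ?thesis
    proof cases
      case 1 then show ?thesis using v by (auto simp: xyz par_triples_def same_parity_def)
    next
      case 2 then show ?thesis using v by (auto simp: xyz N_def mixed_triples_def)
    next
      case 3
      then have "(y, z, x) \<in> N" using v by (auto simp: xyz N_def mixed_triples_def selling_triples_def algebra_simps)
      then have "v \<in> N1" unfolding N1_def xyz by (force simp: image_iff)
      then show ?thesis by blast
    next
      case 4
      then have "(z, x, y) \<in> N" using v by (auto simp: xyz N_def mixed_triples_def selling_triples_def algebra_simps)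
      then have "v \<in> N2" unfolding N2_def xyz by (force simp: image_iff)
      then show ?thesis by blast
    qed
  qed
  have C: "selling_triples D = par_triples D \<union> (N \<union> (N1 \<union> N2))"
    using sub by (auto simp: par_triples_def N_def N1_def N2_def mixed_triples_def selling_triples_def algebra_simps)
  have d: "par_triples D \<inter> (N \<union> (N1 \<union> N2)) = {}" "N \<inter> (N1 \<union> N2) = {}" "N1 \<inter> N2 = {}"
    by (auto simp: par_triples_def N_def N1_def N2_def mixed_triples_def same_parity_def)
  have w1: "(\<Sum>v\<in>N1. selling_wt v) = (\<Sum>v\<in>N. selling_wt v)"
    unfolding N1_def by (subst sum.reindex) (auto simp: inj_on_def selling_wt_def intro!: sum.cong)
  have w2: "(\<Sum>v\<in>N2. selling_wt v) = (\<Sum>v\<in>N. selling_wt v)"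
    unfolding N2_def by (subst sum.reindex) (auto simp: inj_on_def selling_wt_def intro!: sum.cong)
  have f: "finite N1" "finite N2" using fN by (simp_all add: N1_def N2_def)
  have "(\<Sum>v\<in>selling_triples D. selling_wt v) = (\<Sum>v\<in>par_triples D. selling_wt v)
      + ((\<Sum>v\<in>N. selling_wt v) + ((\<Sum>v\<in>N1. selling_wt v) + (\<Sum>v\<in>N2. selling_wt v)))"
    unfolding C using f fN finite_par_triples[OF D(1)] d by (simp add: sum.union_disjoint)
  also have "\<dots> = 4 * (\<Sum>v\<in>par_triples D. selling_wt v)"
    unfolding w1 w2 using sum_mixed_triples[OF D] by (simp add: N_def)
  finally show ?thesis
    using card_three_squares[OF D(1)] hurwitz_class_number_selling[of D] D D4 by (simp add: par_triples_def)
qed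

subsection \<open>The fourth power of the theta series\<close>

lemma has_sum_times_complex:
  fixes f :: "'a \<Rightarrow> complex" and g :: "'b \<Rightarrow> complex"
  assumes "(\<lambda>x. norm (f x)) summable_on A" "(\<lambda>x. norm (g x)) summable_on B"
  shows "(\<lambda>z. norm (case z of (x, y) \<Rightarrow> f x * g y)) summable_on A \<times> B"
    and "((\<lambda>(x, y). f x * g y) has_sum infsum f A * infsum g B) (A \<times> B)"
proof -
  show *: "(\<lambda>z. norm (case z of (x, y) \<Rightarrow> f x * g y)) summable_on A \<times> B"
    using abs_summable_on_times[OF assms] by (simp add: case_prod_unfold)
  have S: "(\<lambda>(x, y). f x * g y) summable_on A \<times> B" by (rule abs_summable_summable[OF *])
  have "infsum (\<lambda>(x, y). f x * g y) (A \<times> B) = infsum (\<lambda>x. infsum (\<lambda>y. f x * g y) B) A"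
    using infsum_Sigma'_banach[of "\<lambda>x y. f x * g y" A "\<lambda>_. B"] S by simp
  also have "\<dots> = infsum f A * infsum g B"
    by (simp add: infsum_cmult_right' infsum_cmult_left')
  finally show "((\<lambda>(x, y). f x * g y) has_sum infsum f A * infsum g B) (A \<times> B)"
    using has_sum_infsum[OF S] by simp
qed

lemma summable_theta_terms:
  fixes q w :: complex
  assumes "q \<noteq> 0" "norm q < 1" "w \<noteq> 0"
  shows "(\<lambda>k::int. norm ((-1) powi k * q powi (k * (k + 1)) * w powi k)) summable_on UNIV"
proof -
  define \<rho> where "\<rho> = norm q"
  define A where "A = norm w"
  interpret nome \<rho> using assms by unfold_locales (auto simp: \<rho>_def)
  have A: "A > 0" using assms by (simp add: A_def)
  \<comment> \<open>A power of \<open>\<rho>\<close> below both \<open>A\<close> and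
    \<open>1 / A\<close> bounds \<open>A powi k\<close>, for either sign of \<open>k\<close>, by a
    power of \<open>\<rho>\<close> with exponent linear in \<open>|k|\<close>; the quadratic
    exponent outweighs it.\<close>
  obtain m where m: "\<rho> ^ m < min A (1 / A)"
    using real_arch_pow_inv[of "min A (1 / A)" \<rho>] A Q_less_1 by auto
  have Am: "A \<le> 1 / \<rho> ^ m" "1 / A \<le> 1 / \<rho> ^ m"
    using m A zero_less_power[OF Q_pos, of m] by (auto simp: field_simps)
  have term_eq: "norm ((-1) powi k * q powi (k * (k + 1)) * w powi k) = \<rho> powi (k * (k + 1)) * A powi k" for k
    by (simp add: norm_mult norm_power_int \<rho>_def A_def)
  have P: "(1 / \<rho> ^ m) ^ j = \<rho> powi (- (int m * int j))" for j
  proof -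
    have "\<rho> powi (- int (m * j)) = 1 / \<rho> ^ (m * j)"
      by (simp only: power_int_minus power_int_of_nat divide_inverse mult_1)
    then show ?thesis by (simp add: power_mult power_one_over)
  qed
  have Ak: "A powi k \<le> \<rho> powi (- (int m * \<bar>k\<bar>))" for k
  proof (cases "k \<ge> 0")
    case True
    have "A ^ nat k \<le> (1 / \<rho> ^ m) ^ nat k" using Am A by (intro power_mono) auto
    then show ?thesis unfolding P using True by (simp add: power_int_def)
  next
    case False
    have "(1 / A) ^ nat (- k) \<le> (1 / \<rho> ^ m) ^ nat (- k)" using Am A by (intro power_mono) auto
    moreover have "A powi k = (1 / A) ^ nat (- k)" using False by (simp add: power_int_def divide_inverse)
    moreover have "int (nat (- k)) = \<bar>k\<bar>" using False by simp
    ultimately show ?thesis unfolding P by (simp only:)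
  qed
  \<comment> \<open>With \<open>u = |k|\<close> and \<open>c = m + 2\<close>, the required bound on
    the exponent reduces to \<open>u^2 - c * u + K \<ge> 0\<close>, which holds for
    \<open>K = c^2\<close>.\<close>
  define K where "K = (int m + 2)\<^sup>2"
  show ?thesis
    unfolding term_eq
  proof (rule summable_geom_bdI[of _ "1 / \<rho> powi K"])
    fix k :: int
    have ex: "k * (k + 1) + - (int m * \<bar>k\<bar>) \<ge> \<bar>k\<bar> - K"
    proof -
      define u c where "u = \<bar>k\<bar>" and "c = int m + 2"
      have u: "u \<ge> 0" "c \<ge> 2" by (auto simp: u_def c_def)
      have "u\<^sup>2 - c * u + c\<^sup>2 \<ge> 0"
      proof (cases "u \<le> c")
        case True
        then have "c * u \<le> c * c" using u by (intro mult_left_mono) auto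
        then show ?thesis using zero_le_square[of u] unfolding power2_eq_square by linarith
      next
        case False
        then have "c * u \<le> u * u" using u by (intro mult_right_mono) auto
        then show ?thesis using zero_le_square[of c] unfolding power2_eq_square by linarith
      qed
      moreover have "k * (k + 1) \<ge> u\<^sup>2 - u"
      proof -
        have "k * (k + 1) = u\<^sup>2 + k" by (simp add: u_def power2_eq_square algebra_simps)
        then show ?thesis by (simp add: u_def)
      qed
      ultimately show ?thesis unfolding K_def u_def[symmetric] c_def[symmetric]
        by (simp add: c_def algebra_simps)
    qed
    have "\<rho> powi (k * (k + 1)) * A powi k \<le> \<rho> powi (k * (k + 1)) * \<rho> powi (- (int m * \<bar>k\<bar>))"
      by (rule mult_left_mono[OF Ak]) simp
    also have "\<dots> = \<rho> powi (k * (k + 1) + - (int m * \<bar>k\<bar>))" by (rule powi_add[symmetric])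
    also have "\<dots> \<le> \<rho> powi (\<bar>k\<bar> - K)"
      using ex Q_pos Q_less_1 by (intro power_int_decreasing) auto
    also have "\<dots> = \<rho> ^ nat \<bar>k\<bar> / \<rho> powi K" by (simp add: powi_diff powi_nat_abs)
    also have "\<dots> \<le> geom_bd \<rho> k / \<rho> powi K" by (rule divide_right_mono[OF pow_le_geom_bd]) simp
    finally show "\<bar>\<rho> powi (k * (k + 1)) * A powi k\<bar> \<le> 1 / \<rho> powi K * geom_bd \<rho> k"
      using A by (simp add: abs_mult)
  qed
qed

section \<open>Quadruples indexing the fourth power of the theta series\<close>

type_synonym int4 = "(int \<times> int) \<times> (int \<times> int)"

text \<open>For the odd numbers \<open>2 * j + 1\<close>, \<open>2 * k + 1\<close>,
  \<open>2 * l + 1\<close>, \<open>2 * m + 1\<close>, the square sum is \<open>4 * theta_deg\<close>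
  and the sum is \<open>2 * theta_tr\<close>. The constants \<open>1\<close> and \<open>2\<close>
  come from the fourth power \<open>q * \<zeta>^4\<close> of the prefactors.\<close>

definition theta_deg :: "int4 \<Rightarrow> int" where
  "theta_deg = (\<lambda>((j, k), (l, m)). 1 + j * (j + 1) + k * (k + 1) + l * (l + 1) + m * (m + 1))"

definition theta_tr :: "int4 \<Rightarrow> int" where
  "theta_tr = (\<lambda>((j, k), (l, m)). 2 + j + k + l + m)"

lemma pronic_ge: "\<bar>k\<bar> - 1 \<le> k * (k + 1)" "(0 :: int) \<le> k * (k + 1)"
proof -
  have "k * (k + 1) = k\<^sup>2 + k" by (simp add: power2_eq_square algebra_simps)
  moreover have "\<bar>k\<bar> \<le> k\<^sup>2" by (rule abs_le_square_int)
  moreover have "\<bar>k + 1\<bar> \<le> (k + 1)\<^sup>2" by (rule abs_le_square_int)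
  moreover have "(k + 1)\<^sup>2 = k\<^sup>2 + 2 * k + 1" by (simp add: power2_eq_square algebra_simps)
  ultimately show "\<bar>k\<bar> - 1 \<le> k * (k + 1)" "0 \<le> k * (k + 1)" by linarith+
qed

lemma finite_theta_deg: "finite {v. theta_deg v = M}"
proof (rule finite_subset)
  show "{v. theta_deg v = M} \<subseteq> ({- M..M} \<times> {- M..M}) \<times> ({- M..M} \<times> {- M..M})"
  proof
    fix v assume v: "v \<in> {v. theta_deg v = M}"
    obtain j k l m where e: "v = ((j, k), (l, m))" by (metis surj_pair)
    have s: "1 + j * (j + 1) + k * (k + 1) + l * (l + 1) + m * (m + 1) = M"
      using v by (simp add: e theta_deg_def)
    have "\<bar>j\<bar> \<le> M" "\<bar>k\<bar> \<le> M" "\<bar>l\<bar> \<le> M" "\<bar>m\<bar> \<le> M"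
      using s pronic_ge[of j] pronic_ge[of k] pronic_ge[of l] pronic_ge[of m] by linarith+
    then show "v \<in> ({- M..M} \<times> {- M..M}) \<times> ({- M..M} \<times> {- M..M})" by (auto simp: e)
  qed
qed simp

text \<open>Products of consecutive integers are even; this is the origin of the restriction to odd
  \<open>n\<close>.\<close>

lemma theta_deg_odd: "odd (theta_deg v)"
proof -
  obtain j k l m where "v = ((j, k), (l, m))" by (metis surj_pair)
  then show ?thesis by (simp add: theta_deg_def)
qed

lemma theta_deg_pos: "theta_deg v > 0"
proof -
  obtain j k l m where e: "v = ((j, k), (l, m))" by (metis surj_pair)
  show ?thesis using pronic_ge(2)[of j] pronic_ge(2)[of k] pronic_ge(2)[of l] pronic_ge(2)[of m]
    unfolding e theta_deg_def by simp
qed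

lemma jacobi_theta_fourth_power:
  fixes \<tau> z q \<zeta> :: complex
  assumes "Im \<tau> > 0" and q: "q = exp (2 * pi * \<i> * \<tau>)" and \<zeta>: "\<zeta> = exp (2 * pi * \<i> * z)"
  shows "((\<lambda>v. (-1) powi theta_tr v * \<zeta> powi (2 * theta_tr v) * q ^ nat (theta_deg v))
    has_sum jacobi_theta_odd (2 * \<tau>) (2 * z) ^ 4) UNIV"
proof -
  define T where "T k = (-1) powi k * q powi (k * (k + 1)) * (\<zeta>\<^sup>2) powi k" for k
  have q0: "q \<noteq> 0" "\<zeta> \<noteq> 0" by (auto simp: q \<zeta>)
  have qn: "norm q < 1" using assms(1) by (simp add: q)
  have ST: "(\<lambda>k. norm (T k)) summable_on UNIV"
    unfolding T_def by (rule summable_theta_terms) (use q0 qn in auto)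
  define S where "S = infsum T UNIV"
  have e1: "exp (2 * pi * \<i> * (2 * \<tau>)) = q\<^sup>2" "exp (2 * pi * \<i> * (2 * z)) = \<zeta>\<^sup>2"
    by (simp_all add: q \<zeta> exp_double[symmetric] algebra_simps)
  have T_eq: "(-1) powi k * (q\<^sup>2) powi (k * (k + 1) div 2) * (\<zeta>\<^sup>2) powi k = T k" for k
  proof -
    have "even (k * (k + 1))" by simp
    then obtain j where j: "k * (k + 1) = 2 * j" using evenE by blast
    have "(q\<^sup>2) powi j = q powi (2 * j)" by (simp add: power_int_mult)
    then show ?thesis unfolding T_def j by simp
  qed
  have J: "jacobi_theta_odd (2 * \<tau>) (2 * z)
      = exp (2 * pi * \<i> * (2 * \<tau>) / 8) * exp (pi * \<i> * (2 * z)) * S"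
    unfolding jacobi_theta_odd_def e1 T_eq S_def by simp
  have "exp (2 * pi * \<i> * (2 * \<tau>) / 8) ^ 4 = q" "exp (pi * \<i> * (2 * z)) = \<zeta>"
    by (simp_all add: q \<zeta> exp_of_nat_mult[symmetric] algebra_simps)
  then have J4: "jacobi_theta_odd (2 * \<tau>) (2 * z) ^ 4 = q * \<zeta> ^ 4 * (S\<^sup>2 * S\<^sup>2)"
    unfolding J power_mult_distrib by (simp add: power_add[symmetric] flip: power_mult)
  have F2: "(\<lambda>v. norm (case v of (j, k) \<Rightarrow> T j * T k)) summable_on UNIV \<times> UNIV"
      "((\<lambda>(j, k). T j * T k) has_sum S * S) (UNIV \<times> UNIV)"
    using has_sum_times_complex[OF ST ST] by (simp_all add: S_def)
  have "((\<lambda>(u, v). (case u of (j, k) \<Rightarrow> T j * T k) * (case v of (l, m) \<Rightarrow> T l * T m))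
      has_sum infsum (\<lambda>(j, k). T j * T k) (UNIV \<times> UNIV) * infsum (\<lambda>(j, k). T j * T k) (UNIV \<times> UNIV))
      ((UNIV \<times> UNIV) \<times> (UNIV \<times> UNIV))"
    by (rule has_sum_times_complex(2)[OF F2(1) F2(1)])
  then have "((\<lambda>(u, v). (case u of (j, k) \<Rightarrow> T j * T k) * (case v of (l, m) \<Rightarrow> T l * T m))
      has_sum (S\<^sup>2 * S\<^sup>2)) UNIV"
    using infsumI[OF F2(2)] by (simp add: power2_eq_square)
  from has_sum_cmult_right[OF this, of "q * \<zeta> ^ 4"]
  have "((\<lambda>w. q * \<zeta> ^ 4 * (case w of (u, v) \<Rightarrow> (case u of (j, k) \<Rightarrow> T j * T k) * (case v of (l, m) \<Rightarrow> T l * T m)))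
      has_sum jacobi_theta_odd (2 * \<tau>) (2 * z) ^ 4) UNIV"
    unfolding J4 .
  moreover have "q * \<zeta> ^ 4 * (case w of (u, v) \<Rightarrow> (case u of (j, k) \<Rightarrow> T j * T k) * (case v of (l, m) \<Rightarrow> T l * T m))
      = (-1) powi theta_tr w * \<zeta> powi (2 * theta_tr w) * q ^ nat (theta_deg w)" for w
  proof -
    obtain j k l m where w: "w = ((j, k), (l, m))" by (metis surj_pair)
    have Tk: "T k = (-1) powi k * q powi (k * (k + 1)) * \<zeta> powi (2 * k)" for k
      unfolding T_def by (simp add: power_int_mult)
    have pq: "q powi (a + b) = q powi a * q powi b" for a b using q0 by (simp add: power_int_add)
    have pz: "\<zeta> powi (a + b) = \<zeta> powi a * \<zeta> powi b" for a b using q0 by (simp add: power_int_add)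
    have pm: "(-1 :: complex) powi (a + b) = (-1) powi a * (-1) powi b" for a b by (simp add: power_int_add)
    have d: "q ^ nat (theta_deg w) = q powi (1 + j * (j + 1) + k * (k + 1) + l * (l + 1) + m * (m + 1))"
      using theta_deg_pos[of w] by (simp add: w theta_deg_def power_int_def)
    have r: "(-1 :: complex) powi theta_tr w = (-1) powi (j + k + l + m)"
      unfolding w theta_tr_def by (simp add: pm)
    have r2: "\<zeta> powi (2 * theta_tr w) = \<zeta> powi (4 + 2 * j + 2 * k + 2 * l + 2 * m)"
      unfolding w theta_tr_def by (simp add: algebra_simps)
    show ?thesis
      unfolding d r r2 unfolding w pq pz pm by (simp add: Tk mult_ac)
  qed
  ultimately show ?thesis by simp
qed

lemma square_mod_4_int: "(x :: int)\<^sup>2 mod 4 = (if even x then 0 else 1)"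
proof (cases "even x")
  case True
  then obtain y where "x = 2 * y" using evenE by blast
  then show ?thesis by (simp add: power2_eq_square)
next
  case False
  then obtain y where y: "x = 2 * y + 1" using oddE by blast
  have "x\<^sup>2 = 4 * (y\<^sup>2 + y) + 1" unfolding y by algebra
  then show ?thesis using False by presburger
qed

lemma three_squares_parity:
  assumes "(b, c, d) \<in> three_squares D"
  shows "D mod 4 = 0 \<Longrightarrow> even b \<and> even c \<and> even d"
    and "D mod 4 = 3 \<Longrightarrow> odd b \<and> odd c \<and> odd d"
proof -
  have D: "b\<^sup>2 + c\<^sup>2 + d\<^sup>2 = D" using assms by (simp add: three_squares_def)
  define x y z where "x = b\<^sup>2" and "y = c\<^sup>2" and "z = d\<^sup>2"
  have m: "x mod 4 = (if even b then 0 else 1)" "y mod 4 = (if even c then 0 else 1)"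
    "z mod 4 = (if even d then 0 else 1)" by (simp_all add: x_def y_def z_def square_mod_4_int)
  have D': "x + y + z = D" using D by (simp add: x_def y_def z_def)
  show "even b \<and> even c \<and> even d" if "D mod 4 = 0"
    using m D' that by (cases "even b"; cases "even c"; cases "even d"; simp; presburger)
  show "odd b \<and> odd c \<and> odd d" if "D mod 4 = 3"
    using m D' that by (cases "even b"; cases "even c"; cases "even d"; simp; presburger)
qed

section \<open>The Hadamard substitution and the two parities of \<open>r\<close>\<close>

definition theta_fibre :: "int \<Rightarrow> int \<Rightarrow> int4 set" where
  "theta_fibre n r = {v. theta_deg v = n \<and> theta_tr v = r}"

text \<open>Half of the Hadamard matrix of order 4, applied to \<open>(2 j + 1, 2 k + 1, 2 l + 1, 2 m + 1)\<close>.\<close>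

lemma card_theta_fibre:
  "card (theta_fibre n r) = card {(b, c, d) \<in> three_squares (4 * n - r\<^sup>2).
     (even b \<longleftrightarrow> even c) \<and> (even c \<longleftrightarrow> even d) \<and> 4 dvd (r - 2 + b + c + d)}"
proof (rule bij_betw_same_card)
  define R where "R = {(b, c, d) \<in> three_squares (4 * n - r\<^sup>2).
     (even b \<longleftrightarrow> even c) \<and> (even c \<longleftrightarrow> even d) \<and> 4 dvd (r - 2 + b + c + d)}"
  define f where "f = (\<lambda>((j, k), (l, m)). (j + k - l - m, j - k + l - m, j - k - l + m) :: int \<times> int \<times> int)"
  \<comment> \<open>The half Hadamard matrix is an involution, so \<open>g\<close> applies it again,
    to \<open>(r, b, c, d)\<close>; subtracting \<open>2\<close> and dividing by \<open>4\<close>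
    passes from \<open>2 * j + 1\<close> back to \<open>j\<close>. Integrality of the first entry is
    the divisibility condition in \<open>R\<close>, and equal parity of \<open>b\<close>,
    \<open>c\<close>, \<open>d\<close> makes the other entries integral.\<close>
  define g where "g = (\<lambda>(b, c, d). (((r - 2 + b + c + d) div 4, (r - 2 + b - c - d) div 4),
    ((r - 2 - b + c - d) div 4, (r - 2 - b - c + d) div 4)))"
  have "bij_betw f (theta_fibre n r) R"
  proof (rule bij_betwI[of _ _ _ g])
    show "f \<in> theta_fibre n r \<rightarrow> R"
    proof
      fix v assume v: "v \<in> theta_fibre n r"
      obtain j k l m where e: "v = ((j, k), (l, m))" by (metis surj_pair)
      have h: "1 + j * (j + 1) + k * (k + 1) + l * (l + 1) + m * (m + 1) = n" "2 + j + k + l + m = r"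
        using v by (auto simp: e theta_fibre_def theta_deg_def theta_tr_def)
      have "(j + k - l - m)\<^sup>2 + (j - k + l - m)\<^sup>2 + (j - k - l + m)\<^sup>2 = 4 * n - r\<^sup>2"
        unfolding h[symmetric] by algebra
      moreover have "4 dvd (r - 2 + (j + k - l - m) + (j - k + l - m) + (j - k - l + m))"
      proof -
        have "r - 2 + (j + k - l - m) + (j - k + l - m) + (j - k - l + m) = 4 * j"
          unfolding h(2)[symmetric] by simp
        then show ?thesis by (rule dvdI)
      qed
      moreover have "even (j + k - l - m) \<longleftrightarrow> even (j - k + l - m)" "even (j - k + l - m) \<longleftrightarrow> even (j - k - l + m)"
        by presburger+
      ultimately show "f v \<in> R" unfolding R_def f_def e three_squares_def mem_Collect_eq prod.case by blast
    qed
    show "g (f v) = v" if "v \<in> theta_fibre n r" for v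
    proof -
      obtain j k l m where e: "v = ((j, k), (l, m))" by (metis surj_pair)
      have r: "r = 2 + j + k + l + m"
        using that by (auto simp: e theta_fibre_def theta_tr_def)
      show ?thesis unfolding f_def g_def e r by (simp add: algebra_simps)
    qed
    have R: "\<exists>j k l m. r - 2 + b + c + d = 4 * j \<and> r - 2 + b - c - d = 4 * k \<and> r - 2 - b + c - d = 4 * l
        \<and> r - 2 - b - c + d = 4 * m" if "(b, c, d) \<in> R" for b c d
    proof -
      have p: "even b \<longleftrightarrow> even c" "even c \<longleftrightarrow> even d" "4 dvd (r - 2 + b + c + d)" using that by (auto simp: R_def)
      obtain j where j: "r - 2 + b + c + d = 4 * j" using p(3) by (auto elim: dvdE)
      have "even (c + d)" "even (b + d)" "even (b + c)" using p by auto
      then obtain x y w where "c + d = 2 * x" "b + d = 2 * y" "b + c = 2 * w" using evenE by metis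
      then have "r - 2 + b - c - d = 4 * (j - x)" "r - 2 - b + c - d = 4 * (j - y)" "r - 2 - b - c + d = 4 * (j - w)"
        using j by (simp_all add: algebra_simps)
      then show ?thesis using j by blast
    qed
    have fg: "f (g t) = t \<and> g t \<in> theta_fibre n r" if t: "t \<in> R" for t
    proof -
      obtain b c d where e: "t = (b, c, d)" by (metis prod_cases3)
      obtain j k l m where jk: "r - 2 + b + c + d = 4 * j" "r - 2 + b - c - d = 4 * k" "r - 2 - b + c - d = 4 * l"
        "r - 2 - b - c + d = 4 * m" using R[OF t[unfolded e]] by blast
      have gt: "g t = ((j, k), (l, m))" unfolding g_def e by (simp add: jk)
      have bcd: "b = j + k - l - m" "c = j - k + l - m" "d = j - k - l + m" "r = 2 + j + k + l + m"
        using jk by linarith+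
      have "b\<^sup>2 + c\<^sup>2 + d\<^sup>2 = 4 * n - r\<^sup>2" using t by (auto simp: e R_def three_squares_def)
      moreover have "b\<^sup>2 + c\<^sup>2 + d\<^sup>2 + r\<^sup>2 = 4 * (1 + j * (j + 1) + k * (k + 1) + l * (l + 1) + m * (m + 1))"
        unfolding bcd by algebra
      ultimately have "1 + j * (j + 1) + k * (k + 1) + l * (l + 1) + m * (m + 1) = n" by simp
      then show ?thesis unfolding gt using bcd
        by (simp add: f_def e theta_fibre_def theta_deg_def theta_tr_def)
    qed
    show "g \<in> R \<rightarrow> theta_fibre n r" using fg by blast
    show "f (g t) = t" if "t \<in> R" for t using fg[OF that] by blast
  qed
  then show "bij_betw f (theta_fibre n r) {(b, c, d) \<in> three_squares (4 * n - r\<^sup>2).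
     (even b \<longleftrightarrow> even c) \<and> (even c \<longleftrightarrow> even d) \<and> 4 dvd (r - 2 + b + c + d)}"
    unfolding R_def .
qed

text \<open>Here \<open>b\<close>, \<open>c\<close>, \<open>d\<close> are even, and after halving,
  the square sum of the four coordinates is the odd number \<open>n\<close>, so the sum of the
  halves is odd too. The congruence modulo 4 thus holds for every representation.\<close>

lemma card_theta_fibre_even:
  assumes "odd n" "even r" "4 * n - r\<^sup>2 \<ge> 0"
  shows "real (card (theta_fibre n r)) = 12 * hurwitz_class_number2 (4 * n - r\<^sup>2)"
proof -
  define D where "D = 4 * n - r\<^sup>2"
  obtain s where s: "r = 2 * s" using assms(2) evenE by blast
  have D4: "D = 4 * (n - s\<^sup>2)" unfolding D_def s by (simp add: power2_eq_square)
  then have D0: "D mod 4 = 0" by simp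
  have "{(b, c, d) \<in> three_squares D. (even b \<longleftrightarrow> even c) \<and> (even c \<longleftrightarrow> even d) \<and> 4 dvd (r - 2 + b + c + d)}
      = three_squares D"
  proof -
    have "(even b \<longleftrightarrow> even c) \<and> (even c \<longleftrightarrow> even d) \<and> 4 dvd (r - 2 + b + c + d)"
      if t: "(b, c, d) \<in> three_squares D" for b c d
    proof -
      have ev: "even b" "even c" "even d" using three_squares_parity(1)[OF t D0] by auto
      then obtain b' c' d' where e: "b = 2 * b'" "c = 2 * c'" "d = 2 * d'" using evenE by metis
      have "4 * (b'\<^sup>2 + c'\<^sup>2 + d'\<^sup>2) = 4 * (n - s\<^sup>2)"
        using t D4 by (simp add: three_squares_def e power_mult_distrib)
      then have "s\<^sup>2 + b'\<^sup>2 + c'\<^sup>2 + d'\<^sup>2 = n" by simp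
      then have "odd (s\<^sup>2 + b'\<^sup>2 + c'\<^sup>2 + d'\<^sup>2)" using assms(1) by simp
      then have "odd (s + b' + c' + d')" by simp
      then have "even (s - 1 + b' + c' + d')" by presburger
      then obtain w where "s - 1 + b' + c' + d' = 2 * w" using evenE by blast
      then have "r - 2 + b + c + d = 4 * w" unfolding e s by simp
      then show ?thesis using ev by simp
    qed
    then show ?thesis by blast
  qed
  then have card: "card (theta_fibre n r) = card (three_squares D)"
    using card_theta_fibre[of n r] by (simp add: D_def)
  show ?thesis
  proof (cases "D = 0")
    \<comment> \<open>The value \<open>H(0) = - 1 / 12\<close> gives
      \<open>12 * (H(0) - 2 * H(0)) = 1\<close>, matching the single representation of
      \<open>0\<close>.\<close>
    case True
    then show ?thesis
      using card by (simp add: D_def[symmetric] three_squares_0 hurwitz_class_number2_def hurwitz_class_number_def)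
  next
    case False
    then have "D > 0" using assms(3) by (simp add: D_def)
    then show ?thesis
      unfolding D_def[symmetric] card using card_three_squares_hurwitz[of D] D0 by simp
  qed
qed

text \<open>Now \<open>b\<close>, \<open>c\<close>, \<open>d\<close> are odd, and reversing the sign
  of \<open>d\<close> changes \<open>r - 2 + b + c + d\<close>, an even number, by 2 modulo 4.
  Exactly half of the \<open>24 H(D)\<close> representations satisfy the congruence.\<close>

lemma card_theta_fibre_odd:
  assumes "odd n" "odd r" "4 * n - r\<^sup>2 \<ge> 0"
  shows "real (card (theta_fibre n r)) = 12 * hurwitz_class_number (4 * n - r\<^sup>2)"
proof -
  define D where "D = 4 * n - r\<^sup>2"
  obtain s where s: "r = 2 * s + 1" using assms(2) oddE by blast
  obtain m where m: "n = 2 * m + 1" using assms(1) oddE by blast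
  obtain w where w: "s\<^sup>2 + s = 2 * w"
  proof -
    have "even (s\<^sup>2 + s)" by simp
    then show thesis using that evenE by blast
  qed
  have "D = 8 * m + 3 - 4 * (s\<^sup>2 + s)" unfolding D_def s m by algebra
  then have D: "D = 8 * (m - w) + 3" unfolding w by simp
  have D8: "D mod 8 = 3" "D mod 4 = 3" unfolding D by presburger+
  have Dpos: "D > 0" using assms(3) D8 by (cases "D = 0") (auto simp: D_def)
  define E where "E = {(b, c, d) \<in> three_squares D. 4 dvd (r - 2 + b + c + d)}"
  define E' where "E' = {(b, c, d) \<in> three_squares D. \<not> 4 dvd (r - 2 + b + c + d)}"
  have o: "odd b \<and> odd c \<and> odd d" if "(b, c, d) \<in> three_squares D" for b c d
    by (rule three_squares_parity(2)[OF that D8(2)])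
  have "{(b, c, d) \<in> three_squares D. (even b \<longleftrightarrow> even c) \<and> (even c \<longleftrightarrow> even d) \<and> 4 dvd (r - 2 + b + c + d)} = E"
    unfolding E_def using o by blast
  then have card: "card (theta_fibre n r) = card E"
    using card_theta_fibre[of n r] by (simp add: D_def)
  have flip: "4 dvd (r - 2 + b + c - d) \<longleftrightarrow> \<not> 4 dvd (r - 2 + b + c + d)" if t: "(b, c, d) \<in> three_squares D" for b c d
    using o[OF t] assms(2) by presburger
  have "bij_betw (\<lambda>(b, c, d). (b, c, - d)) E E'"
  proof (rule bij_betwI[of _ _ _ "\<lambda>(b, c, d). (b, c, - d)"])
    show "(\<lambda>(b, c, d). (b, c, - d)) \<in> E \<rightarrow> E'"
      using flip by (auto simp: E_def E'_def three_squares_def)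
    show "(\<lambda>(b, c, d). (b, c, - d)) \<in> E' \<rightarrow> E"
      using flip by (auto simp: E_def E'_def three_squares_def)
  qed auto
  then have "card E' = card E" by (rule bij_betw_same_card[symmetric])
  moreover have "card (three_squares D) = card E + card E'"
  proof -
    have U: "three_squares D = E \<union> E'" by (auto simp: E_def E'_def)
    have "finite E" "finite E'"
      by (rule finite_subset[OF _ finite_three_squares[of D]], auto simp: E_def E'_def)+
    moreover have "E \<inter> E' = {}" by (auto simp: E_def E'_def)
    ultimately show ?thesis unfolding U by (rule card_Un_disjoint)
  qed
  ultimately show ?thesis
    unfolding D_def[symmetric] card using card_three_squares_3_mod_8[OF Dpos D8(1)] by simp
qed

lemma theta_tr_bound: "theta_tr v \<in> {r. 4 * theta_deg v - r\<^sup>2 \<ge> 0}"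
proof -
  obtain j k l m where e: "v = ((j, k), (l, m))" by (metis surj_pair)
  have "4 * theta_deg v - (theta_tr v)\<^sup>2 = (j + k - l - m)\<^sup>2 + (j - k + l - m)\<^sup>2 + (j - k - l + m)\<^sup>2"
    unfolding e theta_deg_def theta_tr_def prod.case by algebra
  moreover have "0 \<le> (j + k - l - m)\<^sup>2 + (j - k + l - m)\<^sup>2 + (j - k - l + m)\<^sup>2" by simp
  ultimately have "0 \<le> 4 * theta_deg v - (theta_tr v)\<^sup>2" by linarith
  then show ?thesis by simp
qed

lemma finite_disc_range: "finite {r::int. 4 * n - r\<^sup>2 \<ge> 0}"
proof (rule finite_subset)
  show "{r::int. 4 * n - r\<^sup>2 \<ge> 0} \<subseteq> {- (4 * n)..4 * n}"
  proof
    fix r assume "r \<in> {r::int. 4 * n - r\<^sup>2 \<ge> 0}"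
    then show "r \<in> {- (4 * n)..4 * n}" using abs_le_square_int[of r] by auto
  qed
qed simp

theorem theorem1p4:
  fixes \<tau> z q \<zeta> :: complex
  assumes "Im \<tau> > 0"
    and "q = exp (2 * pi * \<i> * \<tau>)"
    and "\<zeta> = exp (2 * pi * \<i> * z)"
  shows "((\<lambda>n::nat.
      ((\<Sum>r | even r \<and> 4 * int n - r\<^sup>2 \<ge> 0.
          12 * complex_of_real (hurwitz_class_number2 (4 * int n - r\<^sup>2)) * \<zeta> powi (2 * r))
       - (\<Sum>r | odd r \<and> 4 * int n - r\<^sup>2 \<ge> 0.
          12 * complex_of_real (hurwitz_class_number (4 * int n - r\<^sup>2)) * \<zeta> powi (2 * r)))
      * q ^ n)
    has_sum jacobi_theta_odd (2 * \<tau>) (2 * z) ^ 4) {n. odd n}"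
proof -
  define G where "G v = (-1) powi theta_tr v * \<zeta> powi (2 * theta_tr v) * q ^ nat (theta_deg v)" for v
  have fib: "{v \<in> UNIV. nat (theta_deg v) = n} = {v. theta_deg v = int n}" for n
    using theta_deg_pos by (auto simp: less_imp_le)
  have fin: "finite {v \<in> UNIV. nat (theta_deg v) = n}" for n
    unfolding fib by (rule finite_theta_deg)
  have "(G has_sum jacobi_theta_odd (2 * \<tau>) (2 * z) ^ 4) UNIV"
    unfolding G_def by (rule jacobi_theta_fourth_power[OF assms])
  from has_sum_fibres[OF this fin]
  have "((\<lambda>n. \<Sum>v | v \<in> UNIV \<and> nat (theta_deg v) = n. G v) has_sum jacobi_theta_odd (2 * \<tau>) (2 * z) ^ 4) UNIV" .
  then show ?thesis
  proof (rule iffD1[OF has_sum_cong_neutral, rotated -1])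
    fix n :: nat assume "n \<in> UNIV - {n. odd n}"
    then have E: "{v. theta_deg v = int n} = {}" using theta_deg_odd by (metis (mono_tags, lifting) DiffE Collect_empty_eq even_of_nat mem_Collect_eq)
    show "(\<Sum>v | v \<in> UNIV \<and> nat (theta_deg v) = n. G v) = 0" unfolding fib E by simp
  next
    fix n :: nat assume "n \<in> UNIV \<inter> {n. odd n}"
    then have n: "odd (int n)" by simp
    define R where "R = {r::int. 4 * int n - r\<^sup>2 \<ge> 0}"
    define h where "h r = of_nat (card (theta_fibre (int n) r)) * ((-1) powi r * \<zeta> powi (2 * r))" for r
    have finR: "finite R" unfolding R_def by (rule finite_disc_range)
    have "theta_tr v \<in> R" if "theta_deg v = int n" for v
      using theta_tr_bound[of v] unfolding R_def that .
    then have sub: "theta_tr ` {v. theta_deg v = int n} \<subseteq> R" by blast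
    have "(\<Sum>v | theta_deg v = int n. G v) = (\<Sum>r\<in>R. \<Sum>v | v \<in> {v. theta_deg v = int n} \<and> theta_tr v = r. G v)"
      by (rule sum.group[symmetric, OF finite_theta_deg finR sub])
    also have "\<dots> = (\<Sum>r\<in>R. h r * q ^ n)"
    proof (rule sum.cong)
      fix r
      have "(\<Sum>v | v \<in> {v. theta_deg v = int n} \<and> theta_tr v = r. G v)
          = (\<Sum>v\<in>theta_fibre (int n) r. (-1) powi r * \<zeta> powi (2 * r) * q ^ n)"
        by (rule sum.cong) (auto simp: theta_fibre_def G_def)
      then show "(\<Sum>v | v \<in> {v. theta_deg v = int n} \<and> theta_tr v = r. G v) = h r * q ^ n"
        by (simp add: h_def)
    qed simp
    also have "\<dots> = (\<Sum>r\<in>R. h r) * q ^ n" by (simp add: sum_distrib_right)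
    also have "(\<Sum>r\<in>R. h r) = (\<Sum>r\<in>{r \<in> R. even r}. h r) + (\<Sum>r\<in>{r \<in> R. odd r}. h r)"
    proof -
      have "R = {r \<in> R. even r} \<union> {r \<in> R. odd r}" by auto
      then show ?thesis using sum.union_disjoint[of "{r \<in> R. even r}" "{r \<in> R. odd r}" h] finR by auto
    qed
    also have "(\<Sum>r\<in>{r \<in> R. even r}. h r) = (\<Sum>r | even r \<and> 4 * int n - r\<^sup>2 \<ge> 0.
          12 * complex_of_real (hurwitz_class_number2 (4 * int n - r\<^sup>2)) * \<zeta> powi (2 * r))"
    proof (rule sum.cong)
      fix r assume "r \<in> {r. even r \<and> 4 * int n - r\<^sup>2 \<ge> 0}"
      then have r: "even r" "4 * int n - r\<^sup>2 \<ge> 0" by auto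
      have "of_nat (card (theta_fibre (int n) r)) = complex_of_real (real (card (theta_fibre (int n) r)))" by simp
      also have "\<dots> = 12 * complex_of_real (hurwitz_class_number2 (4 * int n - r\<^sup>2))"
        unfolding card_theta_fibre_even[OF n r] by simp
      finally show "h r = 12 * complex_of_real (hurwitz_class_number2 (4 * int n - r\<^sup>2)) * \<zeta> powi (2 * r)"
        unfolding h_def using r(1) by simp
    qed (auto simp: R_def)
    also have "(\<Sum>r\<in>{r \<in> R. odd r}. h r) = (\<Sum>r | odd r \<and> 4 * int n - r\<^sup>2 \<ge> 0.
          - (12 * complex_of_real (hurwitz_class_number (4 * int n - r\<^sup>2)) * \<zeta> powi (2 * r)))"
    proof (rule sum.cong)
      fix r assume "r \<in> {r. odd r \<and> 4 * int n - r\<^sup>2 \<ge> 0}"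
      then have r: "odd r" "4 * int n - r\<^sup>2 \<ge> 0" by auto
      have "of_nat (card (theta_fibre (int n) r)) = complex_of_real (real (card (theta_fibre (int n) r)))" by simp
      also have "\<dots> = 12 * complex_of_real (hurwitz_class_number (4 * int n - r\<^sup>2))"
        unfolding card_theta_fibre_odd[OF n r] by simp
      finally show "h r = - (12 * complex_of_real (hurwitz_class_number (4 * int n - r\<^sup>2)) * \<zeta> powi (2 * r))"
        unfolding h_def using r(1) by simp
    qed (auto simp: R_def)
    finally show "(\<Sum>v | v \<in> UNIV \<and> nat (theta_deg v) = n. G v)
        = ((\<Sum>r | even r \<and> 4 * int n - r\<^sup>2 \<ge> 0.
          12 * complex_of_real (hurwitz_class_number2 (4 * int n - r\<^sup>2)) * \<zeta> powi (2 * r))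
       - (\<Sum>r | odd r \<and> 4 * int n - r\<^sup>2 \<ge> 0.
          12 * complex_of_real (hurwitz_class_number (4 * int n - r\<^sup>2)) * \<zeta> powi (2 * r))) * q ^ n"
      unfolding fib by (simp add: sum_negf)
  qed auto
qed

end
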